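(* Let $n\ge 1$, $\sigma^2>0$, and consider the real scalar fast fading channel $Y_i=H_iX_i+Z_i$ described in the context, where the fading coefficients $H_i$ are i.i.d. with a regular fading distribution. Let $\epsilon>0$ be a fixed error probability and let $\delta^*(n,\epsilon)$ be the supremum of the NLDs of $n$-dimensional infinite constellations whose average error probability is at most $\epsilon$. Then, as $n\to\infty$, $$\delta^*(n,\epsilon)=\delta^*-\sqrt{\frac{V}{n}}\,Q^{-1}(\epsilon)+O\!\left(\frac{\ln n}{n}\right),$$ where, with $\delta(H)=\frac12\ln\!\left(\frac{H^2}{2\pi e\sigma^2}\right)$, $$\delta^*=E\{\delta(H)\}=E\left\{\tfrac12\ln\!\left(\tfrac{H^2}{2\pi e\sigma^2}\right)\right\},\qquad V=\tfrac12+\mathrm{Var}(\delta(H))=\tfrac12+\mathrm{Var}\!\left(\tfrac12\ln(H^2)\right).$$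
   Context: Channel: $Y_i=H_iX_i+Z_i$, $i=1,2,\dots$, where $\{H_i\}$ are i.i.d. nonnegative fading coefficients with $E\{H_i^2\}=1$, $\{Z_i\}$ are i.i.d. $N(0,\sigma^2)$, and inputs, fading and noise are mutually independent; the receiver knows $\mathbf H=\mathrm{diag}(H_1,\dots,H_n)$ (perfect CSI). In vector form $\mathbf y=\mathbf H\mathbf x+\mathbf z$. A fading PDF $f$ is a regular fading distribution if there is a constant $\alpha>0$ with $f(h)\propto h^{\alpha-1}$ for all sufficiently small $h>0$. An $n$-dimensional infinite constellation (IC) is a countable set $S\subset\mathbb R^n$. Let $\mathrm{Cb}(a)=\{\mathbf x\in\mathbb R^n:|x_i|<a/2\ \forall i\}$, $M(S,a)=|S\cap\mathrm{Cb}(a)|$, density $\gamma=\limsup_{a\to\infty}M(S,a)/a^n$, and normalized log density (NLD) $\delta=\frac1n\ln\gamma$. Given $\mathbf H$, the received IC is $S_{\mathbf H}=\{\mathbf Hs:s\in S\}$; for $s_{rc}\in S_{\mathbf H}$, $P_e(s_{rc}\mid\mathbf H)=\Pr\{s_{rc}+\mathbf z\notin W(s_{rc})\mid \mathbf H\}$, where $W(s_{rc})$ is the Voronoi cell of $s_{rc}$ in $S_{\mathbf H}$ (ML decoding). The average error probability is $P_e(S)=E\left\{\limsup_{a\to\infty}\frac{1}{M(S_{\mathbf H},a)}\sum_{s_{rc}\in S_{\mathbf H}\cap\mathbf H\cdot\mathrm{Cb}(a)}P_e(s_{rc}\mid\mathbf H)\right\}$, with $M(S_{\mathbf H},a)=|S_{\mathbf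 H}\cap \mathbf H\cdot\mathrm{Cb}(a)|$ and the expectation over $\mathbf H$. $Q$ is the standard Gaussian complementary CDF. *)

theory Defs
  imports "HOL-Probability.Probability"
begin

text \<open>Points of R^n are represented as extensional functions nat => real
  (members of PiE {..<n} (%_. UNIV)), coordinates indexed by i < n.\<close>

definition distn :: "nat \<Rightarrow> (nat \<Rightarrow> real) \<Rightarrow> (nat \<Rightarrow> real) \<Rightarrow> real" where
  "distn n x y = sqrt (\<Sum>i<n. (x i - y i)^2)"

definition is_IC :: "nat \<Rightarrow> (nat \<Rightarrow> real) set \<Rightarrow> bool" where
  "is_IC n S \<longleftrightarrow> countable S \<and> S \<subseteq> PiE {..<n} (\<lambda>_. UNIV)"

definition cube :: "nat \<Rightarrow> real \<Rightarrow> (nat \<Rightarrow> real) set" where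
  "cube n a = {x \<in> PiE {..<n} (\<lambda>_. UNIV). \<forall>i<n. \<bar>x i\<bar> < a / 2}"

definition Mcount :: "nat \<Rightarrow> (nat \<Rightarrow> real) set \<Rightarrow> real \<Rightarrow> nat" where
  "Mcount n S a = card (S \<inter> cube n a)"

definition IC_density :: "nat \<Rightarrow> (nat \<Rightarrow> real) set \<Rightarrow> ereal" where
  "IC_density n S = Limsup at_top (\<lambda>a::real. ereal (real (Mcount n S a) / a ^ n))"

definition NLD :: "nat \<Rightarrow> (nat \<Rightarrow> real) set \<Rightarrow> ereal" where
  "NLD n S = (let g = IC_density n S in
     if g = 0 then -\<infinity> else if g = \<infinity> then \<infinity> else ereal (ln (real_of_ereal g) / real n))"

definition scale :: "nat \<Rightarrow> (nat \<Rightarrow> real) \<Rightarrow> (nat \<Rightarrow> real) \<Rightarrow> (nat \<Rightarrow> real)" where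
  "scale n H s = restrict (\<lambda>i. H i * s i) {..<n}"

definition voronoi :: "nat \<Rightarrow> (nat \<Rightarrow> real) set \<Rightarrow> (nat \<Rightarrow> real) \<Rightarrow> (nat \<Rightarrow> real) set" where
  "voronoi n T t = {y. \<forall>t'\<in>T. distn n y t \<le> distn n y t'}"

definition noise :: "nat \<Rightarrow> real \<Rightarrow> (nat \<Rightarrow> real) measure" where
  "noise n \<sigma> = PiM {..<n} (\<lambda>_. density lborel (\<lambda>z. ennreal (normal_density 0 \<sigma> z)))"

definition fading :: "nat \<Rightarrow> (real \<Rightarrow> real) \<Rightarrow> (nat \<Rightarrow> real) measure" where
  "fading n f = PiM {..<n} (\<lambda>_. density lborel (\<lambda>h. ennreal (f h)))"

definition Pe_cond :: "nat \<Rightarrow> real \<Rightarrow> (nat \<Rightarrow> real) set \<Rightarrow> (nat \<Rightarrow> real) \<Rightarrow> real" where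
  "Pe_cond n \<sigma> T t = measure (noise n \<sigma>)
     {z \<in> space (noise n \<sigma>). restrict (\<lambda>i. t i + z i) {..<n} \<notin> voronoi n T t}"

definition Pe_avg :: "nat \<Rightarrow> real \<Rightarrow> (real \<Rightarrow> real) \<Rightarrow> (nat \<Rightarrow> real) set \<Rightarrow> ennreal" where
  "Pe_avg n \<sigma> f S = (\<integral>\<^sup>+ H. Limsup at_top (\<lambda>a::real.
      ennreal ((\<Sum>t \<in> scale n H ` S \<inter> scale n H ` cube n a. Pe_cond n \<sigma> (scale n H ` S) t)
               / real (card (scale n H ` S \<inter> scale n H ` cube n a)))) \<partial>fading n f)"

definition delta_opt :: "nat \<Rightarrow> real \<Rightarrow> (real \<Rightarrow> real) \<Rightarrow> real \<Rightarrow> ereal" where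
  "delta_opt n \<sigma> f \<epsilon> = Sup {NLD n S | S. is_IC n S \<and> Pe_avg n \<sigma> f S \<le> ennreal \<epsilon>}"

definition fading_pdf :: "(real \<Rightarrow> real) \<Rightarrow> bool" where
  "fading_pdf f \<longleftrightarrow> f \<in> borel_measurable borel \<and> (\<forall>h. 0 \<le> f h) \<and> (\<forall>h<0. f h = 0)
     \<and> (\<integral>\<^sup>+ h. ennreal (f h) \<partial>lborel) = 1
     \<and> (\<integral>\<^sup>+ h. ennreal (h^2 * f h) \<partial>lborel) = 1"

definition regular_fading :: "(real \<Rightarrow> real) \<Rightarrow> bool" where
  "regular_fading f \<longleftrightarrow> (\<exists>\<alpha>>0. \<exists>c>0. \<exists>h0>0. \<forall>h. 0 < h \<and> h < h0 \<longrightarrow> f h = c * h powr (\<alpha> - 1))"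

definition delta_H :: "real \<Rightarrow> real \<Rightarrow> real" where
  "delta_H \<sigma> h = 1/2 * ln (h^2 / (2 * pi * exp 1 * \<sigma>^2))"

definition delta_star :: "real \<Rightarrow> (real \<Rightarrow> real) \<Rightarrow> real" where
  "delta_star \<sigma> f = (\<integral>h. delta_H \<sigma> h \<partial>density lborel (\<lambda>h. ennreal (f h)))"

definition dispersion :: "real \<Rightarrow> (real \<Rightarrow> real) \<Rightarrow> real" where
  "dispersion \<sigma> f = 1/2 + (\<integral>h. (delta_H \<sigma> h - delta_star \<sigma> f)^2 \<partial>density lborel (\<lambda>h. ennreal (f h)))"

definition Qfun :: "real \<Rightarrow> real" where
  "Qfun x = measure (density lborel (\<lambda>t. ennreal (std_normal_density t))) {x<..}"

definition Qinv :: "real \<Rightarrow> real" where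
  "Qinv e = (THE x. Qfun x = e)"

end

theory Submission
  imports Defs
begin

text \<open>Given the fading, let \<open>exp (info H z)\<close> be the noise density at \<open>z\<close> times the determinant of the fading
  matrix; \<open>info\<close> is a sum of \<open>n\<close> i.i.d. terms of mean \<open>delta_star\<close> and variance \<open>dispersion\<close>.

  Converse: the part of the noise where the density is at most \<open>\<tau>\<close> puts mass at most \<open>\<tau>\<close> times the volume on a
  Voronoi cell, and the cells of the points in a large cube have an average volume of at most about the inverse
  density. Hence the error probability is at least the probability that \<open>info\<close> is below the log density, up to
  \<open>O(ln n)\<close> in the threshold and \<open>1 / sqrt n\<close> in the probability.

  Direct part: the constellation \<open>{k v + a m}\<close> with \<open>0 \<le> k < M\<close> and \<open>m\<close> an integer vector is periodic, and for each
  \<open>l \<noteq> 0\<close> the point \<open>l v\<close> is uniform on the torus when \<open>v\<close> is. By the union bound every point has, on average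
  over \<open>v\<close>, at most \<open>2 M / a ^ n\<close> times the volume of \<open>{x. density (z - H x) \<ge> density z}\<close> competitors, and by
  Markov's inequality this volume is at most \<open>exp (- info)\<close>. So the same tail of \<open>info\<close> bounds the error from above.

  Finally, a Berry--Esseen estimate for \<open>info\<close> turns both bounds into the expansion.\<close>

section \<open>Lebesgue measure and Gaussian noise in coordinates\<close>

text \<open>All slack is budgeted at the scale of the claimed remainder. A change of order ln n /
  sqrt n in probability moves a quantile of the normalised \<open>info\<close> by the same order,
  hence the NLD by O(ln n / n). Losses of 1 / sqrt n and a Berry--Esseen bound with an extra
  logarithm are therefore affordable. Regularity of the fading controls the mass near 0 and gives
  \<open>delta_H\<close> a fourth moment. The constellation is fixed before the fading is known, so
  the random offset is averaged over the joint law of H and z and one offset serves all fadings.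
  With multiples of a single v, the difference of two points is again a multiple of v modulo the
  lattice; one error bound then holds for every point, and averaging over cubes costs nothing.
  Lattice translates of a point are not randomised by v; they are pushed away by taking a large at
  fixed M / a ^ n and fixed n. In the converse, points near the faces of a cube may have unbounded
  cells, so very large noise is discarded before volumes are compared.\<close>

abbreviation Leb :: "nat \<Rightarrow> (nat \<Rightarrow> real) measure" where
  "Leb n \<equiv> PiM {..<n} (\<lambda>_. lborel)"

interpretation lborel_product: product_sigma_finite "\<lambda>_::nat. lborel :: real measure"
  by standard

text \<open>Both measures are determined by their values on boxes, where the claim factors into the
  one-dimensional substitution rule. It serves twice: with slope \<open>1/\<theta>\<close> to shrink
  cells and with slope \<open>l\<close> to wind around the torus.\<close>

lemma Leb_affine:
  fixes t c :: "nat \<Rightarrow> real"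
  assumes c: "\<And>i. i < n \<Longrightarrow> c i \<noteq> 0"
  shows "density (distr (Leb n) (Leb n) (\<lambda>x. \<lambda>i\<in>{..<n}. t i + c i * x i))
           (\<lambda>_. \<Prod>i<n. ennreal \<bar>c i\<bar>) = Leb n" (is "?M = _")
proof (rule lborel_product.PiM_eqI)
  have meas[measurable]: "(\<lambda>x. \<lambda>i\<in>{..<n}. t i + c i * x i) \<in> measurable (Leb n) (Leb n)"
    by measurable
  fix A :: "nat \<Rightarrow> real set" assume A: "\<And>i. i \<in> {..<n} \<Longrightarrow> A i \<in> sets lborel"
  have PA[measurable]: "PiE {..<n} A \<in> sets (Leb n)"
    using A by (intro sets_PiM_I_finite) auto
  have "emeasure ?M (PiE {..<n} A)
      = (\<Prod>i<n. ennreal \<bar>c i\<bar>) * emeasure (distr (Leb n) (Leb n) (\<lambda>x. \<lambda>i\<in>{..<n}. t i + c i * x i)) (PiE {..<n} A)"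
    by (simp add: emeasure_density nn_integral_cmult)
  also have "emeasure (distr (Leb n) (Leb n) (\<lambda>x. \<lambda>i\<in>{..<n}. t i + c i * x i)) (PiE {..<n} A)
      = emeasure (Leb n) (PiE {..<n} (\<lambda>i. (\<lambda>x. t i + c i * x) -` A i))"
    by (subst emeasure_distr) (auto intro!: arg_cong2[where f=emeasure] simp: space_PiM PiE_iff extensional_def)
  also have "\<dots> = (\<Prod>i<n. emeasure lborel ((\<lambda>x. t i + c i * x) -` A i))"
    using A by (subst lborel_product.emeasure_PiM)
      (auto intro!: measurable_sets_borel[of _ borel] )
  also have "(\<Prod>i<n. ennreal \<bar>c i\<bar>) * \<dots> = (\<Prod>i<n. ennreal \<bar>c i\<bar> * emeasure lborel ((\<lambda>x. t i + c i * x) -` A i))"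
    by (simp add: prod.distrib)
  also have "\<dots> = (\<Prod>i<n. emeasure lborel (A i))"
  proof (intro prod.cong refl)
    fix i assume "i \<in> {..<n}"
    with A c have Ai[measurable]: "A i \<in> sets borel" and ci: "c i \<noteq> 0" by auto
    have "emeasure lborel (A i) = (\<integral>\<^sup>+x. indicator (A i) x \<partial>lborel)" by simp
    also have "\<dots> = ennreal \<bar>c i\<bar> * (\<integral>\<^sup>+x. indicator (A i) (t i + c i * x) \<partial>lborel)"
      using ci by (subst nn_integral_real_affine[where t="t i" and c="c i"]) auto
    also have "(\<integral>\<^sup>+x. indicator (A i) (t i + c i * x) \<partial>lborel) = emeasure lborel ((\<lambda>x. t i + c i * x) -` A i)"
      by (subst nn_integral_indicator[symmetric]) (auto intro!: nn_integral_cong measurable_sets_borel[of _ borel] split: split_indicator)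
    finally show "ennreal \<bar>c i\<bar> * emeasure lborel ((\<lambda>x. t i + c i * x) -` A i) = emeasure lborel (A i)" ..
  qed
  finally show "emeasure ?M (PiE {..<n} A) = (\<Prod>i<n. emeasure lborel (A i))" .
qed auto

lemma nn_integral_Leb_affine:
  fixes t c :: "nat \<Rightarrow> real"
  assumes c: "\<And>i. i < n \<Longrightarrow> c i \<noteq> 0" and F[measurable]: "F \<in> borel_measurable (Leb n)"
  shows "(\<Prod>i<n. ennreal \<bar>c i\<bar>) * (\<integral>\<^sup>+x. F (\<lambda>i\<in>{..<n}. t i + c i * x i) \<partial>Leb n) = (\<integral>\<^sup>+x. F x \<partial>Leb n)"
proof -
  have "(\<integral>\<^sup>+x. F x \<partial>Leb n) = (\<integral>\<^sup>+x. F x \<partial>density (distr (Leb n) (Leb n) (\<lambda>x. \<lambda>i\<in>{..<n}. t i + c i * x i))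
           (\<lambda>_. \<Prod>i<n. ennreal \<bar>c i\<bar>))"
    by (subst Leb_affine[of n c t]) (use c in auto)
  also have "\<dots> = (\<Prod>i<n. ennreal \<bar>c i\<bar>) * (\<integral>\<^sup>+x. F (\<lambda>i\<in>{..<n}. t i + c i * x i) \<partial>Leb n)"
    by (subst nn_integral_density) (auto simp: nn_integral_cmult nn_integral_distr)
  finally show ?thesis ..
qed

definition noise_density :: "nat \<Rightarrow> real \<Rightarrow> (nat \<Rightarrow> real) \<Rightarrow> real" where
  "noise_density n \<sigma> z = (\<Prod>i<n. normal_density 0 \<sigma> (z i))"

lemma noise_density_measurable[measurable]: "noise_density n \<sigma> \<in> borel_measurable (PiM {..<n} (\<lambda>_. borel))"
  unfolding noise_density_def by measurable

lemma PiM_density_lborel: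
  fixes g :: "real \<Rightarrow> ennreal"
  assumes [measurable]: "g \<in> borel_measurable borel" and "prob_space (density lborel g)"
  shows "PiM {..<n} (\<lambda>_. density lborel g) = density (Leb n) (\<lambda>z. \<Prod>i<n. g (z i))"
proof -
  interpret P: prob_space "density lborel g" by fact
  interpret Q: product_sigma_finite "\<lambda>_::nat. density lborel g" by standard
  show ?thesis
  proof (rule Q.PiM_eqI[symmetric])
    fix A :: "nat \<Rightarrow> real set" assume A: "\<And>i. i \<in> {..<n} \<Longrightarrow> A i \<in> sets (density lborel g)"
    have PA[measurable]: "PiE {..<n} A \<in> sets (Leb n)"
      using A by (intro sets_PiM_I_finite) auto
    have "emeasure (density (Leb n) (\<lambda>z. \<Prod>i<n. g (z i))) (PiE {..<n} A)
        = (\<integral>\<^sup>+z. (\<Prod>i<n. g (z i)) * indicator (PiE {..<n} A) z \<partial>Leb n)"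
      by (simp add: emeasure_density)
    also have "\<dots> = (\<integral>\<^sup>+z. (\<Prod>i<n. g (z i) * indicator (A i) (z i)) \<partial>Leb n)"
    proof (rule nn_integral_cong)
      fix z assume "z \<in> space (Leb n)"
      then have "indicator (PiE {..<n} A) z = (\<Prod>i<n. indicator (A i) (z i) :: ennreal)"
        by (auto simp: indicator_def space_PiM PiE_iff prod_zero_iff split: if_splits)
      then show "(\<Prod>i<n. g (z i)) * indicator (PiE {..<n} A) z = (\<Prod>i<n. g (z i) * indicator (A i) (z i))"
        by (simp add: prod.distrib)
    qed
    also have "\<dots> = (\<Prod>i<n. \<integral>\<^sup>+x. g x * indicator (A i) x \<partial>lborel)"
      using A by (subst lborel_product.product_nn_integral_prod) auto
    also have "\<dots> = (\<Prod>i<n. emeasure (density lborel g) (A i))"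
      using A by (intro prod.cong) (auto simp: emeasure_density)
    finally show "emeasure (density (Leb n) (\<lambda>z. \<Prod>i<n. g (z i))) (PiE {..<n} A)
      = (\<Prod>i<n. emeasure (density lborel g) (A i))" .
  qed (auto intro!: sets_PiM_cong)
qed

lemma noise_eq_density:
  assumes "\<sigma> > 0"
  shows "noise n \<sigma> = density (Leb n) (\<lambda>z. ennreal (noise_density n \<sigma> z))"
  unfolding noise_def noise_density_def
  by (subst PiM_density_lborel) (auto simp: prob_space_normal_density assms prod_ennreal)

lemma prob_space_noise: "\<sigma> > 0 \<Longrightarrow> prob_space (noise n \<sigma>)"
  unfolding noise_def by (intro prob_space_PiM prob_space_normal_density)

lemma sets_noise[measurable_cong]: "sets (noise n \<sigma>) = sets (PiM {..<n} (\<lambda>_. borel))"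
  unfolding noise_def by (intro sets_PiM_cong) auto

lemma space_noise: "space (noise n \<sigma>) = PiE {..<n} (\<lambda>_. UNIV)"
  unfolding noise_def by (simp add: space_PiM)

lemma emeasure_noise_le:
  assumes "\<sigma> > 0" and [measurable]: "B \<in> sets (Leb n)" and \<tau>: "\<And>z. z \<in> B \<Longrightarrow> noise_density n \<sigma> z \<le> \<tau>"
  shows "emeasure (noise n \<sigma>) B \<le> ennreal \<tau> * emeasure (Leb n) B"
proof -
  have "emeasure (noise n \<sigma>) B = (\<integral>\<^sup>+z. ennreal (noise_density n \<sigma> z) * indicator B z \<partial>Leb n)"
    unfolding noise_eq_density[OF assms(1)] by (simp add: emeasure_density)
  also have "\<dots> \<le> (\<integral>\<^sup>+z. ennreal \<tau> * indicator B z \<partial>Leb n)"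
    using \<tau> by (intro nn_integral_mono) (auto split: split_indicator intro!: ennreal_leI)
  finally show ?thesis by (simp add: nn_integral_cmult)
qed

lemma noise_density_pos: "\<sigma> > 0 \<Longrightarrow> 0 < noise_density n \<sigma> z"
  unfolding noise_density_def by (intro prod_pos) (auto intro: normal_density_pos)

lemma noise_density_eq:
  assumes "\<sigma> > 0"
  shows "noise_density n \<sigma> z = (1 / sqrt (2 * pi * \<sigma>\<^sup>2)) ^ n * exp (- (\<Sum>i<n. (z i)\<^sup>2) / (2 * \<sigma>\<^sup>2))"
  unfolding noise_density_def normal_density_def
  by (simp add: prod.distrib exp_sum[symmetric] sum_divide_distrib sum_negf power_divide prod_dividef power_one_over flip: exp_sum)

text \<open>As a function of \<open>x\<close> the integrand is a Gaussian density up to the Jacobian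
  of \<open>H\<close>, so the integral is free of \<open>z\<close>. It supplies the expectation in
  the Markov step of \<open>confusable_volume\<close>.\<close>

lemma nn_integral_noise_density_affine:
  assumes "\<sigma> > 0" and H: "\<And>i. i < n \<Longrightarrow> H i > 0"
  shows "(\<integral>\<^sup>+x. ennreal (noise_density n \<sigma> (\<lambda>i. z i - H i * x i)) \<partial>Leb n) = ennreal (1 / (\<Prod>i<n. H i))"
proof -
  interpret N: prob_space "density lborel (\<lambda>z. ennreal (normal_density 0 \<sigma> z))"
    by (rule prob_space_normal_density[OF assms(1)])
  have "(\<integral>\<^sup>+x. ennreal (noise_density n \<sigma> (\<lambda>i. z i - H i * x i)) \<partial>Leb n)
     = (\<integral>\<^sup>+x. (\<Prod>i<n. ennreal (normal_density 0 \<sigma> (z i - H i * x i))) \<partial>Leb n)"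
    by (simp add: noise_density_def prod_ennreal)
  also have "\<dots> = (\<Prod>i<n. \<integral>\<^sup>+x. ennreal (normal_density 0 \<sigma> (z i - H i * x)) \<partial>lborel)"
    by (subst lborel_product.product_nn_integral_prod) auto
  also have "\<dots> = (\<Prod>i<n. ennreal (1 / H i))"
  proof (intro prod.cong refl)
    fix i assume "i \<in> {..<n}" then have Hi: "H i > 0" using H by auto
    have "1 = (\<integral>\<^sup>+x. ennreal (normal_density 0 \<sigma> x) \<partial>lborel)"
      using N.emeasure_space_1 by (simp add: emeasure_density)
    also have "\<dots> = ennreal \<bar>- H i\<bar> * (\<integral>\<^sup>+x. ennreal (normal_density 0 \<sigma> (z i + (- H i) * x)) \<partial>lborel)"
      using Hi by (intro nn_integral_real_affine) auto
    finally have 1: "1 = ennreal (H i) * (\<integral>\<^sup>+x. ennreal (normal_density 0 \<sigma> (z i - H i * x)) \<partial>lborel)"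
      using Hi by simp
    have "(\<integral>\<^sup>+x. ennreal (normal_density 0 \<sigma> (z i - H i * x)) \<partial>lborel)
       = ennreal (1 / H i) * (ennreal (H i) * (\<integral>\<^sup>+x. ennreal (normal_density 0 \<sigma> (z i - H i * x)) \<partial>lborel))"
      using Hi by (simp add: mult.assoc[symmetric] ennreal_mult[symmetric])
    with 1 show "(\<integral>\<^sup>+x. ennreal (normal_density 0 \<sigma> (z i - H i * x)) \<partial>lborel) = ennreal (1 / H i)"
      by simp
  qed
  also have "\<dots> = ennreal (\<Prod>i<n. 1 / H i)" using H by (intro prod_ennreal) (auto simp: less_imp_le)
  finally show ?thesis by (simp add: prod_dividef)
qed

section \<open>Volumes of cells and the converse bound\<close>

lemma sum_squares_measurable[measurable]:
  "(\<lambda>z. \<Sum>i<n. (z i)\<^sup>2 :: real) \<in> borel_measurable (PiM {..<n} (\<lambda>_. borel))"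
  by measurable

text \<open>\<open>K t\<close> is a cell in coordinates centred at \<open>t\<close>; the shrunken
  cell is \<open>t + \<theta> K t\<close>. After the squares of \<open>z\<close> cancel, the cell
  inequality is affine in \<open>z\<close>. Adding the inequalities of \<open>t\<close> against
  \<open>t'\<close> and of \<open>t'\<close> against \<open>t\<close> at a common point of both
  shrunken cells leaves a negative multiple of the squared distance of the centres, so the shrunken
  cells are disjoint and their volumes add up inside the box.\<close>

lemma shrunk_cells_volume:
  fixes K :: "(nat \<Rightarrow> real) \<Rightarrow> (nat \<Rightarrow> real) set"
  assumes "finite A" and A: "A \<subseteq> PiE {..<n} (\<lambda>_. UNIV)" and lam: "0 < \<theta>" "\<theta> < 1"
    and K: "\<And>t. t \<in> A \<Longrightarrow> K t \<in> sets (Leb n)"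
    and cell: "\<And>t t' z. t \<in> A \<Longrightarrow> t' \<in> A \<Longrightarrow> z \<in> K t \<Longrightarrow> (\<Sum>i<n. (z i)\<^sup>2) \<le> (\<Sum>i<n. (t i + z i - t' i)\<^sup>2)"
    and bt: "\<And>t i. t \<in> A \<Longrightarrow> i < n \<Longrightarrow> \<bar>t i\<bar> \<le> b i"
    and bz: "\<And>t z i. t \<in> A \<Longrightarrow> z \<in> K t \<Longrightarrow> i < n \<Longrightarrow> \<bar>t i + z i\<bar> \<le> b i"
    and b0: "\<And>i. i < n \<Longrightarrow> 0 \<le> b i"
  shows "ennreal (\<theta> ^ n) * (\<Sum>t\<in>A. emeasure (Leb n) (K t)) \<le> ennreal (\<Prod>i<n. 2 * b i)"
proof -
  \<comment> \<open>\<open>g t\<close> inverts the contraction from \<open>z\<close> to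
    \<open>t + \<theta> * z\<close>, so \<open>J t\<close> is the shrunken cell in absolute
    coordinates.\<close>
  define g where "g t y = (\<lambda>i\<in>{..<n}. - t i / \<theta> + (1/\<theta>) * y i)" for t y :: "nat \<Rightarrow> real"
  define J where "J t = g t -` K t \<inter> space (Leb n)" for t
  have gm[measurable]: "g t \<in> measurable (Leb n) (Leb n)" for t
    unfolding g_def by measurable
  have J: "J t \<in> sets (Leb n)" if "t \<in> A" for t
    unfolding J_def using K[OF that] by measurable
  have vol: "emeasure (Leb n) (J t) = ennreal (\<theta> ^ n) * emeasure (Leb n) (K t)" if t: "t \<in> A" for t
  proof -
    note [measurable] = K[OF t]
    have "emeasure (Leb n) (K t) = ennreal ((1/\<theta>) ^ n) * (\<integral>\<^sup>+y. indicator (K t) (g t y) \<partial>Leb n)"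
      using lam nn_integral_Leb_affine[of n "\<lambda>_. 1/\<theta>" "indicator (K t)" "\<lambda>i. - t i / \<theta>"]
      by (simp add: g_def ennreal_power)
    also have "(\<integral>\<^sup>+y. indicator (K t) (g t y) \<partial>Leb n) = emeasure (Leb n) (J t)"
    proof -
      have "(\<integral>\<^sup>+y. indicator (K t) (g t y) \<partial>Leb n) = (\<integral>\<^sup>+y. indicator (J t) y \<partial>Leb n)"
        by (intro nn_integral_cong) (auto simp: J_def split: split_indicator)
      with J[OF t] show ?thesis by simp
    qed
    finally have "ennreal (\<theta> ^ n) * emeasure (Leb n) (K t)
        = ennreal (\<theta>^n * (1/\<theta>) ^ n) * emeasure (Leb n) (J t)"
      using lam by (simp add: ennreal_mult mult.assoc)
    also have "\<theta>^n * (1/\<theta>) ^ n = 1" using lam by (simp add: power_mult_distrib[symmetric])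
    finally show ?thesis by simp
  qed
  have disj: "disjoint_family_on J A"
    unfolding disjoint_family_on_def
  proof (intro ballI impI equals0I)
    fix t t' y assume t: "t \<in> A" and t': "t' \<in> A" and ne: "t \<noteq> t'" and y: "y \<in> J t \<inter> J t'"
    \<comment> \<open>The cell inequality of \<open>s\<close> against \<open>s'\<close> at the point
      \<open>(y - s) / \<theta>\<close>, multiplied by \<open>\<theta>\<close>.\<close>
    have half: "0 \<le> (\<Sum>i<n. 2 * (y i - s i) * (s i - s' i) + \<theta> * (s i - s' i)\<^sup>2)"
      if s: "s \<in> A" "s' \<in> A" "y \<in> J s" for s s'
    proof -
      have "(\<Sum>i<n. (g s y i)\<^sup>2) \<le> (\<Sum>i<n. (s i + g s y i - s' i)\<^sup>2)"
        using s by (intro cell) (auto simp: J_def)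
      then have "0 \<le> \<theta> * (\<Sum>i<n. (s i + g s y i - s' i)\<^sup>2 - (g s y i)\<^sup>2)"
        using lam by (simp add: sum_subtractf)
      also have "\<dots> = (\<Sum>i<n. 2 * (y i - s i) * (s i - s' i) + \<theta> * (s i - s' i)\<^sup>2)"
        unfolding sum_distrib_left
        by (intro sum.cong refl) (use lam in \<open>simp add: g_def field_simps power2_eq_square\<close>)
      finally show ?thesis .
    qed
    have "0 \<le> (\<Sum>i<n. 2 * (y i - t i) * (t i - t' i) + \<theta> * (t i - t' i)\<^sup>2)
        + (\<Sum>i<n. 2 * (y i - t' i) * (t' i - t i) + \<theta> * (t' i - t i)\<^sup>2)"
      using half[of t t'] half[of t' t] t t' y by auto
    also have "\<dots> = (\<Sum>i<n. - (2 * (1 - \<theta>)) * (t i - t' i)\<^sup>2)"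
      by (subst sum.distrib[symmetric], intro sum.cong refl) (simp add: algebra_simps power2_eq_square)
    also have "\<dots> = - (2 * (1 - \<theta>)) * (\<Sum>i<n. (t i - t' i)\<^sup>2)"
      by (simp only: sum_distrib_left)
    finally have "\<not> 0 < (\<Sum>i<n. (t i - t' i)\<^sup>2)"
      using mult_neg_pos[of "- (2 * (1 - \<theta>))" "\<Sum>i<n. (t i - t' i)\<^sup>2"] lam
      by (metis diff_gt_0_iff_gt mult_pos_pos neg_less_0_iff_less not_le zero_less_numeral)
    moreover have "0 \<le> (\<Sum>i<n. (t i - t' i)\<^sup>2)" by (intro sum_nonneg) auto
    ultimately have "(\<Sum>i<n. (t i - t' i)\<^sup>2) = 0" by linarith
    then have "\<And>i. i \<in> {..<n} \<Longrightarrow> t i = t' i" by (subst (asm) sum_nonneg_eq_0_iff) auto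
    with t t' A have "t = t'" by (intro PiE_ext[of t "{..<n}" "\<lambda>_. UNIV" t']) auto
    with ne show False by simp
  qed
  have sub: "J t \<subseteq> PiE {..<n} (\<lambda>i. {- b i..b i})" if t: "t \<in> A" for t
  proof
    fix y assume y: "y \<in> J t"
    have "y i \<in> {- b i..b i}" if i: "i < n" for i
    proof -
      have gi: "\<bar>t i + g t y i\<bar> \<le> b i" using y t i by (intro bz) (auto simp: J_def)
      \<comment> \<open>A convex combination of the centre and a point of the cell, both of which
        lie in the box.\<close>
      have "y i = (1 - \<theta>) * t i + \<theta> * (t i + g t y i)"
        using lam i by (simp add: g_def field_simps)
      then have "\<bar>y i\<bar> \<le> (1 - \<theta>) * \<bar>t i\<bar> + \<theta> * \<bar>t i + g t y i\<bar>"
        using lam abs_triangle_ineq[of "(1 - \<theta>) * t i" "\<theta> * (t i + g t y i)"] by (simp add: abs_mult)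
      also have "\<dots> \<le> (1 - \<theta>) * b i + \<theta> * b i"
        using lam gi bt[OF t i] by (intro add_mono mult_left_mono) auto
      finally show ?thesis by (auto simp: algebra_simps)
    qed
    moreover have "y \<in> PiE {..<n} (\<lambda>_. UNIV)" using y by (simp add: J_def space_PiM)
    ultimately show "y \<in> PiE {..<n} (\<lambda>i. {- b i..b i})" by (auto simp: PiE_iff)
  qed
  have "ennreal (\<theta> ^ n) * (\<Sum>t\<in>A. emeasure (Leb n) (K t)) = (\<Sum>t\<in>A. emeasure (Leb n) (J t))"
    by (simp add: sum_distrib_left vol)
  also have "\<dots> = emeasure (Leb n) (\<Union>t\<in>A. J t)"
    using J disj \<open>finite A\<close> by (intro sum_emeasure) auto
  also have "\<dots> \<le> emeasure (Leb n) (PiE {..<n} (\<lambda>i. {- b i..b i}))"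
    using sub by (intro emeasure_mono sets_PiM_I_finite) auto
  also have "\<dots> = ennreal (\<Prod>i<n. 2 * b i)"
    using b0 by (subst lborel_product.emeasure_PiM) (auto intro!: prod_ennreal)
  finally show ?thesis .
qed

text \<open>Cells overlap in their boundaries; shrinking each cell towards its centre makes them disjoint,
  which replaces an argument that the boundaries are null sets.\<close>

lemma cells_volume:
  fixes K :: "(nat \<Rightarrow> real) \<Rightarrow> (nat \<Rightarrow> real) set"
  assumes "finite A" and A: "A \<subseteq> PiE {..<n} (\<lambda>_. UNIV)"
    and K: "\<And>t. t \<in> A \<Longrightarrow> K t \<in> sets (Leb n)"
    and cell: "\<And>t t' z. t \<in> A \<Longrightarrow> t' \<in> A \<Longrightarrow> z \<in> K t \<Longrightarrow> (\<Sum>i<n. (z i)\<^sup>2) \<le> (\<Sum>i<n. (t i + z i - t' i)\<^sup>2)"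
    and bt: "\<And>t i. t \<in> A \<Longrightarrow> i < n \<Longrightarrow> \<bar>t i\<bar> \<le> b i"
    and bz: "\<And>t z i. t \<in> A \<Longrightarrow> z \<in> K t \<Longrightarrow> i < n \<Longrightarrow> \<bar>t i + z i\<bar> \<le> b i"
    and b0: "\<And>i. i < n \<Longrightarrow> 0 \<le> b i"
  shows "(\<Sum>t\<in>A. emeasure (Leb n) (K t)) \<le> ennreal (\<Prod>i<n. 2 * b i)"
proof -
  let ?S = "\<Sum>t\<in>A. emeasure (Leb n) (K t)"
  have le: "ennreal (\<theta> ^ n) * ?S \<le> ennreal (\<Prod>i<n. 2 * b i)" if "0 < \<theta>" "\<theta> < 1" for \<theta>
    using assms(1,2) that by (rule shrunk_cells_volume) (fact K cell bt bz b0)+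
  \<comment> \<open>A fixed factor below 1 already bounds the sum; with finiteness the limit
    \<open>\<theta>\<close> to 1 can be taken in the reals.\<close>
  have "?S \<noteq> \<infinity>"
  proof
    assume "?S = \<infinity>"
    with le[of "1/2"] show False
      by (auto simp: ennreal_mult_top top_unique simp flip: ennreal_power)
  qed
  then obtain s where s: "?S = ennreal s" "0 \<le> s" by (cases ?S) auto
  have P0: "0 \<le> (\<Prod>i<n. 2 * b i)" using b0 by (intro prod_nonneg) auto
  have "((\<lambda>\<theta>. \<theta> ^ n * s) \<longlongrightarrow> 1 ^ n * s) (at_left (1::real))"
    by (intro tendsto_intros)
  moreover have "\<forall>\<^sub>F \<theta> in at_left (1::real). \<theta> ^ n * s \<le> (\<Prod>i<n. 2 * b i)"
    using eventually_at_left_real[OF zero_less_one]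
  proof eventually_elim
    case (elim \<theta>)
    then show ?case using le[of \<theta>] s P0 by (simp add: ennreal_mult[symmetric])
  qed
  ultimately have "1 ^ n * s \<le> (\<Prod>i<n. 2 * b i)"
    by (rule tendsto_upperbound) simp
  then show ?thesis using s P0 by simp
qed

lemma voronoi_iff:
  "restrict (\<lambda>i. t i + z i) {..<n} \<in> voronoi n T t \<longleftrightarrow>
    (\<forall>t'\<in>T. (\<Sum>i<n. (z i)\<^sup>2) \<le> (\<Sum>i<n. (t i + z i - t' i)\<^sup>2))"
  by (simp add: voronoi_def distn_def)

lemma sets_Collect_ball_countable:
  assumes "countable X" and "\<And>i. i \<in> X \<Longrightarrow> {x \<in> space M. P i x} \<in> sets M"
  shows "{x \<in> space M. \<forall>i\<in>X. P i x} \<in> sets M"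
proof -
  have "{x \<in> space M. \<forall>i\<in>X. P i x} = space M - (\<Union>i\<in>X. space M - {x \<in> space M. P i x})"
    by auto
  also have "\<dots> \<in> sets M"
    using assms by (intro sets.Diff sets.top sets.countable_UN') auto
  finally show ?thesis .
qed

lemma voronoi_measurable:
  assumes "countable T"
  shows "{z \<in> space (PiM {..<n} (\<lambda>_. borel)). restrict (\<lambda>i. t i + z i) {..<n} \<in> voronoi n T t}
    \<in> sets (PiM {..<n} (\<lambda>_. borel))"
  unfolding voronoi_iff 
  by (intro sets_Collect_ball_countable assms) measurable

text \<open>Correct decoding of \<open>t\<close> puts the noise in the cell \<open>W t\<close>. Its
  part outside \<open>B1\<close> and \<open>B2\<close> has density at most \<open>\<tau>\<close>, so
  its probability is at most \<open>\<tau>\<close> times a volume, and these volumes add up to at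
  most that of the enlarged cube. \<open>B2\<close> removes the noise that leaves this cube;
  measuring it in units of \<open>H i\<close> keeps the enlarged region of the form \<open>H\<close>
  times a cube.\<close>

lemma sum_Pe_cond_ge:
  assumes "\<sigma> > 0" and "countable T" and T: "T \<subseteq> PiE {..<n} (\<lambda>_. UNIV)"
    and A: "A \<subseteq> T" "finite A" and H: "\<And>i. i < n \<Longrightarrow> 0 < H i" and "0 < \<tau>" "0 \<le> D" "0 \<le> a"
    and bt: "\<And>t i. t \<in> A \<Longrightarrow> i < n \<Longrightarrow> \<bar>t i\<bar> \<le> H i * (a / 2)"
  shows "real (card A) * (1 - measure (noise n \<sigma>) {z \<in> space (noise n \<sigma>). \<tau> < noise_density n \<sigma> z}
           - measure (noise n \<sigma>) {z \<in> space (noise n \<sigma>). \<exists>i<n. H i * D \<le> \<bar>z i\<bar>})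
         - \<tau> * ((\<Prod>i<n. H i) * (a + 2 * D) ^ n) \<le> (\<Sum>t\<in>A. Pe_cond n \<sigma> T t)"
proof -
  interpret N: prob_space "noise n \<sigma>" using assms(1) by (rule prob_space_noise)
  define B1 where "B1 = {z \<in> space (noise n \<sigma>). \<tau> < noise_density n \<sigma> z}"
  define B2 where "B2 = {z \<in> space (noise n \<sigma>). \<exists>i<n. H i * D \<le> \<bar>z i\<bar>}"
  define W where "W t = {z \<in> space (noise n \<sigma>). restrict (\<lambda>i. t i + z i) {..<n} \<in> voronoi n T t}" for t
  define K where "K t = W t - B1 - B2" for t
  have B1[measurable]: "B1 \<in> sets (noise n \<sigma>)" unfolding B1_def by measurable
  have B2[measurable]: "B2 \<in> sets (noise n \<sigma>)" unfolding B2_def by measurable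
  have W[measurable]: "W t \<in> sets (noise n \<sigma>)" for t
    unfolding W_def using voronoi_measurable[OF assms(2), of n t]
    by (simp add: sets_noise space_noise space_PiM)
  have sL: "sets (noise n \<sigma>) = sets (Leb n)" by (simp add: sets_noise cong: sets_PiM_cong)
  have KL: "K t \<in> sets (Leb n)" for t unfolding sL[symmetric] K_def by measurable
  have Pe: "Pe_cond n \<sigma> T t = 1 - N.prob (W t)" for t
  proof -
    have "{z \<in> space (noise n \<sigma>). restrict (\<lambda>i. t i + z i) {..<n} \<notin> voronoi n T t} = space (noise n \<sigma>) - W t"
      by (auto simp: W_def)
    then show ?thesis unfolding Pe_cond_def by (simp add: N.prob_compl)
  qed
  have vol: "(\<Sum>t\<in>A. emeasure (Leb n) (K t)) \<le> ennreal (\<Prod>i<n. 2 * (H i * (a / 2 + D)))"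
  proof (rule cells_volume)
    fix t t' z assume "t \<in> A" "t' \<in> A" "z \<in> K t"
    then show "(\<Sum>i<n. (z i)\<^sup>2) \<le> (\<Sum>i<n. (t i + z i - t' i)\<^sup>2)"
      using A by (auto simp: K_def W_def voronoi_iff)
  next
    fix t z i assume t: "t \<in> A" and z: "z \<in> K t" and i: "i < n"
    have "\<bar>z i\<bar> \<le> H i * D" using z i by (auto simp: K_def B2_def W_def not_le intro: less_imp_le)
    with bt[OF t i] show "\<bar>t i + z i\<bar> \<le> H i * (a / 2 + D)" by (simp add: algebra_simps)
  next
    fix t i assume t: "t \<in> A" and i: "i < n"
    have "0 \<le> H i * D" using H[OF i] assms by auto
    then show "\<bar>t i\<bar> \<le> H i * (a / 2 + D)" using bt[OF t i] by (simp add: algebra_simps)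
  qed (use A T KL H assms in \<open>auto simp: less_imp_le\<close>)
  have Pprod: "(\<Prod>i<n. 2 * (H i * (a / 2 + D))) = (\<Prod>i<n. H i) * (a + 2 * D) ^ n"
  proof -
    have "(\<Prod>i<n. 2 * (H i * (a / 2 + D))) = (\<Prod>i<n. H i * (a + 2 * D))"
      by (intro prod.cong) (auto simp: algebra_simps)
    then show ?thesis by (simp add: prod.distrib)
  qed
  have P0: "0 \<le> (\<Prod>i<n. H i) * (a + 2 * D) ^ n"
    using H assms by (intro mult_nonneg_nonneg prod_nonneg) (auto simp: less_imp_le)
  have fin: "emeasure (Leb n) (K t) < \<infinity>" if "t \<in> A" for t
  proof -
    have "emeasure (Leb n) (K t) \<le> (\<Sum>t\<in>A. emeasure (Leb n) (K t))"
      using that A by (intro member_le_sum) auto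
    also note vol
    finally show ?thesis by (simp add: less_top[symmetric] top_unique) (metis ennreal_neq_top top_unique)
  qed
  have vol': "(\<Sum>t\<in>A. measure (Leb n) (K t)) \<le> (\<Prod>i<n. H i) * (a + 2 * D) ^ n"
  proof -
    have "ennreal (\<Sum>t\<in>A. measure (Leb n) (K t)) = (\<Sum>t\<in>A. emeasure (Leb n) (K t))"
      using fin by (subst sum_ennreal[symmetric]) (auto intro!: sum.cong simp: emeasure_eq_ennreal_measure less_top)
    with vol show ?thesis using P0 by (metis Pprod ennreal_le_iff)
  qed
  have one: "1 - N.prob B1 - N.prob B2 - \<tau> * measure (Leb n) (K t) \<le> Pe_cond n \<sigma> T t" if t: "t \<in> A" for t
  proof -
    have "N.prob (W t) \<le> N.prob ((K t \<union> B1) \<union> B2)"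
      using KL[of t] by (intro N.finite_measure_mono) (auto simp: K_def)
    also have "\<dots> \<le> N.prob (K t \<union> B1) + N.prob B2"
      using KL[of t] B1 B2 by (intro measure_Un_le) (auto simp: sL)
    also have "N.prob (K t \<union> B1) \<le> N.prob (K t) + N.prob B1"
      using KL[of t] B1 B2 by (intro measure_Un_le) (auto simp: sL)
    also have "N.prob (K t) \<le> \<tau> * measure (Leb n) (K t)"
    proof -
      have "ennreal (N.prob (K t)) \<le> ennreal \<tau> * emeasure (Leb n) (K t)"
        unfolding N.emeasure_eq_measure[symmetric]
        by (rule emeasure_noise_le[OF assms(1) KL]) (auto simp: K_def B1_def W_def)
      also have "\<dots> = ennreal (\<tau> * measure (Leb n) (K t))"
        using fin[OF t] assms by (simp add: emeasure_eq_ennreal_measure less_top ennreal_mult)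
      finally show ?thesis using assms by simp
    qed
    finally show ?thesis by (simp add: Pe)
  qed
  have "real (card A) * (1 - N.prob B1 - N.prob B2) - \<tau> * ((\<Prod>i<n. H i) * (a + 2 * D) ^ n)
     \<le> real (card A) * (1 - N.prob B1 - N.prob B2) - \<tau> * (\<Sum>t\<in>A. measure (Leb n) (K t))"
    using vol' assms by (intro diff_left_mono mult_left_mono) auto
  also have "\<dots> = (\<Sum>t\<in>A. 1 - N.prob B1 - N.prob B2 - \<tau> * measure (Leb n) (K t))"
    by (simp add: sum_subtractf sum_distrib_left sum.distrib algebra_simps)
  also have "\<dots> \<le> (\<Sum>t\<in>A. Pe_cond n \<sigma> T t)" by (intro sum_mono one)
  finally show ?thesis by (simp add: B1_def B2_def)
qed

text \<open>Density and average error are both upper limits. The cubes that contain many points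
  recur but need not be eventually all, and recurrence suffices for a lower bound on an upper
  limit.\<close>

lemma le_Limsup_if_frequently:
  fixes f :: "'a \<Rightarrow> 'b :: complete_linorder"
  assumes "\<exists>\<^sub>F x in F. c \<le> f x"
  shows "c \<le> Limsup F f"
proof (rule ccontr)
  assume "\<not> c \<le> Limsup F f"
  then have "\<forall>\<^sub>F x in F. f x < c" by (intro Limsup_lessD) simp
  with assms show False by (auto simp: frequently_def not_le)
qed

lemma ennreal_le_if_all_less:
  assumes "\<And>e. 0 < e \<Longrightarrow> ennreal (c - e) \<le> L"
  shows "ennreal c \<le> L"
proof (rule tendsto_upperbound)
  have "((\<lambda>e. ennreal (c - e)) \<longlongrightarrow> ennreal (c - 0)) (at_right 0)"
    by (intro tendsto_intros)
  then show "((\<lambda>e. ennreal (c - e)) \<longlongrightarrow> ennreal c) (at_right 0)" by simp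
  show "\<forall>\<^sub>F e in at_right 0. ennreal (c - e) \<le> L"
    using assms by (auto simp: eventually_at_right_less eventually_at_filter)
qed simp

lemma inj_on_scale:
  assumes "\<And>i. i < n \<Longrightarrow> H i \<noteq> 0"
  shows "inj_on (scale n H) (PiE {..<n} (\<lambda>_. UNIV))"
proof (rule inj_onI)
  fix x y assume x: "x \<in> PiE {..<n} (\<lambda>_. UNIV)" and y: "y \<in> PiE {..<n} (\<lambda>_. UNIV)"
    and eq: "scale n H x = scale n H y"
  have "x i = y i" if "i \<in> {..<n}" for i
    using fun_cong[OF eq, of i] assms[of i] that by (simp add: scale_def)
  then show "x = y" by (intro PiE_ext[OF x y])
qed

lemma noise_far_tendsto:
  assumes "\<sigma> > 0" and H: "\<And>i. i < n \<Longrightarrow> 0 < H i"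
  shows "(\<lambda>k::nat. measure (noise n \<sigma>) {z \<in> space (noise n \<sigma>). \<exists>i<n. H i * real k \<le> \<bar>z i\<bar>}) \<longlonglongrightarrow> 0"
proof -
  interpret N: prob_space "noise n \<sigma>" using assms(1) by (rule prob_space_noise)
  let ?B = "\<lambda>k::nat. {z \<in> space (noise n \<sigma>). \<exists>i<n. H i * real k \<le> \<bar>z i\<bar>}"
  have "decseq ?B"
    using H by (auto simp: decseq_def intro: order_trans[OF mult_left_mono] less_imp_le)
      (metis less_imp_le mult_left_mono of_nat_mono order_trans)
  then have "(\<lambda>k. N.prob (?B k)) \<longlonglongrightarrow> N.prob (\<Inter>k. ?B k)"
    by (intro N.finite_Lim_measure_decseq) auto
  moreover have "(\<Inter>k. ?B k) = {}"
  proof (intro equals0I)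
    fix z assume z: "z \<in> (\<Inter>k. ?B k)"
    obtain k :: nat where k: "(\<Sum>i<n. \<bar>z i\<bar> / H i) < real k" using reals_Archimedean2 by blast
    from z obtain i where i: "i < n" "H i * real k \<le> \<bar>z i\<bar>" by auto
    have "\<bar>z i\<bar> / H i \<le> (\<Sum>i<n. \<bar>z i\<bar> / H i)"
      using i H by (intro member_le_sum) (auto simp: less_imp_le)
    with k have "\<bar>z i\<bar> / H i < real k" by simp
    with i H[OF i(1)] show False by (simp add: field_simps)
  qed
  ultimately show ?thesis by simp
qed

text \<open>Dividing \<open>sum_Pe_cond_ge\<close> by a number of points above
  \<open>g * a ^ n\<close> leaves the volume term
  \<open>\<tau> * (\<Prod>i<n. H i) * ((a + 2 * D) / a) ^ n / g\<close>, and the last ratio tends to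
  1.\<close>

lemma Limsup_error_ge:
  assumes "\<sigma> > 0" and IC: "is_IC n S" and H: "\<And>i. i < n \<Longrightarrow> 0 < H i" and "0 < \<tau>" "0 < g"
    and freq: "\<exists>\<^sub>F a in at_top. g < real (Mcount n S a) / a ^ n"
  shows "ennreal (1 - measure (noise n \<sigma>) {z \<in> space (noise n \<sigma>). \<tau> < noise_density n \<sigma> z} - \<tau> * (\<Prod>i<n. H i) / g)
    \<le> Limsup at_top (\<lambda>a::real.
      ennreal ((\<Sum>t \<in> scale n H ` S \<inter> scale n H ` cube n a. Pe_cond n \<sigma> (scale n H ` S) t)
               / real (card (scale n H ` S \<inter> scale n H ` cube n a))))" (is "ennreal ?c \<le> Limsup at_top ?f")
proof (rule ennreal_le_if_all_less)
  fix e :: real assume e: "0 < e"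
  define p where "p = measure (noise n \<sigma>) {z \<in> space (noise n \<sigma>). \<tau> < noise_density n \<sigma> z}"
  define q where "q D = measure (noise n \<sigma>) {z \<in> space (noise n \<sigma>). \<exists>i<n. H i * D \<le> \<bar>z i\<bar>}" for D
  define h where "h = (\<Prod>i<n. H i)"
  have hpos: "0 < h" unfolding h_def using H by (intro prod_pos) auto
  have S: "S \<subseteq> PiE {..<n} (\<lambda>_. UNIV)" "countable S" using IC by (auto simp: is_IC_def)
  have cb: "cube n a \<subseteq> PiE {..<n} (\<lambda>_. UNIV)" for a by (auto simp: cube_def)
  have Ha: "scale n H ` S \<inter> scale n H ` cube n a = scale n H ` (S \<inter> cube n a)" for a
    using H S cb by (intro inj_on_image_Int[OF inj_on_scale, symmetric]) (auto simp: less_le)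
  \<comment> \<open>\<open>D\<close> is fixed before the cube grows, so the margin is negligible
    against \<open>a\<close>.\<close>
  obtain D :: nat where D: "q (real D) < e / 2"
    using order_tendstoD(2)[OF noise_far_tendsto[of \<sigma> n H, folded q_def], of "e/2"] e H assms(1)
    by (auto simp: eventually_sequentially)
  have "((\<lambda>a. \<tau> * h * ((a + 2 * real D) / a) ^ n / g) \<longlongrightarrow> \<tau> * h * (1 + 2 * real D * 0) ^ n / g) at_top"
  proof (rule Lim_transform_eventually)
    show "((\<lambda>a. \<tau> * h * (1 + 2 * real D * inverse a) ^ n / g) \<longlongrightarrow> \<tau> * h * (1 + 2 * real D * 0) ^ n / g) at_top"
      using assms by (intro tendsto_intros tendsto_inverse_0_at_top filterlim_ident) auto
    show "\<forall>\<^sub>F a in at_top. \<tau> * h * (1 + 2 * real D * inverse a) ^ n / g = \<tau> * h * ((a + 2 * real D) / a) ^ n / g"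
      using eventually_gt_at_top[of 0] by eventually_elim (simp add: field_simps)
  qed
  then have "\<forall>\<^sub>F a in at_top. \<tau> * h * ((a + 2 * real D) / a) ^ n / g < \<tau> * h / g + e / 2"
    using e by (intro order_tendstoD) auto
  then have "\<forall>\<^sub>F a in at_top. \<tau> * h * ((a + 2 * real D) / a) ^ n / g < \<tau> * h / g + e / 2 \<and> 0 < a"
    using eventually_gt_at_top[of 0] by (rule eventually_conj)
  with freq have "\<exists>\<^sub>F a in at_top. (\<tau> * h * ((a + 2 * real D) / a) ^ n / g < \<tau> * h / g + e / 2 \<and> 0 < a)
      \<and> g < real (Mcount n S a) / a ^ n"
    by (rule eventually_frequently_simps(1)[THEN iffD2, OF conjI, rotated] frequently_rev_mp[OF _ eventually_mono]) auto
  then have "\<exists>\<^sub>F a in at_top. ennreal (?c - e) \<le> ?f a"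
  proof (rule frequently_elim1)
    fix a assume *: "(\<tau> * h * ((a + 2 * real D) / a) ^ n / g < \<tau> * h / g + e / 2 \<and> 0 < a)
      \<and> g < real (Mcount n S a) / a ^ n"
    define A where "A = scale n H ` (S \<inter> cube n a)"
    have cardA: "card A = Mcount n S a"
      unfolding A_def Mcount_def using H S by (intro card_image inj_on_subset[OF inj_on_scale]) (auto simp: less_le)
    have ga: "g * a ^ n < real (card A)" using * pos_less_divide_eq[of "a ^ n" g] by (simp add: cardA)
    have ga0: "0 < g * a ^ n" using * assms by simp
    \<comment> \<open>\<open>card\<close> is 0 on infinite sets, so a positive count also yields
      finiteness.\<close>
    then have cA: "0 < card A" using ga by simp
    have "real (card A) * (1 - p - q (real D)) - \<tau> * (h * (a + 2 * real D) ^ n)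
        \<le> (\<Sum>t\<in>A. Pe_cond n \<sigma> (scale n H ` S) t)"
      unfolding p_def q_def h_def
    proof (rule sum_Pe_cond_ge)
      show "finite A" using cA by (simp add: card_gt_0_iff)
      show "scale n H ` S \<subseteq> PiE {..<n} (\<lambda>_. UNIV)" by (auto simp: scale_def split: if_splits)
      fix t i assume "t \<in> A" "i < n"
      then show "\<bar>t i\<bar> \<le> H i * (a / 2)"
        using H[of i] by (auto simp: A_def scale_def cube_def abs_mult intro!: mult_left_mono less_imp_le)
    qed (use assms S * in \<open>auto simp: A_def\<close>)
    then have "(real (card A) * (1 - p - q (real D)) - \<tau> * (h * (a + 2 * real D) ^ n)) / real (card A)
        \<le> (\<Sum>t\<in>A. Pe_cond n \<sigma> (scale n H ` S) t) / real (card A)"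
      by (intro divide_right_mono) auto
    moreover have "(real (card A) * (1 - p - q (real D)) - \<tau> * (h * (a + 2 * real D) ^ n)) / real (card A)
       = 1 - p - q (real D) - \<tau> * (h * (a + 2 * real D) ^ n) / real (card A)"
      using cA by (simp add: diff_divide_distrib)
    moreover have "\<tau> * (h * (a + 2 * real D) ^ n) / real (card A) \<le> \<tau> * (h * (a + 2 * real D) ^ n) / (g * a ^ n)"
      using ga ga0 cA hpos assms * by (intro divide_left_mono mult_pos_pos mult_nonneg_nonneg) (auto simp: less_imp_le)
    moreover have "\<tau> * (h * (a + 2 * real D) ^ n) / (g * a ^ n) = \<tau> * h * ((a + 2 * real D) / a) ^ n / g"
      by (simp add: power_divide ac_simps)
    ultimately have "?c - e \<le> (\<Sum>t\<in>A. Pe_cond n \<sigma> (scale n H ` S) t) / real (card A)"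
      using conjunct1[OF conjunct1[OF *]] D unfolding p_def[symmetric] h_def[symmetric] by linarith
    then show "ennreal (?c - e) \<le> ?f a"
      unfolding Ha A_def by (rule ennreal_leI)
  qed
  then show "ennreal (?c - e) \<le> Limsup at_top ?f"
    by (rule le_Limsup_if_frequently)
qed

section \<open>Fading vectors and the information density\<close>

lemma prob_space_fading_density: "fading_pdf f \<Longrightarrow> prob_space (density lborel (\<lambda>h. ennreal (f h)))"
  by (auto intro!: prob_spaceI simp: fading_pdf_def emeasure_density)

lemma prob_space_fading: "fading_pdf f \<Longrightarrow> prob_space (fading n f)"
  unfolding fading_def by (intro prob_space_PiM prob_space_fading_density)

lemma sets_fading[measurable_cong]: "sets (fading n f) = sets (PiM {..<n} (\<lambda>_. borel))"
  unfolding fading_def by (intro sets_PiM_cong) auto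

lemma AE_fading_density_pos:
  assumes "fading_pdf f"
  shows "AE h in density lborel (\<lambda>h. ennreal (f h)). 0 < h"
proof -
  have [measurable]: "f \<in> borel_measurable borel" and f: "\<And>h. h < 0 \<Longrightarrow> f h = 0"
    using assms by (auto simp: fading_pdf_def)
  have "AE h in lborel. h \<noteq> (0::real)" by (rule AE_lborel_singleton)
  then have "AE h in lborel. 0 < ennreal (f h) \<longrightarrow> 0 < h"
  proof eventually_elim
    case (elim h)
    then show ?case using f[of h] by (cases "h < 0") auto
  qed
  then show ?thesis by (subst AE_density) auto
qed

lemma AE_fading_pos:
  assumes "fading_pdf f"
  shows "AE H in fading n f. \<forall>i<n. 0 < H i"
proof -
  have "AE H in fading n f. \<forall>i\<in>{..<n}. 0 < H i"
    unfolding fading_def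
    by (intro AE_finite_allI AE_PiM_component prob_space_fading_density AE_fading_density_pos assms) auto
  then show ?thesis by (rule eventually_mono) auto
qed

text \<open>For positive fading coefficients this is the logarithm of the noise density multiplied by the
  determinant of the fading matrix, i.e. the information density of the channel.\<close>

definition info :: "nat \<Rightarrow> real \<Rightarrow> (nat \<Rightarrow> real) \<Rightarrow> (nat \<Rightarrow> real) \<Rightarrow> real" where
  "info n \<sigma> H z = (\<Sum>i<n. delta_H \<sigma> (H i) + (1/2 - (z i)\<^sup>2 / (2 * \<sigma>\<^sup>2)))"

lemma delta_H_measurable[measurable]: "delta_H \<sigma> \<in> borel_measurable borel"
  unfolding delta_H_def by measurable

lemma info_measurable[measurable]:
  "(\<lambda>x. info n \<sigma> (fst x) (snd x)) \<in> borel_measurable (PiM {..<n} (\<lambda>_. borel) \<Otimes>\<^sub>M PiM {..<n} (\<lambda>_. borel))"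
  unfolding info_def by measurable

lemma info_measurable'[measurable]:
  "(\<lambda>z. info n \<sigma> H z) \<in> borel_measurable (PiM {..<n} (\<lambda>_. borel))"
  unfolding info_def by measurable

lemma delta_H_pos:
  assumes "\<sigma> > 0" "h > 0"
  shows "delta_H \<sigma> h = ln h - 1/2 * ln (2 * pi * \<sigma>\<^sup>2) - 1/2"
  using assms by (simp add: delta_H_def ln_div ln_mult ln_realpow field_simps)

text \<open>The factor e inside \<open>delta_H\<close> contributes -1/2, which cancels against the
  1/2 in \<open>info\<close>; that same 1/2 centres the noise term, since
  \<open>(z i)\<^sup>2 / (2 * \<sigma>\<^sup>2)\<close> has mean 1/2.\<close>

lemma exp_info:
  assumes s: "\<sigma> > 0" and H: "\<And>i. i < n \<Longrightarrow> 0 < H i"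
  shows "exp (info n \<sigma> H z) = (\<Prod>i<n. H i) * noise_density n \<sigma> z"
proof -
  have "exp (delta_H \<sigma> (H i) + (1/2 - (z i)\<^sup>2 / (2 * \<sigma>\<^sup>2))) = H i * normal_density 0 \<sigma> (z i)" if "i < n" for i
  proof -
    have eq: "delta_H \<sigma> (H i) + (1/2 - (z i)\<^sup>2 / (2 * \<sigma>\<^sup>2))
        = ln (H i) - ln (sqrt (2 * pi * \<sigma>\<^sup>2)) + (- (z i)\<^sup>2 / (2 * \<sigma>\<^sup>2))"
      using s H[OF that] by (simp add: delta_H_pos ln_sqrt)
    have "exp (ln (H i)) = H i" "exp (ln (sqrt (2 * pi * \<sigma>\<^sup>2))) = sqrt (2 * pi * \<sigma>\<^sup>2)"
      using s H[OF that] by auto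
    then show ?thesis unfolding eq by (simp only: exp_add exp_diff) (simp add: normal_density_def)
  qed
  then show ?thesis
    unfolding info_def noise_density_def by (auto simp: exp_sum prod.distrib[symmetric] intro!: prod.cong)
qed

abbreviation joint :: "nat \<Rightarrow> real \<Rightarrow> (real \<Rightarrow> real) \<Rightarrow> ((nat \<Rightarrow> real) \<times> (nat \<Rightarrow> real)) measure" where
  "joint n \<sigma> f \<equiv> fading n f \<Otimes>\<^sub>M noise n \<sigma>"

abbreviation info_le :: "nat \<Rightarrow> real \<Rightarrow> (real \<Rightarrow> real) \<Rightarrow> real \<Rightarrow> ((nat \<Rightarrow> real) \<times> (nat \<Rightarrow> real)) set" where
  "info_le n \<sigma> f r \<equiv> {x \<in> space (joint n \<sigma> f). info n \<sigma> (fst x) (snd x) \<le> r}"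

lemma prob_space_joint: "\<sigma> > 0 \<Longrightarrow> fading_pdf f \<Longrightarrow> prob_space (joint n \<sigma> f)"
  by (intro prob_space_pair prob_space_fading prob_space_noise)

text \<open>For each fading vector the density threshold is scaled by the determinant of
  \<open>H\<close>. The volume term then becomes the constant 1 / sqrt n, and the condition on the
  noise density becomes a condition on \<open>info\<close> with a threshold that no longer depends
  on \<open>H\<close>, so integration over the fading gives a joint probability.\<close>

theorem converse_bound:
  assumes s: "\<sigma> > 0" and f: "fading_pdf f" and IC: "is_IC n S" and "0 < g" and n: "0 < n"
    and freq: "\<exists>\<^sub>F a in at_top. g < real (Mcount n S a) / a ^ n"
  shows "emeasure (joint n \<sigma> f) (info_le n \<sigma> f (ln g - ln (real n) / 2))
    \<le> Pe_avg n \<sigma> f S + ennreal (1 / sqrt (real n))"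
proof -
  interpret F: prob_space "fading n f" using f by (rule prob_space_fading)
  interpret N: prob_space "noise n \<sigma>" using s by (rule prob_space_noise)
  let ?s = "ln g - ln (real n) / 2"
  define G where "G H = N.prob {z \<in> space (noise n \<sigma>). info n \<sigma> H z \<le> ?s}" for H
  define L where "L H = Limsup at_top (\<lambda>a::real.
      ennreal ((\<Sum>t \<in> scale n H ` S \<inter> scale n H ` cube n a. Pe_cond n \<sigma> (scale n H ` S) t)
               / real (card (scale n H ` S \<inter> scale n H ` cube n a))))" for H
  have Gm[measurable]: "G \<in> borel_measurable (fading n f)"
    unfolding G_def by measurable
  have HL: "ennreal (G H - 1 / sqrt (real n)) \<le> L H" if H: "\<forall>i<n. 0 < H i" for H
  proof -
    define h where "h = (\<Prod>i<n. H i)"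
    have hpos: "0 < h" unfolding h_def using H by (intro prod_pos) auto
    \<comment> \<open>Chosen so that \<open>\<tau> * h / g\<close> is 1 / sqrt n; this is also the
      origin of the ln n / 2 in the threshold.\<close>
    define \<tau> where "\<tau> = g / (sqrt (real n) * h)"
    have \<tau>: "0 < \<tau>" using hpos assms by (auto simp: \<tau>_def)
    have "exp ?s = g / sqrt (real n)"
      using assms by (simp add: exp_diff ln_sqrt[symmetric])
    then have iff: "\<tau> < noise_density n \<sigma> z \<longleftrightarrow> \<not> info n \<sigma> H z \<le> ?s" for z
    proof -
      have "info n \<sigma> H z \<le> ?s \<longleftrightarrow> exp (info n \<sigma> H z) \<le> exp ?s" by simp
      also have "\<dots> \<longleftrightarrow> h * noise_density n \<sigma> z \<le> g / sqrt (real n)"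
        unfolding \<open>exp ?s = g / sqrt (real n)\<close> using exp_info[OF s, of n H z] H by (simp add: h_def)
      also have "\<dots> \<longleftrightarrow> noise_density n \<sigma> z \<le> (g / sqrt (real n)) / h"
        using hpos by (simp only: pos_le_divide_eq mult.commute)
      finally show ?thesis by (simp add: \<tau>_def not_le)
    qed
    have "{z \<in> space (noise n \<sigma>). \<tau> < noise_density n \<sigma> z}
        = space (noise n \<sigma>) - {z \<in> space (noise n \<sigma>). info n \<sigma> H z \<le> ?s}"
      using iff by auto
    then have "N.prob {z \<in> space (noise n \<sigma>). \<tau> < noise_density n \<sigma> z} = 1 - G H"
      unfolding G_def by (simp add: N.prob_compl)
    moreover have "\<tau> * h / g = 1 / sqrt (real n)"
      using hpos assms by (simp add: \<tau>_def)
    ultimately show ?thesis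
      using Limsup_error_ge[OF s IC _ \<tau> \<open>0 < g\<close> freq, of H] H
      unfolding L_def h_def by simp
  qed
  have "emeasure (joint n \<sigma> f) (info_le n \<sigma> f ?s)
      = (\<integral>\<^sup>+H. emeasure (noise n \<sigma>) (Pair H -` (info_le n \<sigma> f ?s)) \<partial>fading n f)"
    by (intro N.emeasure_pair_measure_alt) measurable
  also have "\<dots> = (\<integral>\<^sup>+H. ennreal (G H) \<partial>fading n f)"
    by (intro nn_integral_cong)
      (auto simp: G_def N.emeasure_eq_measure space_pair_measure intro!: arg_cong[where f=N.prob])
  also have "\<dots> \<le> (\<integral>\<^sup>+H. ennreal (G H - 1 / sqrt (real n)) + ennreal (1 / sqrt (real n)) \<partial>fading n f)"
  proof (rule nn_integral_mono)
    fix H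
    \<comment> \<open>\<open>ennreal\<close> truncates a negative difference to 0, which only helps
      the bound.\<close>
    have "G H \<le> max 0 (G H - 1 / sqrt (real n)) + 1 / sqrt (real n)" by simp
    then have "ennreal (G H) \<le> ennreal (max 0 (G H - 1 / sqrt (real n)) + 1 / sqrt (real n))"
      by (rule ennreal_leI)
    then show "ennreal (G H) \<le> ennreal (G H - 1 / sqrt (real n)) + ennreal (1 / sqrt (real n))"
      by (simp add: ennreal_plus ennreal_max_0)
  qed
  also have "\<dots> = (\<integral>\<^sup>+H. ennreal (G H - 1 / sqrt (real n)) \<partial>fading n f) + ennreal (1 / sqrt (real n))"
    by (subst nn_integral_add) (auto simp: F.emeasure_space_1)
  \<comment> \<open>The integrand of \<open>Pe_avg\<close> is never shown to be measurable; only
    monotonicity of the nonnegative integral is applied to it.\<close>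
  also have "(\<integral>\<^sup>+H. ennreal (G H - 1 / sqrt (real n)) \<partial>fading n f) \<le> (\<integral>\<^sup>+H. L H \<partial>fading n f)"
    using AE_fading_pos[OF f, of n] HL by (intro nn_integral_mono_AE) (auto elim!: eventually_mono)
  finally show ?thesis
    unfolding Pe_avg_def L_def by (simp add: add_right_mono)
qed

section \<open>Averaging over the torus\<close>

text \<open>The condition confines \<open>m\<close> to a half-open interval of length
  \<open>\<bar>l\<bar>\<close>; the sign of \<open>l\<close> decides which end is closed.
  Geometrically, multiplication by \<open>l\<close> covers the circle of circumference
  \<open>a\<close> exactly \<open>\<bar>l\<bar>\<close> times.\<close>

lemma shift_ints:
  fixes a w :: real and l :: int
  assumes "a > 0" "l \<noteq> 0"
  shows "finite {m::int. (w - a * of_int m) / of_int l \<in> {0..<a}}"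
    and "card {m::int. (w - a * of_int m) / of_int l \<in> {0..<a}} = nat \<bar>l\<bar>"
proof -
  have "finite {m::int. (w - a * of_int m) / of_int l \<in> {0..<a}} \<and>
    card {m::int. (w - a * of_int m) / of_int l \<in> {0..<a}} = nat \<bar>l\<bar>"
  proof (cases "l > 0")
    case True
    have "(w - a * of_int m) / of_int l \<in> {0..<a} \<longleftrightarrow> m \<in> {\<lfloor>w/a\<rfloor> - l + 1..\<lfloor>w/a\<rfloor>}" for m :: int
    proof -
      have "0 \<le> (w - a * of_int m) / of_int l \<longleftrightarrow> m \<le> \<lfloor>w/a\<rfloor>"
      proof -
        have "0 \<le> (w - a * of_int m) / of_int l \<longleftrightarrow> of_int m * a \<le> w"
          using True by (auto simp: zero_le_divide_iff mult.commute)
        also have "\<dots> \<longleftrightarrow> of_int m \<le> w / a" using assms(1) by (simp add: pos_le_divide_eq)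
        finally show ?thesis by (simp add: le_floor_iff)
      qed
      moreover have "(w - a * of_int m) / of_int l < a \<longleftrightarrow> \<lfloor>w/a\<rfloor> - l + 1 \<le> m"
      proof -
        have "(w - a * of_int m) / of_int l < a \<longleftrightarrow> w / a < of_int (m + l)"
          using True assms(1) by (simp add: field_simps)
        also have "\<dots> \<longleftrightarrow> \<lfloor>w/a\<rfloor> < m + l" by (rule floor_less_iff[symmetric])
        finally show ?thesis by linarith
      qed
      ultimately show ?thesis by (auto simp only: atLeastLessThan_iff atLeastAtMost_iff)
    qed
    then have "{m::int. (w - a * of_int m) / of_int l \<in> {0..<a}} = {\<lfloor>w/a\<rfloor> - l + 1..\<lfloor>w/a\<rfloor>}"
      by (intro set_eqI) (simp only: mem_Collect_eq)
    then show ?thesis using True by simp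
  next
    case False
    with assms have l: "l < 0" by simp
    have "(w - a * of_int m) / of_int l \<in> {0..<a} \<longleftrightarrow> m \<in> {\<lceil>w/a\<rceil>..<\<lceil>w/a\<rceil> - l}" for m :: int
    proof -
      have "0 \<le> (w - a * of_int m) / of_int l \<longleftrightarrow> \<lceil>w/a\<rceil> \<le> m"
      proof -
        have "0 \<le> (w - a * of_int m) / of_int l \<longleftrightarrow> w \<le> of_int m * a"
          using l by (auto simp: zero_le_divide_iff mult.commute)
        also have "\<dots> \<longleftrightarrow> w / a \<le> of_int m" using assms(1) by (simp add: pos_divide_le_eq)
        finally show ?thesis by (simp add: ceiling_le_iff)
      qed
      moreover have "(w - a * of_int m) / of_int l < a \<longleftrightarrow> m < \<lceil>w/a\<rceil> - l"
      proof -
        have "(w - a * of_int m) / of_int l < a \<longleftrightarrow> of_int (m + l) < w / a"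
        proof -
          have "(w - a * of_int m) / of_int l < a \<longleftrightarrow> a * of_int l < w - a * of_int m"
            using l by (simp add: neg_divide_less_eq)
          also have "\<dots> \<longleftrightarrow> of_int (m + l) * a < w" by (auto simp: algebra_simps)
          also have "\<dots> \<longleftrightarrow> of_int (m + l) < w / a" using assms(1) by (simp only: pos_less_divide_eq)
          finally show ?thesis .
        qed
        also have "\<dots> \<longleftrightarrow> m + l < \<lceil>w/a\<rceil>" by (rule less_ceiling_iff[symmetric])
        finally show ?thesis by linarith
      qed
      ultimately show ?thesis by (auto simp only: atLeastLessThan_iff atLeastAtMost_iff)
    qed
    then have "{m::int. (w - a * of_int m) / of_int l \<in> {0..<a}} = {\<lceil>w/a\<rceil>..<\<lceil>w/a\<rceil> - l}"
      by (intro set_eqI) (simp only: mem_Collect_eq)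
    then show ?thesis using l by simp
  qed
  then show "finite {m::int. (w - a * of_int m) / of_int l \<in> {0..<a}}"
    and "card {m::int. (w - a * of_int m) / of_int l \<in> {0..<a}} = nat \<bar>l\<bar>" by auto
qed

lemma borel_measurable_nn_integral_count_space:
  assumes "countable I" and "\<And>i. i \<in> I \<Longrightarrow> f i \<in> borel_measurable M"
  shows "(\<lambda>x. \<integral>\<^sup>+i. f i x \<partial>count_space I) \<in> borel_measurable M"
proof -
  interpret sigma_finite_measure "count_space I"
    using assms(1) by (rule sigma_finite_measure_count_space_countable)
  have "(\<lambda>p. f (snd p) (fst p)) \<in> borel_measurable (M \<Otimes>\<^sub>M count_space I)"
    by (rule measurable_compose_countable'[where g=snd and I=I, OF measurable_compose[OF measurable_fst assms(2)] measurable_snd assms(1)])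
  then show ?thesis
    using borel_measurable_nn_integral[of "\<lambda>x i. f i x" M] by (simp only: split_beta')
qed

abbreviation int_vectors :: "nat \<Rightarrow> (nat \<Rightarrow> int) set" where
  "int_vectors n \<equiv> PiE {..<n} (\<lambda>_. UNIV)"

lemma countable_int_vectors: "countable (int_vectors n)"
  by (intro countable_PiE) auto

definition torus_point :: "nat \<Rightarrow> int \<Rightarrow> (nat \<Rightarrow> real) \<Rightarrow> real \<Rightarrow> (nat \<Rightarrow> int) \<Rightarrow> nat \<Rightarrow> real" where
  "torus_point n k v a m = (\<lambda>i\<in>{..<n}. of_int k * v i + a * of_int (m i))"

lemma torus_point_measurable[measurable]:
  "(\<lambda>v. torus_point n k v a m) \<in> measurable (PiM {..<n} (\<lambda>_. borel)) (PiM {..<n} (\<lambda>_. borel))"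
  unfolding torus_point_def by measurable

text \<open>For a fixed \<open>m\<close> the substitution \<open>x = l v + a m\<close> has Jacobian
  \<open>\<bar>l\<bar> ^ n\<close>. Conversely \<open>shift_ints\<close>, applied in each
  coordinate, shows that every \<open>x\<close> arises from exactly \<open>\<bar>l\<bar> ^ n\<close>
  pairs of \<open>v\<close> in the box and \<open>m\<close>. The two factors cancel after the sum
  over \<open>m\<close> and the integral are exchanged. The average is not normalised by the volume
  of the box.\<close>

lemma torus_average:
  assumes "a > 0" "l \<noteq> 0" and F[measurable]: "F \<in> borel_measurable (Leb n)"
  shows "(\<integral>\<^sup>+v. indicator (PiE {..<n} (\<lambda>_. {0..<a})) v *
      (\<integral>\<^sup>+m. F (torus_point n l v a m) \<partial>count_space (int_vectors n)) \<partial>Leb n) = (\<integral>\<^sup>+x. F x \<partial>Leb n)"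
proof -
  let ?box = "PiE {..<n} (\<lambda>_. {0..<a})"
  let ?c = "ennreal (\<bar>of_int l\<bar> ^ n)"
  have box[measurable]: "?box \<in> sets (Leb n)" by (intro sets_PiM_I_finite) auto
  have lcm[measurable]: "(\<lambda>v. torus_point n l v a m) \<in> measurable (Leb n) (Leb n)" for m
    unfolding torus_point_def by measurable
  \<comment> \<open>The inverse of \<open>torus_point\<close> in \<open>v\<close>, for fixed
    \<open>m\<close>.\<close>
  define r where "r x m = (\<lambda>i\<in>{..<n}. (x i - a * of_int (m i)) / of_int l)" for x :: "nat \<Rightarrow> real" and m :: "nat \<Rightarrow> int"
  have rm[measurable]: "(\<lambda>x. r x m) \<in> measurable (Leb n) (Leb n)" for m
    unfolding r_def by measurable
  have aff: "?c * (\<integral>\<^sup>+v. indicator ?box v * F (torus_point n l v a m) \<partial>Leb n) = (\<integral>\<^sup>+x. indicator ?box (r x m) * F x \<partial>Leb n)" for m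
  proof -
    have "(\<Prod>i<n. ennreal \<bar>of_int l\<bar>) * (\<integral>\<^sup>+v. (\<lambda>x. indicator ?box (r x m) * F x) (\<lambda>i\<in>{..<n}. a * of_int (m i) + of_int l * v i) \<partial>Leb n)
      = (\<integral>\<^sup>+x. indicator ?box (r x m) * F x \<partial>Leb n)"
      using assms(2) by (intro nn_integral_Leb_affine) auto
    also have "(\<integral>\<^sup>+v. (\<lambda>x. indicator ?box (r x m) * F x) (\<lambda>i\<in>{..<n}. a * of_int (m i) + of_int l * v i) \<partial>Leb n)
      = (\<integral>\<^sup>+v. indicator ?box v * F (torus_point n l v a m) \<partial>Leb n)"
    proof (rule nn_integral_cong)
      fix v assume v: "v \<in> space (Leb n)"
      have "r (\<lambda>i\<in>{..<n}. a * of_int (m i) + of_int l * v i) m = v"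
        using v assms(2) by (intro ext) (auto simp: r_def space_PiM PiE_iff extensional_def)
      then show "(\<lambda>x. indicator ?box (r x m) * F x) (\<lambda>i\<in>{..<n}. a * of_int (m i) + of_int l * v i)
        = indicator ?box v * F (torus_point n l v a m)"
        by (simp add: torus_point_def add.commute cong: restrict_cong)
    qed
    finally show ?thesis by (simp add: ennreal_power)
  qed
  have cnt: "(\<integral>\<^sup>+m. indicator ?box (r x m) \<partial>count_space (int_vectors n)) = ?c" for x
  proof -
    let ?X = "PiE {..<n} (\<lambda>i. {m::int. (x i - a * of_int m) / of_int l \<in> {0..<a}})"
    have "(\<integral>\<^sup>+m. indicator ?box (r x m) \<partial>count_space (int_vectors n)) = (\<integral>\<^sup>+m. indicator ?X m \<partial>count_space (int_vectors n))"
      by (intro nn_integral_cong) (auto simp: r_def PiE_iff split: split_indicator)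
    also have "\<dots> = emeasure (count_space (int_vectors n)) ?X"
      by (intro nn_integral_indicator) (auto simp: PiE_iff)
    also have "\<dots> = of_nat (card ?X)"
      using shift_ints(1)[OF assms(1,2)]
      by (intro emeasure_count_space_finite finite_PiE) (auto simp: PiE_iff)
    also have "card ?X = nat \<bar>l\<bar> ^ n"
      using shift_ints(2)[OF assms(1,2)] by (subst card_PiE) auto
    also have "of_nat (nat \<bar>l\<bar> ^ n) = ?c"
      by (simp add: ennreal_of_nat_eq_real_of_nat)
    finally show ?thesis .
  qed
  have "?c * (\<integral>\<^sup>+v. indicator ?box v * (\<integral>\<^sup>+m. F (torus_point n l v a m) \<partial>count_space (int_vectors n)) \<partial>Leb n)
     = ?c * (\<integral>\<^sup>+v. (\<integral>\<^sup>+m. indicator ?box v * F (torus_point n l v a m) \<partial>count_space (int_vectors n)) \<partial>Leb n)"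
    by (simp add: nn_integral_cmult)
  also have "\<dots> = ?c * (\<integral>\<^sup>+m. (\<integral>\<^sup>+v. indicator ?box v * F (torus_point n l v a m) \<partial>Leb n) \<partial>count_space (int_vectors n))"
    by (subst nn_integral_count_space_nn_integral[OF countable_int_vectors]) auto
  also have "\<dots> = (\<integral>\<^sup>+m. (\<integral>\<^sup>+x. indicator ?box (r x m) * F x \<partial>Leb n) \<partial>count_space (int_vectors n))"
    by (simp add: aff nn_integral_cmult[symmetric])
  also have "\<dots> = (\<integral>\<^sup>+x. (\<integral>\<^sup>+m. indicator ?box (r x m) * F x \<partial>count_space (int_vectors n)) \<partial>Leb n)"
    by (subst nn_integral_count_space_nn_integral[OF countable_int_vectors]) auto
  also have "\<dots> = (\<integral>\<^sup>+x. ?c * F x \<partial>Leb n)"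
    by (simp add: nn_integral_multc cnt)
  also have "\<dots> = ?c * (\<integral>\<^sup>+x. F x \<partial>Leb n)"
    by (simp add: nn_integral_cmult)
  finally show ?thesis
    using assms(2) by (subst (asm) ennreal_mult_cancel_left) auto
qed

text \<open>\<open>x\<close> is the difference, before fading, between a competitor and the sent
  point. Ties count as confusion; in particular 0 is always a member, which later detects coinciding
  code points.\<close>

definition confusable :: "nat \<Rightarrow> (nat \<Rightarrow> real) \<Rightarrow> (nat \<Rightarrow> real) \<Rightarrow> (nat \<Rightarrow> real) set" where
  "confusable n H z = {x. (\<Sum>i<n. (z i - H i * x i)\<^sup>2) \<le> (\<Sum>i<n. (z i)\<^sup>2)}"

text \<open>On this set the ratio of \<open>noise_density\<close> at \<open>z - H x\<close> to that
  at \<open>z\<close> is at least 1, so it dominates the indicator, and the integral of the ratio is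
  known exactly.\<close>

lemma confusable_volume:
  assumes s: "\<sigma> > 0" and H: "\<And>i. i < n \<Longrightarrow> H i > 0"
  shows "(\<integral>\<^sup>+x. indicator (confusable n H z) x \<partial>Leb n) \<le> ennreal (exp (- info n \<sigma> H z))"
proof -
  have pos: "0 < noise_density n \<sigma> y" for y using s by (rule noise_density_pos)
  have "(\<integral>\<^sup>+x. indicator (confusable n H z) x \<partial>Leb n)
      \<le> (\<integral>\<^sup>+x. ennreal (1 / noise_density n \<sigma> z) * ennreal (noise_density n \<sigma> (\<lambda>i. z i - H i * x i)) \<partial>Leb n)"
  proof (intro nn_integral_mono)
    fix x
    show "indicator (confusable n H z) x \<le> ennreal (1 / noise_density n \<sigma> z) * ennreal (noise_density n \<sigma> (\<lambda>i. z i - H i * x i))"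
    proof (cases "x \<in> confusable n H z")
      case True
      have "noise_density n \<sigma> z \<le> noise_density n \<sigma> (\<lambda>i. z i - H i * x i)"
        using True s by (auto simp: noise_density_eq confusable_def intro!: mult_left_mono divide_right_mono)
      then have "1 \<le> (1 / noise_density n \<sigma> z) * noise_density n \<sigma> (\<lambda>i. z i - H i * x i)"
        using pos[of z] by simp
      then show ?thesis
        using True pos by (simp add: ennreal_mult[symmetric] less_imp_le flip: ennreal_1)
    qed simp
  qed
  also have "\<dots> = ennreal (1 / noise_density n \<sigma> z) * (\<integral>\<^sup>+x. ennreal (noise_density n \<sigma> (\<lambda>i. z i - H i * x i)) \<partial>Leb n)"
    by (intro nn_integral_cmult) (simp add: noise_density_def)
  also have "\<dots> = ennreal (1 / noise_density n \<sigma> z) * ennreal (1 / (\<Prod>i<n. H i))"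
    by (subst nn_integral_noise_density_affine[OF s H]) auto
  also have "\<dots> = ennreal (1 / noise_density n \<sigma> z * (1 / (\<Prod>i<n. H i)))"
    using pos[of z] H by (intro ennreal_mult[symmetric] divide_nonneg_nonneg prod_nonneg) (auto simp: less_imp_le)
  also have "1 / noise_density n \<sigma> z * (1 / (\<Prod>i<n. H i)) = exp (- info n \<sigma> H z)"
    by (simp add: exp_minus exp_info[OF s H] inverse_eq_divide mult.commute)
  finally show ?thesis .
qed

section \<open>Torus codes and achievability\<close>

definition torus_code :: "nat \<Rightarrow> nat \<Rightarrow> real \<Rightarrow> (nat \<Rightarrow> real) \<Rightarrow> (nat \<Rightarrow> real) set" where
  "torus_code n M a v = (\<lambda>(k, m). torus_point n (int k) v a m) ` ({..<M} \<times> int_vectors n)"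

definition index_diffs :: "nat \<Rightarrow> int set" where
  "index_diffs M = {l. l \<noteq> 0 \<and> \<bar>l\<bar> < int M}"

lemma finite_index_diffs: "finite (index_diffs M)"
  by (rule finite_subset[of _ "{- int M..int M}"]) (auto simp: index_diffs_def)

lemma card_index_diffs: "card (index_diffs M) \<le> 2 * M"
proof (cases "M = 0")
  case False
  have "card (index_diffs M) \<le> card ({- int M<..<int M} - {0})"
    by (intro card_mono) (auto simp: index_diffs_def)
  also have "\<dots> \<le> 2 * M" using False by (subst card_Diff_singleton) auto
  finally show ?thesis .
qed (simp add: index_diffs_def)

text \<open>Differences of code points involve the two indices only through their difference. Hence
  a single family, indexed by \<open>index_diffs\<close> and the lattice, contains the competitors
  of every code point with another index.\<close>

lemma torus_point_diff:
  "i < n \<Longrightarrow> torus_point n k v a m i - torus_point n k' v a m' i = torus_point n (k - k') v a (\<lambda>i\<in>{..<n}. m i - m' i) i"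
  by (simp add: torus_point_def algebra_simps)

lemma is_IC_torus_code: "is_IC n (torus_code n M a v)"
  unfolding is_IC_def torus_code_def
  by (auto intro!: countable_image countable_SIGMA countable_int_vectors) (auto simp: torus_point_def)

lemma ints_in_interval:
  fixes a c B :: real
  assumes "a > 0"
  shows "finite {j::int. \<bar>c + a * of_int j\<bar> < B / 2}"
    and "B / a - 1 \<le> real (card {j::int. \<bar>c + a * of_int j\<bar> < B / 2})"
proof -
  define x y where "x = (- B / 2 - c) / a" and "y = (B / 2 - c) / a"
  have "\<bar>c + a * of_int j\<bar> < B / 2 \<longleftrightarrow> j \<in> {\<lfloor>x\<rfloor><..<\<lceil>y\<rceil>}" for j :: int
  proof -
    have "\<bar>c + a * of_int j\<bar> < B / 2 \<longleftrightarrow> - B / 2 - c < of_int j * a \<and> of_int j * a < B / 2 - c"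
      by (simp only: abs_less_iff mult.commute[of a]) auto
    also have "\<dots> \<longleftrightarrow> x < of_int j \<and> of_int j < y"
      using assms by (simp add: x_def y_def pos_less_divide_eq pos_divide_less_eq)
    also have "\<dots> \<longleftrightarrow> j \<in> {\<lfloor>x\<rfloor><..<\<lceil>y\<rceil>}"
      by (simp add: floor_less_iff less_ceiling_iff)
    finally show ?thesis .
  qed
  then have eq: "{j::int. \<bar>c + a * of_int j\<bar> < B / 2} = {\<lfloor>x\<rfloor><..<\<lceil>y\<rceil>}"
    by (intro set_eqI) (simp only: mem_Collect_eq)
  show "finite {j::int. \<bar>c + a * of_int j\<bar> < B / 2}" unfolding eq by simp
  have "B / a - 1 = y - x - 1"
    using assms by (simp add: x_def y_def diff_divide_distrib[symmetric])
  also have "\<dots> \<le> of_int (\<lceil>y\<rceil> - \<lfloor>x\<rfloor> - 1)"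
    using of_int_floor_le[of x] le_of_int_ceiling[of y] by (simp only: of_int_diff of_int_1)
  also have "\<dots> \<le> real (nat (\<lceil>y\<rceil> - \<lfloor>x\<rfloor> - 1))" by simp
  also have "\<dots> = real (card {\<lfloor>x\<rfloor><..<\<lceil>y\<rceil>})" by (simp add: algebra_simps)
  finally show "B / a - 1 \<le> real (card {j::int. \<bar>c + a * of_int j\<bar> < B / 2})" unfolding eq .
qed

text \<open>\<open>distinct\<close> makes the parametrisation by index and lattice vector injective,
  so the count is a sum over the indices of products of one-dimensional counts.
  \<open>a \<le> B\<close> keeps the base of the power nonnegative.\<close>

lemma Mcount_torus_code:
  assumes "a > 0" and "a \<le> B"
    and distinct: "\<And>l m i. l \<in> index_diffs M \<Longrightarrow> m \<in> int_vectors n \<Longrightarrow> \<exists>i<n. torus_point n l v a m i \<noteq> 0"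
  shows "real M * (B / a - 1) ^ n \<le> real (Mcount n (torus_code n M a v) B)"
proof -
  define J where "J k = PiE {..<n} (\<lambda>i. {j::int. \<bar>of_int (int k) * v i + a * of_int j\<bar> < B / 2})" for k :: nat
  have finJ: "finite (J k)" for k
    unfolding J_def using assms(1) by (intro finite_PiE ints_in_interval) auto
  have "torus_code n M a v \<inter> cube n B = (\<lambda>(k, m). torus_point n (int k) v a m) ` (SIGMA k:{..<M}. J k)"
  proof (intro equalityI subsetI)
    fix x assume "x \<in> torus_code n M a v \<inter> cube n B"
    then obtain k m where km: "k < M" "m \<in> int_vectors n" "x = torus_point n (int k) v a m" "x \<in> cube n B"
      by (auto simp: torus_code_def)
    then have "m \<in> J k" by (auto simp: J_def PiE_iff cube_def torus_point_def)
    with km show "x \<in> (\<lambda>(k, m). torus_point n (int k) v a m) ` (SIGMA k:{..<M}. J k)" by auto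
  next
    fix x assume "x \<in> (\<lambda>(k, m). torus_point n (int k) v a m) ` (SIGMA k:{..<M}. J k)"
    then obtain k m where km: "k < M" "m \<in> J k" "x = torus_point n (int k) v a m" by auto
    then have "m \<in> int_vectors n" "x \<in> cube n B"
      by (auto simp: J_def PiE_iff cube_def torus_point_def)
    with km show "x \<in> torus_code n M a v \<inter> cube n B" by (auto simp: torus_code_def)
  qed
  moreover have "inj_on (\<lambda>(k, m). torus_point n (int k) v a m) (SIGMA k:{..<M}. J k)"
  proof (rule inj_onI, clarify)
    fix k m k' m' assume k: "k < M" "m \<in> J k" and k': "k' < M" "m' \<in> J k'"
      and eq: "torus_point n (int k) v a m = torus_point n (int k') v a m'"
    let ?m = "\<lambda>i\<in>{..<n}. m i - m' i"
    have z: "torus_point n (int k - int k') v a ?m i = 0" if "i < n" for i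
      using torus_point_diff[OF that, of "int k" v a m "int k'" m'] eq by simp
    have kk: "k = k'"
    proof (rule ccontr)
      assume "k \<noteq> k'"
      then have "int k - int k' \<in> index_diffs M" using k k' by (auto simp: index_diffs_def)
      from distinct[OF this, of ?m] z show False by auto
    qed
    have "m i = m' i" if "i \<in> {..<n}" for i
      using z[of i] that \<open>a > 0\<close> by (simp add: kk torus_point_def)
    then have "m = m'" using k k' by (intro PiE_ext[of m "{..<n}" "\<lambda>_. UNIV" m']) (auto simp: J_def PiE_iff)
    with kk show "k = k' \<and> m = m'" by simp
  qed
  ultimately have "Mcount n (torus_code n M a v) B = (\<Sum>k<M. card (J k))"
    unfolding Mcount_def using finJ by (simp add: card_image)
  moreover have "(B / a - 1) ^ n \<le> real (card (J k))" for k
  proof -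
    have "(B / a - 1) ^ n = (\<Prod>i<n. B / a - 1)" by simp
    also have "\<dots> \<le> (\<Prod>i<n. real (card {j::int. \<bar>of_int (int k) * v i + a * of_int j\<bar> < B / 2}))"
      using assms by (intro prod_mono conjI ints_in_interval) auto
    also have "\<dots> = real (card (J k))" unfolding J_def by (subst card_PiE) auto
    finally show ?thesis .
  qed
  then have "real M * (B / a - 1) ^ n \<le> (\<Sum>k<M. real (card (J k)))"
    using sum_mono[of "{..<M}" "\<lambda>_. (B / a - 1) ^ n" "\<lambda>k. real (card (J k))"] by simp
  ultimately show ?thesis by simp
qed

text \<open>The count of \<open>Mcount_torus_code\<close> divided by the volume of the cube tends to
  \<open>M / a ^ n\<close>. A lower bound is what a supremum over constellations asks for; if the
  density were infinite, so would be \<open>NLD\<close>.\<close>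

lemma NLD_torus_code:
  assumes "a > 0" "0 < M" "0 < n"
    and distinct: "\<And>l m i. l \<in> index_diffs M \<Longrightarrow> m \<in> int_vectors n \<Longrightarrow> \<exists>i<n. torus_point n l v a m i \<noteq> 0"
  shows "ereal (ln (real M / a ^ n) / real n) \<le> NLD n (torus_code n M a v)"
proof -
  let ?g = "IC_density n (torus_code n M a v)"
  have "((\<lambda>B. ereal (real M * (inverse a - inverse B) ^ n)) \<longlongrightarrow> ereal (real M * (inverse a - 0) ^ n)) at_top"
    by (intro tendsto_intros tendsto_inverse_0_at_top filterlim_ident)
  then have "ereal (real M * (inverse a - 0) ^ n) = Limsup at_top (\<lambda>B. ereal (real M * (inverse a - inverse B) ^ n))"
    by (intro lim_imp_Limsup[symmetric]) auto
  also have "\<dots> \<le> ?g"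
    unfolding IC_density_def
  proof (rule Limsup_mono)
    show "\<forall>\<^sub>F B in at_top. ereal (real M * (inverse a - inverse B) ^ n)
        \<le> ereal (real (Mcount n (torus_code n M a v) B) / B ^ n)"
      using eventually_ge_at_top[of a]
    proof eventually_elim
      case (elim B)
      then have "0 < B" using \<open>a > 0\<close> by simp
      have "inverse a - inverse B = (B / a - 1) / B"
        using \<open>0 < B\<close> \<open>a > 0\<close> by (simp add: divide_simps)
      then have "real M * (inverse a - inverse B) ^ n = real M * (B / a - 1) ^ n / B ^ n"
        by (simp add: power_divide)
      also have "\<dots> \<le> real (Mcount n (torus_code n M a v) B) / B ^ n"
        using \<open>0 < B\<close> by (intro divide_right_mono Mcount_torus_code[OF \<open>a > 0\<close> elim distinct]) auto
      finally show ?case by simp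
    qed
  qed
  finally have le: "ereal (real M / a ^ n) \<le> ?g" by (simp add: power_inverse divide_inverse)
  have pos: "0 < real M / a ^ n" using assms by simp
  show ?thesis
  proof (cases ?g)
    case (real r)
    then have "real M / a ^ n \<le> r" using le by simp
    then have "ln (real M / a ^ n) / real n \<le> ln r / real n"
      using pos by (intro divide_right_mono ln_mono) auto
    with real pos \<open>real M / a ^ n \<le> r\<close> show ?thesis
      by (auto simp: NLD_def Let_def)
  next
    case PInf
    then show ?thesis by (simp add: NLD_def Let_def)
  next
    case MInf
    with le show ?thesis by simp
  qed
qed

section \<open>Expected number of competitors\<close>

text \<open>The competitors are counted for all index differences at once, so the value bounds the
  count for every sent point. Writing the sum over lattice vectors as an integral over a counting
  measure makes it accessible to Fubini.\<close>

definition alias_count :: "nat \<Rightarrow> nat \<Rightarrow> real \<Rightarrow> (nat \<Rightarrow> real) \<Rightarrow> (nat \<Rightarrow> real) \<Rightarrow> (nat \<Rightarrow> real) \<Rightarrow> ennreal" where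
  "alias_count n M a v H z = (\<Sum>l\<in>index_diffs M. \<integral>\<^sup>+m. indicator (confusable n H z) (torus_point n l v a m) \<partial>count_space (int_vectors n))"

lemma confusable_indicator_measurable:
  "(\<lambda>p. indicator (confusable n (fst (snd p)) (snd (snd p))) (torus_point n l (fst p) a m) :: ennreal)
    \<in> borel_measurable (PiM {..<n} (\<lambda>_. borel) \<Otimes>\<^sub>M (PiM {..<n} (\<lambda>_. borel) \<Otimes>\<^sub>M PiM {..<n} (\<lambda>_. borel)))"
proof -
  have "(\<lambda>p. indicator (confusable n (fst (snd p)) (snd (snd p))) (torus_point n l (fst p) a m) :: ennreal)
   = (\<lambda>p. if (\<Sum>i<n. (snd (snd p) i - fst (snd p) i * (of_int l * fst p i + a * of_int (m i)))\<^sup>2)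
        \<le> (\<Sum>i<n. (snd (snd p) i)\<^sup>2) then 1 else 0)"
    by (auto simp: confusable_def torus_point_def fun_eq_iff indicator_def)
  also have "\<dots> \<in> borel_measurable (PiM {..<n} (\<lambda>_. borel) \<Otimes>\<^sub>M (PiM {..<n} (\<lambda>_. borel) \<Otimes>\<^sub>M PiM {..<n} (\<lambda>_. borel)))"
    by measurable
  finally show ?thesis .
qed

lemma alias_count_measurable:
  "(\<lambda>p. alias_count n M a (fst p) (fst (snd p)) (snd (snd p)))
    \<in> borel_measurable (PiM {..<n} (\<lambda>_. borel) \<Otimes>\<^sub>M (PiM {..<n} (\<lambda>_. borel) \<Otimes>\<^sub>M PiM {..<n} (\<lambda>_. borel)))"
  unfolding alias_count_def
  by (intro borel_measurable_sum borel_measurable_nn_integral_count_space countable_int_vectors confusable_indicator_measurable)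

text \<open>Fubini puts the average over \<open>v\<close> innermost. For fixed fading and noise each
  index difference then contributes the volume of \<open>confusable\<close>, at most
  \<open>exp (- info)\<close>, which is below \<open>exp (- r)\<close> on the event considered;
  there are at most \<open>2 * M\<close> differences.\<close>

lemma torus_average_alias:
  assumes s: "\<sigma> > 0" and f: "fading_pdf f" and "0 < a" "0 < n"
  shows "(\<integral>\<^sup>+v. indicator (PiE {..<n} (\<lambda>_. {0..<a})) v *
      (\<integral>\<^sup>+x. indicator {x. r < info n \<sigma> (fst x) (snd x)} x * alias_count n M a v (fst x) (snd x) \<partial>joint n \<sigma> f) \<partial>Leb n)
    \<le> ennreal (2 * real M / exp r)"
proof -
  interpret P: prob_space "joint n \<sigma> f" using s f by (rule prob_space_joint)
  interpret L: finite_product_sigma_finite "\<lambda>_. lborel" "{..<n}" by standard simp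
  interpret pair_sigma_finite "Leb n" "joint n \<sigma> f" by standard
  let ?box = "PiE {..<n} (\<lambda>_. {0..<a})"
  let ?E = "\<lambda>x. indicator {x. r < info n \<sigma> (fst x) (snd x)} x :: ennreal"
  have box[measurable]: "?box \<in> sets (Leb n)" by (intro sets_PiM_I_finite) auto
  have Em[measurable]: "?E \<in> borel_measurable (PiM {..<n} (\<lambda>_. borel) \<Otimes>\<^sub>M PiM {..<n} (\<lambda>_. borel))"
  proof -
    have "?E = (\<lambda>x. if r < info n \<sigma> (fst x) (snd x) then 1 else 0)" by (auto simp: fun_eq_iff)
    also have "\<dots> \<in> borel_measurable (PiM {..<n} (\<lambda>_. borel) \<Otimes>\<^sub>M PiM {..<n} (\<lambda>_. borel))" by measurable
    finally show ?thesis .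
  qed
  have am[measurable]: "(\<lambda>p. alias_count n M a (fst p) (fst (snd p)) (snd (snd p))) \<in> borel_measurable (Leb n \<Otimes>\<^sub>M joint n \<sigma> f)"
    using alias_count_measurable by measurable
  have am1[measurable]: "(\<lambda>x. alias_count n M a v (fst x) (snd x)) \<in> borel_measurable (joint n \<sigma> f)"
    if "v \<in> space (Leb n)" for v
    using measurable_compose[OF measurable_Pair1'[OF that] am] by simp
  have am2[measurable]: "(\<lambda>v. alias_count n M a v (fst x) (snd x)) \<in> borel_measurable (Leb n)"
    if "x \<in> space (joint n \<sigma> f)" for x
    using measurable_compose[OF measurable_Pair2'[OF that] am] by simp
  have nm: "(\<lambda>x. indicator (confusable n H z) x :: ennreal) \<in> borel_measurable (Leb n)" for H z
  proof -
    have "(\<lambda>x. indicator (confusable n H z) x :: ennreal) = (\<lambda>x. if (\<Sum>i<n. (z i - H i * x i)\<^sup>2) \<le> (\<Sum>i<n. (z i)\<^sup>2) then 1 else 0)"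
      by (auto simp: confusable_def fun_eq_iff)
    also have "\<dots> \<in> borel_measurable (Leb n)" by measurable
    finally show ?thesis .
  qed
  have "(\<integral>\<^sup>+v. indicator ?box v * (\<integral>\<^sup>+x. ?E x * alias_count n M a v (fst x) (snd x) \<partial>joint n \<sigma> f) \<partial>Leb n)
      = (\<integral>\<^sup>+v. (\<integral>\<^sup>+x. indicator ?box v * (?E x * alias_count n M a v (fst x) (snd x)) \<partial>joint n \<sigma> f) \<partial>Leb n)"
    by (intro nn_integral_cong nn_integral_cmult[symmetric]) measurable
  also have "\<dots> = (\<integral>\<^sup>+x. (\<integral>\<^sup>+v. indicator ?box v * (?E x * alias_count n M a v (fst x) (snd x)) \<partial>Leb n) \<partial>joint n \<sigma> f)"
    by (intro Fubini'[symmetric]) measurable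
  also have "\<dots> \<le> (\<integral>\<^sup>+x. ennreal (2 * real M / exp r) \<partial>joint n \<sigma> f)"
  proof (rule nn_integral_mono_AE)
    have "AE x in joint n \<sigma> f. \<forall>i<n. 0 < fst x i"
    proof -
      interpret F: prob_space "fading n f" using f by (rule prob_space_fading)
      interpret N: prob_space "noise n \<sigma>" using s by (rule prob_space_noise)
      interpret Q: pair_sigma_finite "fading n f" "noise n \<sigma>" by standard
      have "AE H in fading n f. AE z in noise n \<sigma>. \<forall>i<n. 0 < fst (H, z) i"
        using AE_fading_pos[OF f, of n] by (rule eventually_mono) auto
      then show ?thesis by (intro Q.AE_pair_measure) auto
    qed
    then show "AE x in joint n \<sigma> f. (\<integral>\<^sup>+v. indicator ?box v * (?E x * alias_count n M a v (fst x) (snd x)) \<partial>Leb n)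
        \<le> ennreal (2 * real M / exp r)"
      using AE_space
    proof eventually_elim
      case (elim x)
      note [measurable] = am2[OF elim(2)]
      let ?A = "confusable n (fst x) (snd x)"
      have im[measurable]: "(\<lambda>v. \<integral>\<^sup>+m. indicator ?A (torus_point n l v a m) \<partial>count_space (int_vectors n)) \<in> borel_measurable (Leb n)" for l
      proof (intro borel_measurable_nn_integral_count_space countable_int_vectors)
        fix m show "(\<lambda>v. indicator ?A (torus_point n l v a m) :: ennreal) \<in> borel_measurable (Leb n)"
          by (rule measurable_compose[OF _ nm]) (simp add: torus_point_def)
      qed
      have 1: "(\<integral>\<^sup>+v. indicator ?box v * (?E x * alias_count n M a v (fst x) (snd x)) \<partial>Leb n)
          = ?E x * (\<integral>\<^sup>+v. indicator ?box v * alias_count n M a v (fst x) (snd x) \<partial>Leb n)"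
        by (subst nn_integral_cmult[symmetric]) (auto simp: ac_simps)
      have "(\<integral>\<^sup>+v. indicator ?box v * alias_count n M a v (fst x) (snd x) \<partial>Leb n)
          = (\<Sum>l\<in>index_diffs M. \<integral>\<^sup>+v. indicator ?box v * (\<integral>\<^sup>+m. indicator ?A (torus_point n l v a m) \<partial>count_space (int_vectors n)) \<partial>Leb n)"
        unfolding alias_count_def sum_distrib_left by (intro nn_integral_sum) measurable
      also have "\<dots> = (\<Sum>l\<in>index_diffs M. \<integral>\<^sup>+x. indicator ?A x \<partial>Leb n)"
        using assms by (intro sum.cong refl torus_average nm) (auto simp: index_diffs_def)
      also have "\<dots> \<le> (\<Sum>l\<in>index_diffs M. ennreal (exp (- info n \<sigma> (fst x) (snd x))))"
        using elim by (intro sum_mono confusable_volume s) auto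
      also have "\<dots> = ennreal (real (card (index_diffs M)) * exp (- info n \<sigma> (fst x) (snd x)))"
        by (simp add: ennreal_of_nat_eq_real_of_nat ennreal_mult)
      also have "\<dots> \<le> ennreal (2 * real M * exp (- info n \<sigma> (fst x) (snd x)))"
        using card_index_diffs[of M] by (intro ennreal_leI mult_right_mono) auto
      finally have "(\<integral>\<^sup>+v. indicator ?box v * (?E x * alias_count n M a v (fst x) (snd x)) \<partial>Leb n)
          \<le> ?E x * ennreal (2 * real M * exp (- info n \<sigma> (fst x) (snd x)))"
        unfolding 1 by (rule mult_left_mono) simp
      also have "\<dots> \<le> ennreal (2 * real M * exp (- r))"
        by (cases "r < info n \<sigma> (fst x) (snd x)") (auto intro!: ennreal_leI mult_left_mono)
      finally show ?case by (simp add: exp_minus divide_inverse)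
    qed
  qed
  also have "\<dots> = ennreal (2 * real M / exp r)"
    by (simp add: P.emeasure_space_1)
  finally show ?thesis .
qed

text \<open>The average over the box is at most \<open>2 * M / exp r\<close>. The constant 3 leaves
  a strict gap, so that not all offsets can exceed the claimed value.\<close>

lemma exists_torus_code_offset:
  assumes s: "\<sigma> > 0" and f: "fading_pdf f" and "0 < a" "0 < n" "0 < M"
  shows "\<exists>v. (\<integral>\<^sup>+x. indicator {x. r < info n \<sigma> (fst x) (snd x)} x * alias_count n M a v (fst x) (snd x) \<partial>joint n \<sigma> f)
    \<le> ennreal (3 * real M / (exp r * a ^ n))"
proof (rule ccontr)
  let ?T = "\<lambda>v. \<integral>\<^sup>+x. indicator {x. r < info n \<sigma> (fst x) (snd x)} x * alias_count n M a v (fst x) (snd x) \<partial>joint n \<sigma> f"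
  let ?c = "3 * real M / (exp r * a ^ n)"
  let ?box = "PiE {..<n} (\<lambda>_. {0..<a})"
  assume "\<not> ?thesis"
  then have c: "ennreal ?c \<le> ?T v" for v by (auto simp: not_le less_imp_le)
  have box[measurable]: "?box \<in> sets (Leb n)" by (intro sets_PiM_I_finite) auto
  have vol: "emeasure (Leb n) ?box = ennreal (a ^ n)"
    using assms by (subst lborel_product.emeasure_PiM) (auto simp: ennreal_power)
  have "ennreal (3 * real M / exp r) = ennreal ?c * emeasure (Leb n) ?box"
    unfolding vol using assms by (subst ennreal_mult[symmetric]) auto
  also have "\<dots> = (\<integral>\<^sup>+v. indicator ?box v * ennreal ?c \<partial>Leb n)"
    by (simp add: nn_integral_multc mult.commute)
  also have "\<dots> \<le> (\<integral>\<^sup>+v. indicator ?box v * ?T v \<partial>Leb n)"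
    by (intro nn_integral_mono mult_left_mono c) auto
  also have "\<dots> \<le> ennreal (2 * real M / exp r)"
    using assms by (intro torus_average_alias) auto
  finally show False using assms by (simp add: divide_le_cancel)
qed

section \<open>From competitors to the error probability\<close>

text \<open>Covers the competitors with the same index, which differ from the sent point by a
  lattice vector: if one of them is closer, the triangle inequality in a coordinate where they
  differ gives the inequality. The positivity conjunct makes the event decrease to the empty set as
  \<open>a\<close> grows, even at vectors with a vanishing coefficient.\<close>

definition self_alias :: "nat \<Rightarrow> real \<Rightarrow> ((nat \<Rightarrow> real) \<times> (nat \<Rightarrow> real)) \<Rightarrow> bool" where
  "self_alias n a x \<longleftrightarrow> (\<exists>i\<in>{..<n}. 0 < fst x i \<and> a * fst x i \<le> 2 * sqrt (\<Sum>i<n. (snd x i)\<^sup>2))"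

text \<open>A pointwise upper bound for the indicator of a decoding error. Competitors are counted
  only where \<open>info\<close> exceeds \<open>r\<close>, since their expected number is controlled
  only there; the complementary event is charged in full.\<close>

definition error_bound :: "nat \<Rightarrow> real \<Rightarrow> nat \<Rightarrow> real \<Rightarrow> (nat \<Rightarrow> real) \<Rightarrow> real \<Rightarrow> (nat \<Rightarrow> real) \<times> (nat \<Rightarrow> real) \<Rightarrow> ennreal" where
  "error_bound n \<sigma> M a v r x = (if info n \<sigma> (fst x) (snd x) \<le> r then 1 else 0) + (if self_alias n a x then 1 else 0)
     + (if r < info n \<sigma> (fst x) (snd x) then alias_count n M a v (fst x) (snd x) else 0)"

lemma nn_integral_count_space_ge_one:
  assumes "i \<in> I" "1 \<le> f i"
  shows "1 \<le> (\<integral>\<^sup>+i. f i \<partial>count_space I)"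
proof -
  have "1 = (\<integral>\<^sup>+j. indicator {i} j \<partial>count_space I)"
    using assms(1) by (subst nn_integral_indicator) (auto simp: emeasure_count_space_finite)
  also have "\<dots> \<le> (\<integral>\<^sup>+i. f i \<partial>count_space I)"
    using assms(2) by (intro nn_integral_mono) (auto split: split_indicator)
  finally show ?thesis .
qed

lemma alias_count_ge_one:
  assumes "l \<in> index_diffs M" "m \<in> int_vectors n" "torus_point n l v a m \<in> confusable n H z"
  shows "1 \<le> alias_count n M a v H z"
proof -
  have "1 \<le> (\<integral>\<^sup>+m. indicator (confusable n H z) (torus_point n l v a m) \<partial>count_space (int_vectors n) :: ennreal)"
    using assms by (intro nn_integral_count_space_ge_one[of m]) auto
  also have "\<dots> \<le> alias_count n M a v H z"
    unfolding alias_count_def using assms finite_index_diffs by (intro member_le_sum) auto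
  finally show ?thesis .
qed

lemma self_alias_measurable[measurable]:
  "Measurable.pred (PiM {..<n} (\<lambda>_. borel) \<Otimes>\<^sub>M PiM {..<n} (\<lambda>_. borel)) (self_alias n a)"
  unfolding self_alias_def[abs_def]
proof (rule pred_intros_finite)
  fix i assume "i \<in> {..<n}"
  then have [measurable]: "(\<lambda>x. x i) \<in> borel_measurable (PiM {..<n} (\<lambda>_. borel :: real measure))" by simp
  show "Measurable.pred (PiM {..<n} (\<lambda>_. borel) \<Otimes>\<^sub>M PiM {..<n} (\<lambda>_. borel))
      (\<lambda>x. 0 < fst x i \<and> a * fst x i \<le> 2 * sqrt (\<Sum>i<n. (snd x i)\<^sup>2))"
    by measurable
qed simp

lemma alias_count_extensional_measurable:
  "(\<lambda>x. alias_count n M a v (fst x) (snd x)) \<in> borel_measurable (PiM {..<n} (\<lambda>_. borel) \<Otimes>\<^sub>M PiM {..<n} (\<lambda>_. borel))"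
  if "v \<in> PiE {..<n} (\<lambda>_. UNIV)"
  using measurable_compose[OF measurable_Pair1' alias_count_measurable[of n M a], of v] that
  by (simp add: space_PiM)

text \<open>Measurability at a fixed offset comes from a section of the product space, which
  requires an extensional \<open>v\<close>. Only the coordinates below \<open>n\<close> are read, so
  it carries over to every \<open>v\<close>.\<close>

lemma alias_count_restrict: "alias_count n M a (restrict v {..<n}) = alias_count n M a v"
  by (simp add: fun_eq_iff alias_count_def torus_point_def cong: restrict_cong)

lemma alias_count_offset_measurable[measurable]:
  "(\<lambda>x. alias_count n M a v (fst x) (snd x)) \<in> borel_measurable (PiM {..<n} (\<lambda>_. borel) \<Otimes>\<^sub>M PiM {..<n} (\<lambda>_. borel))"
  using alias_count_extensional_measurable[of "restrict v {..<n}" n M a] by (simp add: alias_count_restrict)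

lemma error_bound_measurable[measurable]:
  "error_bound n \<sigma> M a v r \<in> borel_measurable (PiM {..<n} (\<lambda>_. borel) \<Otimes>\<^sub>M PiM {..<n} (\<lambda>_. borel))"
  unfolding error_bound_def by measurable

text \<open>An error exhibits a strictly closer competitor. If its index differs from that of
  \<open>t\<close>, its difference from \<open>t\<close> is counted by \<open>alias_count\<close>;
  if the index is the same, the two points differ by a lattice vector and \<open>self_alias\<close>
  holds. The bound obtained does not mention \<open>t\<close>.\<close>

lemma Pe_cond_torus_code_le:
  assumes s: "\<sigma> > 0" and H: "\<And>i. i < n \<Longrightarrow> 0 < H i" and "0 < a"
    and t: "t \<in> scale n H ` torus_code n M a v"
  shows "ennreal (Pe_cond n \<sigma> (scale n H ` torus_code n M a v) t) \<le> (\<integral>\<^sup>+z. error_bound n \<sigma> M a v r (H, z) \<partial>noise n \<sigma>)"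
proof -
  interpret N: prob_space "noise n \<sigma>" using s by (rule prob_space_noise)
  let ?T = "scale n H ` torus_code n M a v"
  let ?B = "{z \<in> space (noise n \<sigma>). restrict (\<lambda>i. t i + z i) {..<n} \<notin> voronoi n ?T t}"
  obtain k m where k: "k < M" "m \<in> int_vectors n" "t = scale n H (torus_point n (int k) v a m)"
    using t by (auto simp: torus_code_def)
  have "countable ?T" using is_IC_torus_code[of n M a v] by (auto simp: is_IC_def)
  have "{z \<in> space (noise n \<sigma>). restrict (\<lambda>i. t i + z i) {..<n} \<in> voronoi n ?T t} \<in> sets (noise n \<sigma>)"
    using voronoi_measurable[OF \<open>countable ?T\<close>, of n t] by (simp add: sets_noise space_noise space_PiM)
  moreover have "?B = space (noise n \<sigma>) - {z \<in> space (noise n \<sigma>). restrict (\<lambda>i. t i + z i) {..<n} \<in> voronoi n ?T t}"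
    by auto
  ultimately have B: "?B \<in> sets (noise n \<sigma>)" by simp
  have "1 \<le> error_bound n \<sigma> M a v r (H, z)" if "z \<in> ?B" for z
  proof -
    from that obtain t' where t': "t' \<in> ?T" "(\<Sum>i<n. (t i + z i - t' i)\<^sup>2) < (\<Sum>i<n. (z i)\<^sup>2)"
      unfolding voronoi_iff by (auto simp: not_le)
    then obtain k' m' where k': "k' < M" "m' \<in> int_vectors n" "t' = scale n H (torus_point n (int k') v a m')"
      by (auto simp: torus_code_def)
    define l where "l = int k' - int k"
    define d where "d = (\<lambda>i\<in>{..<n}. m' i - m i)"
    have d: "d \<in> int_vectors n" by (simp add: d_def)
    have tz: "t i + z i - t' i = z i - H i * torus_point n l v a d i" if "i < n" for i
      using torus_point_diff[OF that, of "int k'" v a m' "int k" m] that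
      by (simp add: k(3) k'(3) scale_def l_def d_def algebra_simps)
    have "(\<Sum>i<n. (t i + z i - t' i)\<^sup>2) = (\<Sum>i<n. (z i - H i * torus_point n l v a d i)\<^sup>2)"
      by (intro sum.cong refl) (simp only: tz lessThan_iff)
    then have nr: "(\<Sum>i<n. (z i - H i * torus_point n l v a d i)\<^sup>2) < (\<Sum>i<n. (z i)\<^sup>2)"
      using t'(2) by simp
    show ?thesis
    proof (cases "l = 0")
      case False
      then have "l \<in> index_diffs M" using k(1) k'(1) by (auto simp: index_diffs_def l_def)
      then have "1 \<le> alias_count n M a v H z"
        using nr d by (intro alias_count_ge_one[of l _ d]) (auto simp: confusable_def)
      then show ?thesis
        by (cases "r < info n \<sigma> H z") (auto simp: error_bound_def not_less intro: add_increasing add_increasing2)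
    next
      case True
      \<comment> \<open>The strict inequality \<open>nr\<close> excludes the sent point
        itself.\<close>
      have "\<exists>i<n. d i \<noteq> 0"
      proof (rule ccontr)
        assume "\<not> (\<exists>i<n. d i \<noteq> 0)"
        then have "(\<Sum>i<n. (z i - H i * torus_point n l v a d i)\<^sup>2) = (\<Sum>i<n. (z i)\<^sup>2)"
          using True by (intro sum.cong) (auto simp: torus_point_def)
        with nr show False by simp
      qed
      then obtain i where i: "i < n" "d i \<noteq> 0" by auto
      let ?x = "z i - H i * torus_point n l v a d i"
      have lci: "torus_point n l v a d i = a * of_int (d i)" using True i by (simp add: torus_point_def)
      have "\<bar>?x\<bar> \<le> sqrt (\<Sum>i<n. (z i - H i * torus_point n l v a d i)\<^sup>2)"
        by (rule real_le_rsqrt) (use i in \<open>auto intro: member_le_sum[of i "{..<n}" "\<lambda>i. (z i - H i * torus_point n l v a d i)\<^sup>2"]\<close>)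
      also have "\<dots> \<le> sqrt (\<Sum>i<n. (z i)\<^sup>2)" using nr by simp
      finally have 1: "\<bar>?x\<bar> \<le> sqrt (\<Sum>i<n. (z i)\<^sup>2)" .
      have 2: "\<bar>z i\<bar> \<le> sqrt (\<Sum>i<n. (z i)\<^sup>2)"
        by (rule real_le_rsqrt) (use i in \<open>auto intro: member_le_sum[of i "{..<n}" "\<lambda>i. (z i)\<^sup>2"]\<close>)
      \<comment> \<open>A nonzero integer has absolute value at least 1, so the translate moves
        coordinate \<open>i\<close> by at least \<open>a * H i\<close>.\<close>
      have "a * H i * 1 \<le> a * H i * \<bar>of_int (d i)\<bar>"
        using H[OF i(1)] \<open>0 < a\<close> i by (intro mult_left_mono) auto
      also have "\<dots> = \<bar>H i * torus_point n l v a d i\<bar>"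
        using H[OF i(1)] \<open>0 < a\<close> by (simp add: lci abs_mult)
      also have "\<dots> \<le> \<bar>z i\<bar> + \<bar>?x\<bar>" by linarith
      finally have "a * H i \<le> 2 * sqrt (\<Sum>i<n. (z i)\<^sup>2)" using 1 2 by simp
      then have "self_alias n a (H, z)" using i H[OF i(1)] by (auto simp: self_alias_def)
      then show ?thesis by (auto simp: error_bound_def intro: add_increasing add_increasing2)
    qed
  qed
  then have "(\<integral>\<^sup>+z. indicator ?B z \<partial>noise n \<sigma>) \<le> (\<integral>\<^sup>+z. error_bound n \<sigma> M a v r (H, z) \<partial>noise n \<sigma>)"
    by (intro nn_integral_mono) (auto split: split_indicator)
  then show ?thesis
    using B by (simp add: Pe_cond_def N.emeasure_eq_measure)
qed

text \<open>If \<open>A\<close> is empty or infinite, \<open>card A\<close> is 0 and the quotient is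
  0 by convention.\<close>

lemma ennreal_average_le:
  assumes "\<And>t. t \<in> A \<Longrightarrow> ennreal (p t) \<le> b"
  shows "ennreal ((\<Sum>t\<in>A. p t) / real (card A)) \<le> b"
proof (cases "b = \<infinity> \<or> card A = 0")
  case False
  then obtain c where c: "b = ennreal c" "0 \<le> c" by (cases b) auto
  have "p t \<le> c" if "t \<in> A" for t using assms[OF that] c by (simp add: ennreal_le_iff)
  then have "(\<Sum>t\<in>A. p t) \<le> real (card A) * c" by (rule sum_bounded_above)
  then show ?thesis using False c by (auto intro!: ennreal_leI simp: divide_le_eq mult.commute)
qed auto

text \<open>Since one bound holds for all points, it passes unchanged through the average over a
  cube and through the upper limit. What remains is to integrate the three summands of
  \<open>error_bound\<close> over fading and noise.\<close>

lemma Pe_avg_torus_code_le: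
  assumes s: "\<sigma> > 0" and f: "fading_pdf f" and "0 < a"
  shows "Pe_avg n \<sigma> f (torus_code n M a v)
    \<le> emeasure (joint n \<sigma> f) (info_le n \<sigma> f r)
      + emeasure (joint n \<sigma> f) {x \<in> space (joint n \<sigma> f). self_alias n a x}
      + (\<integral>\<^sup>+x. indicator {x. r < info n \<sigma> (fst x) (snd x)} x * alias_count n M a v (fst x) (snd x) \<partial>joint n \<sigma> f)"
proof -
  interpret N: prob_space "noise n \<sigma>" using s by (rule prob_space_noise)
  have ind: "(\<integral>\<^sup>+x. (if P x then 1 else 0) \<partial>joint n \<sigma> f) = emeasure (joint n \<sigma> f) {x \<in> space (joint n \<sigma> f). P x}"
    if [measurable]: "Measurable.pred (joint n \<sigma> f) P" for P
  proof -
    have "(\<integral>\<^sup>+x. (if P x then 1 else 0) \<partial>joint n \<sigma> f) = (\<integral>\<^sup>+x. indicator {x \<in> space (joint n \<sigma> f). P x} x \<partial>joint n \<sigma> f)"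
      by (intro nn_integral_cong) (auto split: split_indicator)
    then show ?thesis by simp
  qed
  have "Pe_avg n \<sigma> f (torus_code n M a v) \<le> (\<integral>\<^sup>+H. \<integral>\<^sup>+z. error_bound n \<sigma> M a v r (H, z) \<partial>noise n \<sigma> \<partial>fading n f)"
    unfolding Pe_avg_def
  proof (rule nn_integral_mono_AE, use AE_fading_pos[OF f, of n] in eventually_elim)
    case (elim H)
    show ?case
      using elim assms(3)
      by (intro Limsup_bounded always_eventually allI ennreal_average_le Pe_cond_torus_code_le s) auto
  qed
  also have "\<dots> = (\<integral>\<^sup>+x. error_bound n \<sigma> M a v r x \<partial>joint n \<sigma> f)"
    by (intro N.nn_integral_fst) measurable
  also have "\<dots> = (\<integral>\<^sup>+x. (if info n \<sigma> (fst x) (snd x) \<le> r then 1 else 0) \<partial>joint n \<sigma> f)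
      + (\<integral>\<^sup>+x. (if self_alias n a x then 1 else 0) \<partial>joint n \<sigma> f)
      + (\<integral>\<^sup>+x. (if r < info n \<sigma> (fst x) (snd x) then alias_count n M a v (fst x) (snd x) else 0) \<partial>joint n \<sigma> f)"
    unfolding error_bound_def by (subst nn_integral_add, measurable, subst nn_integral_add, measurable)
  also have "(\<integral>\<^sup>+x. (if r < info n \<sigma> (fst x) (snd x) then alias_count n M a v (fst x) (snd x) else 0) \<partial>joint n \<sigma> f)
      = (\<integral>\<^sup>+x. indicator {x. r < info n \<sigma> (fst x) (snd x)} x * alias_count n M a v (fst x) (snd x) \<partial>joint n \<sigma> f)"
    by (intro nn_integral_cong) auto
  also have "(\<integral>\<^sup>+x. (if info n \<sigma> (fst x) (snd x) \<le> r then 1 else 0) \<partial>joint n \<sigma> f)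
      = emeasure (joint n \<sigma> f) (info_le n \<sigma> f r)"
    by (rule ind) measurable
  also have "(\<integral>\<^sup>+x. (if self_alias n a x then 1 else 0) \<partial>joint n \<sigma> f)
      = emeasure (joint n \<sigma> f) {x \<in> space (joint n \<sigma> f). self_alias n a x}"
    by (rule ind) measurable
  finally show ?thesis .
qed

text \<open>Continuity from above along integer values of \<open>a\<close>, extended to all larger
  \<open>a\<close> by monotonicity. The threshold \<open>a0\<close> may depend on \<open>n\<close>,
  because the density of the code constrains only \<open>M / a ^ n\<close>.\<close>

lemma self_alias_small:
  assumes s: "\<sigma> > 0" and f: "fading_pdf f" and "0 < \<eta>"
  shows "\<exists>a0>0. \<forall>a\<ge>a0. emeasure (joint n \<sigma> f) {x \<in> space (joint n \<sigma> f). self_alias n a x} \<le> ennreal \<eta>"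
proof -
  interpret P: prob_space "joint n \<sigma> f" using s f by (rule prob_space_joint)
  let ?B = "\<lambda>a. {x \<in> space (joint n \<sigma> f). self_alias n a x}"
  have mB: "?B a \<in> sets (joint n \<sigma> f)" for a by measurable
  have mono: "?B b \<subseteq> ?B a" if "a \<le> b" for a b
  proof (intro subsetI CollectI conjI, goal_cases)
    case (1 x)
    then show ?case by simp
  next
    case (2 x)
    then obtain i where i: "i < n" "0 < fst x i" "b * fst x i \<le> 2 * sqrt (\<Sum>i<n. (snd x i)\<^sup>2)" by (auto simp: self_alias_def)
    have "a * fst x i \<le> b * fst x i" using that i by (intro mult_right_mono) auto
    with i(3) have "a * fst x i \<le> 2 * sqrt (\<Sum>i<n. (snd x i)\<^sup>2)" by linarith
    with i show ?case unfolding self_alias_def by (intro bexI[of _ i]) auto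
  qed
  have "(\<lambda>k::nat. P.prob (?B (real k))) \<longlonglongrightarrow> P.prob (\<Inter>k. ?B (real k))"
  proof (rule P.finite_Lim_measure_decseq)
    show "range (\<lambda>k::nat. ?B (real k)) \<subseteq> sets (joint n \<sigma> f)" using mB by blast
    show "decseq (\<lambda>k::nat. ?B (real k))"
      unfolding decseq_def by (intro allI impI mono) simp
  qed
  moreover have "(\<Inter>k::nat. ?B (real k)) = {}"
  proof (intro equals0I)
    fix x assume x: "x \<in> (\<Inter>k::nat. ?B (real k))"
    let ?N = "2 * sqrt (\<Sum>i<n. (snd x i)\<^sup>2)"
    let ?q = "\<lambda>i. if 0 < fst x i then ?N / fst x i else 0"
    obtain k :: nat where k: "(\<Sum>i<n. ?q i) < real k" using reals_Archimedean2 by blast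
    from x obtain i where i: "i < n" "0 < fst x i" "real k * fst x i \<le> ?N" by (auto simp: self_alias_def)
    have "?q i \<le> (\<Sum>i<n. ?q i)"
      using i by (intro member_le_sum) (auto intro!: divide_nonneg_nonneg sum_nonneg)
    with k i have "?N / fst x i < real k" by simp
    with i show False by (simp add: pos_divide_less_eq)
  qed
  ultimately have "(\<lambda>k::nat. P.prob (?B (real k))) \<longlonglongrightarrow> 0" by simp
  from order_tendstoD(2)[OF this \<open>0 < \<eta>\<close>] obtain k0 where k0: "\<And>k. k \<ge> k0 \<Longrightarrow> P.prob (?B (real k)) < \<eta>"
    by (auto simp: eventually_sequentially)
  have "emeasure (joint n \<sigma> f) (?B a) \<le> ennreal \<eta>" if "a \<ge> real (Suc k0)" for a
  proof -
    have "emeasure (joint n \<sigma> f) (?B a) \<le> emeasure (joint n \<sigma> f) (?B (real (Suc k0)))"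
      by (intro emeasure_mono mono that mB)
    also have "\<dots> \<le> ennreal \<eta>"
      using k0[of "Suc k0"] by (auto simp: P.emeasure_eq_measure intro!: ennreal_leI)
    finally show ?thesis .
  qed
  then show ?thesis by (intro exI[of _ "real (Suc k0)"]) auto
qed

text \<open>\<open>lt1\<close> does more than keep the bound nontrivial: it forces the chosen offset
  to produce distinct code points, so no separate choice of \<open>v\<close> outside a null set has
  to be made.\<close>

theorem achievability:
  assumes s: "\<sigma> > 0" and f: "fading_pdf f" and n: "0 < n" and "0 < \<gamma>" "0 < \<eta>"
    and lt1: "emeasure (joint n \<sigma> f) (info_le n \<sigma> f r)
      + ennreal (3 * \<gamma> / exp r) < 1"
  shows "\<exists>S. is_IC n S \<and> ereal (ln \<gamma> / real n) \<le> NLD n S \<and> Pe_avg n \<sigma> f S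
    \<le> emeasure (joint n \<sigma> f) (info_le n \<sigma> f r)
      + ennreal (3 * \<gamma> / exp r) + ennreal \<eta>"
proof -
  interpret P: prob_space "joint n \<sigma> f" using s f by (rule prob_space_joint)
  let ?I = "(info_le n \<sigma> f r)"
  have mI[measurable]: "?I \<in> sets (joint n \<sigma> f)" by measurable
  obtain a0 where a0: "0 < a0"
    "\<And>a. a \<ge> a0 \<Longrightarrow> emeasure (joint n \<sigma> f) {x \<in> space (joint n \<sigma> f). self_alias n a x} \<le> ennreal \<eta>"
    using self_alias_small[OF s f \<open>0 < \<eta>\<close>, of n] by blast
  obtain M :: nat where M: "\<gamma> * a0 ^ n < real M" using reals_Archimedean2 by blast
  have "0 < \<gamma> * a0 ^ n" using a0 \<open>0 < \<gamma>\<close> by simp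
  with M have "0 < M" by (cases "M = 0") auto
  \<comment> \<open>\<open>M\<close> points per cube of side \<open>a\<close> then have density
    exactly \<open>\<gamma>\<close>, and the size of \<open>M\<close> ensures
    \<open>a \<ge> a0\<close>.\<close>
  define a where "a = root n (real M / \<gamma>)"
  have an: "a ^ n = real M / \<gamma>" unfolding a_def using n \<open>0 < \<gamma>\<close> by simp
  have a_pos: "0 < a" unfolding a_def using n \<open>0 < \<gamma>\<close> \<open>0 < M\<close> by simp
  have "a0 \<le> a"
  proof (rule power_le_imp_le_base)
    show "a0 ^ Suc (n - 1) \<le> a ^ Suc (n - 1)"
      using n M \<open>0 < \<gamma>\<close> by (simp add: an field_simps)
  qed (use a_pos in simp)
  let ?T = "\<lambda>v. \<integral>\<^sup>+x. indicator {x. r < info n \<sigma> (fst x) (snd x)} x * alias_count n M a v (fst x) (snd x) \<partial>joint n \<sigma> f"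
  obtain v where "?T v \<le> ennreal (3 * real M / (exp r * a ^ n))"
    using exists_torus_code_offset[OF s f a_pos n \<open>0 < M\<close>, of r] by blast
  then have v: "?T v \<le> ennreal (3 * \<gamma> / exp r)"
    using \<open>0 < M\<close> by (simp add: an mult.commute)
  \<comment> \<open>If some torus point with nonzero \<open>l\<close> were 0, it would be confusable
    for all fading and noise. Then \<open>alias_count\<close> would be at least 1 everywhere, its
    integral at least the probability of \<open>info > r\<close>, and this contradicts
    \<open>lt1\<close>.\<close>
  have distinct: "\<exists>i<n. torus_point n l v a m i \<noteq> 0" if l: "l \<in> index_diffs M" and m: "m \<in> int_vectors n" for l m
  proof (rule ccontr)
    assume "\<not> (\<exists>i<n. torus_point n l v a m i \<noteq> 0)"
    then have "1 \<le> alias_count n M a v H z" for H z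
      using l m by (intro alias_count_ge_one) (auto simp: confusable_def)
    then have "(\<integral>\<^sup>+x. indicator (space (joint n \<sigma> f) - ?I) x \<partial>joint n \<sigma> f) \<le> ?T v"
      by (intro nn_integral_mono) (auto split: split_indicator)
    then have "emeasure (joint n \<sigma> f) (space (joint n \<sigma> f) - ?I) \<le> ennreal (3 * \<gamma> / exp r)"
      using v by simp
    then have "emeasure (joint n \<sigma> f) ?I + emeasure (joint n \<sigma> f) (space (joint n \<sigma> f) - ?I)
        \<le> emeasure (joint n \<sigma> f) ?I + ennreal (3 * \<gamma> / exp r)"
      by (intro add_left_mono)
    moreover have "emeasure (joint n \<sigma> f) ?I + emeasure (joint n \<sigma> f) (space (joint n \<sigma> f) - ?I) = 1"
      by (subst plus_emeasure) (auto simp: Un_absorb1 P.emeasure_space_1)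
    ultimately show False using lt1 by simp
  qed
  show ?thesis
  proof (intro exI conjI)
    show "is_IC n (torus_code n M a v)" by (rule is_IC_torus_code)
    show "ereal (ln \<gamma> / real n) \<le> NLD n (torus_code n M a v)"
      using NLD_torus_code[OF a_pos \<open>0 < M\<close> n distinct] \<open>0 < M\<close> by (simp add: an)
    have "Pe_avg n \<sigma> f (torus_code n M a v) \<le> emeasure (joint n \<sigma> f) ?I
        + emeasure (joint n \<sigma> f) {x \<in> space (joint n \<sigma> f). self_alias n a x} + ?T v"
      by (rule Pe_avg_torus_code_le[OF s f a_pos])
    also have "\<dots> \<le> emeasure (joint n \<sigma> f) ?I + ennreal \<eta> + ennreal (3 * \<gamma> / exp r)"
      by (intro add_mono order_refl v a0 \<open>a0 \<le> a\<close>)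
    finally show "Pe_avg n \<sigma> f (torus_code n M a v) \<le> emeasure (joint n \<sigma> f) ?I
      + ennreal (3 * \<gamma> / exp r) + ennreal \<eta>" by (simp add: ac_simps)
  qed
qed

section \<open>A Berry--Esseen estimate\<close>

text \<open>Levy inversion for an interval has the kernel \<open>F\<close>, whose modulus is at most
  2 / |t|; the factor |t| in the hypothesis absorbs this pole. The bound does not depend on the left
  end point, which may therefore tend to minus infinity. Absence of atoms is what inversion at the
  end points requires.\<close>

lemma cdf_diff_le_char:
  fixes h :: "real \<Rightarrow> real"
  assumes "real_distribution M" "real_distribution N"
    and atomM: "\<And>x. measure M {x} = 0" and atomN: "\<And>x. measure N {x} = 0"
    and h: "integrable lborel h"
    and le: "\<And>t. cmod (char M t - char N t) \<le> \<bar>t\<bar> * h t"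
  shows "\<bar>cdf M b - cdf N b\<bar> \<le> (\<integral>t. h t \<partial>lborel) / pi"
proof -
  interpret M: real_distribution M by fact
  interpret N: real_distribution N by fact
  have main: "\<bar>measure M {a<..b} - measure N {a<..b}\<bar> \<le> (\<integral>t. h t \<partial>lborel) / pi" if ab: "a \<le> b" for a
  proof -
    define F where "F t = (iexp (-(t * a)) - iexp (-(t * b))) / (\<i> * complex_of_real t)" for t :: real
    let ?I = "\<lambda>M T. 1 / (2 * pi) * (CLBINT t=-real T..real T. F t * char M t)"
    \<comment> \<open>Depends on the interval; it serves only to integrate each characteristic
      function separately over a bounded range.\<close>
    have Fb: "cmod (F t) \<le> b - a" if "t \<noteq> 0" for t
    proof -
      have "F t = (iexp (t * (- a)) - iexp (t * (- b))) / (\<i> * complex_of_real t)" by (simp add: F_def)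
      then show ?thesis using Levy_Inversion_aux2[of "- b" "- a" t] ab that by simp
    qed
    \<comment> \<open>Uniform in the interval, and the bound that enters the final estimate.\<close>
    have F2: "cmod (F t) * \<bar>t\<bar> \<le> 2" for t
    proof (cases "t = 0")
      case False
      have "cmod (F t) * \<bar>t\<bar> = cmod (iexp (-(t * a)) - iexp (-(t * b)))"
        using False by (simp add: F_def norm_divide norm_mult)
      also have "\<dots> \<le> cmod (iexp (-(t * a))) + cmod (iexp (-(t * b)))" by (rule norm_triangle_ineq4)
      also have "\<dots> = 2" by (simp only: norm_exp_i_times)
      finally show ?thesis .
    qed simp
    have Fm[measurable]: "F \<in> borel_measurable borel" unfolding F_def by measurable
    have int: "integrable lborel (\<lambda>t. indicator {-real T<..<real T} t *\<^sub>R (F t * char K t))"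
      if "real_distribution K" for K T
    proof -
      interpret K: real_distribution K by fact
      have "AE t in lborel. t \<in> {-real T<..<real T} \<longrightarrow> cmod (F t * char K t) \<le> b - a"
        using AE_lborel_singleton[of 0]
      proof eventually_elim
        case (elim t)
        have "cmod (F t * char K t) \<le> (b - a) * 1"
          unfolding norm_mult using Fb[OF elim] K.cmod_char_le_1[of t] ab by (intro mult_mono) auto
        then show ?case by simp
      qed
      then show ?thesis
        by (intro integrableI_bounded_set_indicator[where B="b - a"]) auto
    qed
    have eqI: "?I K T = 1 / (2 * pi) * (\<integral>t. indicator {-real T<..<real T} t *\<^sub>R (F t * char K t) \<partial>lborel)" for K T
      by (simp add: interval_lebesgue_integral_def set_lebesgue_integral_def)
    have bound: "cmod (?I M T - ?I N T) \<le> (\<integral>t. h t \<partial>lborel) / pi" for T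
    proof -
      have "?I M T - ?I N T = 1 / (2 * pi) * (\<integral>t. indicator {-real T<..<real T} t *\<^sub>R (F t * char M t)
          - indicator {-real T<..<real T} t *\<^sub>R (F t * char N t) \<partial>lborel)"
        unfolding eqI using int assms(1,2) by (simp add: Bochner_Integration.integral_diff right_diff_distrib)
      then have 1: "cmod (?I M T - ?I N T) = 1 / (2 * pi) * cmod (\<integral>t. indicator {-real T<..<real T} t *\<^sub>R (F t * char M t)
          - indicator {-real T<..<real T} t *\<^sub>R (F t * char N t) \<partial>lborel)"
        by (simp add: norm_mult norm_divide)
      have "cmod (\<integral>t. indicator {-real T<..<real T} t *\<^sub>R (F t * char M t)
          - indicator {-real T<..<real T} t *\<^sub>R (F t * char N t) \<partial>lborel)
         \<le> (\<integral>t. cmod (indicator {-real T<..<real T} t *\<^sub>R (F t * char M t)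
          - indicator {-real T<..<real T} t *\<^sub>R (F t * char N t)) \<partial>lborel)"
        by (rule integral_norm_bound)
      also have "\<dots> \<le> (\<integral>t. 2 * h t \<partial>lborel)"
      proof (rule integral_mono_AE)
        show "integrable lborel (\<lambda>t. cmod (indicator {-real T<..<real T} t *\<^sub>R (F t * char M t)
          - indicator {-real T<..<real T} t *\<^sub>R (F t * char N t)))"
          by (intro integrable_norm Bochner_Integration.integrable_diff int assms(1,2))
        show "integrable lborel (\<lambda>t. 2 * h t)" using h by simp
        show "AE t in lborel. cmod (indicator {-real T<..<real T} t *\<^sub>R (F t * char M t)
          - indicator {-real T<..<real T} t *\<^sub>R (F t * char N t)) \<le> 2 * h t"
          using AE_lborel_singleton[of 0]
        proof eventually_elim
          case (elim t)
          have h0: "0 \<le> h t"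
            using order_trans[OF norm_ge_zero le[of t]] elim by (simp add: zero_le_mult_iff)
          have "cmod (indicator {-real T<..<real T} t *\<^sub>R (F t * char M t) - indicator {-real T<..<real T} t *\<^sub>R (F t * char N t))
              = indicator {-real T<..<real T} t * cmod (F t) * cmod (char M t - char N t)"
            by (simp add: norm_mult flip: scaleR_diff_right right_diff_distrib)
          also have "\<dots> \<le> 1 * cmod (F t) * (\<bar>t\<bar> * h t)"
            by (intro mult_mono le) (auto split: split_indicator)
          also have "\<dots> \<le> 2 * h t"
            using mult_right_mono[OF F2[of t] h0] by (simp add: mult.assoc)
          finally show ?case .
        qed
      qed
      finally have 2: "cmod (\<integral>t. indicator {-real T<..<real T} t *\<^sub>R (F t * char M t)
          - indicator {-real T<..<real T} t *\<^sub>R (F t * char N t) \<partial>lborel) \<le> 2 * (\<integral>t. h t \<partial>lborel)"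
        by simp
      show ?thesis unfolding 1 using mult_left_mono[OF 2, of "1 / (2 * pi)"] by simp
    qed
    have "(\<lambda>T. ?I M T - ?I N T) \<longlonglongrightarrow> complex_of_real (measure M {a<..b}) - complex_of_real (measure N {a<..b})"
      unfolding F_def using M.Levy_Inversion[OF ab atomM atomM] N.Levy_Inversion[OF ab atomN atomN]
      by (intro tendsto_diff) auto
    then have "(\<lambda>T. cmod (?I M T - ?I N T)) \<longlonglongrightarrow> cmod (complex_of_real (measure M {a<..b} - measure N {a<..b}))"
      by (intro tendsto_norm) simp
    from tendsto_upperbound[OF this always_eventually] bound
    show ?thesis unfolding norm_of_real by auto
  qed
  have "((\<lambda>a. \<bar>(cdf M b - cdf M a) - (cdf N b - cdf N a)\<bar>) \<longlongrightarrow> \<bar>(cdf M b - 0) - (cdf N b - 0)\<bar>) at_bot"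
    by (intro tendsto_intros M.cdf_lim_at_bot N.cdf_lim_at_bot)
  moreover have "\<forall>\<^sub>F a in at_bot. \<bar>(cdf M b - cdf M a) - (cdf N b - cdf N a)\<bar> \<le> (\<integral>t. h t \<partial>lborel) / pi"
    using eventually_gt_at_bot[of b]
  proof eventually_elim
    case (elim a)
    then show ?case using main[of a] M.cdf_diff_eq[OF elim] N.cdf_diff_eq[OF elim] by simp
  qed
  ultimately have "\<bar>(cdf M b - 0) - (cdf N b - 0)\<bar> \<le> (\<integral>t. h t \<partial>lborel) / pi"
    by (rule tendsto_upperbound) simp
  then show ?thesis by simp
qed

section \<open>Gaussian smoothing of distribution functions\<close>

text \<open>The convolution of \<open>M\<close> with a centred normal law of standard deviation
  \<open>\<eta>\<close>. It damps high frequencies by a Gaussian factor and removes atoms.\<close>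

definition gauss_smooth :: "real measure \<Rightarrow> real \<Rightarrow> real measure" where
  "gauss_smooth M \<eta> = distr (M \<Otimes>\<^sub>M std_normal_distribution) borel (\<lambda>(x, z). x + \<eta> * z)"

lemma char_gauss_smooth:
  assumes "real_distribution M"
  shows "char (gauss_smooth M \<eta>) t = char M t * complex_of_real (exp (- ((\<eta> * t)\<^sup>2) / 2))"
proof -
  interpret M: real_distribution M by fact
  interpret Z: real_distribution std_normal_distribution by (rule real_dist_normal_dist)
  interpret P: pair_prob_space M std_normal_distribution by standard
  have [measurable_cong]: "sets M = sets borel" by simp
  have int: "integrable (M \<Otimes>\<^sub>M std_normal_distribution) (\<lambda>x. iexp (t * (fst x + \<eta> * snd x)))"
    by (intro P.integrable_const_bound[where B=1]) (auto simp: norm_exp_i_times)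
  have "char (gauss_smooth M \<eta>) t = (CLINT x|M \<Otimes>\<^sub>M std_normal_distribution. iexp (t * (fst x + \<eta> * snd x)))"
    unfolding char_def gauss_smooth_def by (subst integral_distr) (auto simp: split_beta')
  also have "\<dots> = (CLINT x|M. CLINT z|std_normal_distribution. iexp (t * (x + \<eta> * z)))"
    using P.integral_fst'[OF int] by simp
  also have "\<dots> = (CLINT x|M. iexp (t * x) * char std_normal_distribution (\<eta> * t))"
    unfolding char_def by (subst integral_mult_right_zero[symmetric]) (simp add: exp_add[symmetric] algebra_simps)
  also have "\<dots> = char M t * char std_normal_distribution (\<eta> * t)"
    by (simp add: char_def)
  finally show ?thesis by (simp add: char_std_normal_distribution)
qed

lemma real_distribution_gauss_smooth:
  assumes "real_distribution M"
  shows "real_distribution (gauss_smooth M \<eta>)"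
proof -
  interpret M: real_distribution M by fact
  interpret Z: real_distribution std_normal_distribution by (rule real_dist_normal_dist)
  interpret P: pair_prob_space M std_normal_distribution by standard
  have [measurable_cong]: "sets M = sets borel" by simp
  show ?thesis unfolding gauss_smooth_def by (intro P.real_distribution_distr) measurable
qed

lemma std_normal_no_atoms: "measure std_normal_distribution {x} = 0"
  by (simp add: measure_def emeasure_density nn_integral_0_iff_AE AE_lborel_singleton)

lemma gauss_smooth_no_atoms:
  assumes "real_distribution M" "\<eta> \<noteq> 0"
  shows "measure (gauss_smooth M \<eta>) {y} = 0"
proof -
  interpret M: real_distribution M by fact
  interpret Z: real_distribution std_normal_distribution by (rule real_dist_normal_dist)
  interpret P: pair_prob_space M std_normal_distribution by standard
  have [measurable_cong]: "sets M = sets borel" by simp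
  have "emeasure (gauss_smooth M \<eta>) {y} = emeasure (M \<Otimes>\<^sub>M std_normal_distribution)
      ((\<lambda>(x, z). x + \<eta> * z) -` {y} \<inter> space (M \<Otimes>\<^sub>M std_normal_distribution))"
    unfolding gauss_smooth_def by (subst emeasure_distr) auto
  also have "\<dots> = (\<integral>\<^sup>+x. emeasure std_normal_distribution (Pair x -` ((\<lambda>(x, z). x + \<eta> * z) -` {y} \<inter> space (M \<Otimes>\<^sub>M std_normal_distribution))) \<partial>M)"
    by (intro Z.emeasure_pair_measure_alt) measurable
  also have "\<dots> = (\<integral>\<^sup>+x. emeasure std_normal_distribution {(y - x) / \<eta>} \<partial>M)"
    using assms(2) by (intro nn_integral_cong arg_cong2[where f=emeasure]) (auto simp: space_pair_measure field_simps)
  also have "\<dots> = 0"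
    using std_normal_no_atoms by (simp add: Z.emeasure_eq_measure)
  finally show ?thesis by (simp add: measure_def)
qed

text \<open>Unless the standard normal variable exceeds \<open>w\<close> in modulus, smoothing moves
  the value by at most \<open>\<eta> * w\<close>.\<close>

lemma cdf_gauss_smooth_sandwich:
  fixes w x \<eta> :: real
  assumes "real_distribution M" "0 < \<eta>"
  defines "q \<equiv> measure std_normal_distribution {z. w < \<bar>z\<bar>}"
  shows "cdf M x \<le> cdf (gauss_smooth M \<eta>) (x + \<eta> * w) + q"
    and "cdf (gauss_smooth M \<eta>) x \<le> cdf M (x + \<eta> * w) + q"
proof -
  interpret M: real_distribution M by fact
  interpret Z: real_distribution std_normal_distribution by (rule real_dist_normal_dist)
  interpret P: pair_prob_space M std_normal_distribution by standard
  have [measurable_cong]: "sets M = sets borel" by simp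
  let ?P = "M \<Otimes>\<^sub>M std_normal_distribution"
  have G: "cdf (gauss_smooth M \<eta>) y = measure ?P {p \<in> space ?P. fst p + \<eta> * snd p \<le> y}" for y
    unfolding gauss_smooth_def cdf_def
    by (subst measure_distr) (auto intro!: arg_cong[where f="measure ?P"])
  have X: "cdf M y = measure ?P {p \<in> space ?P. fst p \<le> y}" for y
  proof -
    have "{p \<in> space ?P. fst p \<le> y} = {..y} \<times> space std_normal_distribution"
      by (auto simp: space_pair_measure)
    then show ?thesis
      by (simp add: cdf_def measure_def Z.emeasure_pair_measure_Times Z.emeasure_space_1)
        (metis Z.emeasure_space_1 Z.space_eq_univ mult.right_neutral)
  qed
  have Q: "q = measure ?P {p \<in> space ?P. w < \<bar>snd p\<bar>}"
  proof -
    have "{p \<in> space ?P. w < \<bar>snd p\<bar>} = space M \<times> {z. w < \<bar>z\<bar>}"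
      by (auto simp: space_pair_measure)
    then show ?thesis
      by (simp add: q_def measure_def Z.emeasure_pair_measure_Times)
        (metis M.emeasure_space_1 M.space_eq_univ mult.left_neutral)
  qed
  have z: "\<bar>\<eta> * z\<bar> \<le> \<eta> * w" if "\<not> w < \<bar>z\<bar>" for z
    using that assms(2) by (simp add: abs_mult mult_left_mono)
  have "cdf M x \<le> measure ?P ({p \<in> space ?P. fst p + \<eta> * snd p \<le> x + \<eta> * w} \<union> {p \<in> space ?P. w < \<bar>snd p\<bar>})"
    unfolding X
  proof (rule P.finite_measure_mono)
    show "{p \<in> space ?P. fst p \<le> x} \<subseteq> {p \<in> space ?P. fst p + \<eta> * snd p \<le> x + \<eta> * w} \<union> {p \<in> space ?P. w < \<bar>snd p\<bar>}"
      using z by (auto simp: abs_le_iff) (smt (verit))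
  qed measurable
  also have "\<dots> \<le> cdf (gauss_smooth M \<eta>) (x + \<eta> * w) + q"
    unfolding G Q by (intro measure_Un_le) measurable
  finally show "cdf M x \<le> cdf (gauss_smooth M \<eta>) (x + \<eta> * w) + q" .
  have "cdf (gauss_smooth M \<eta>) x \<le> measure ?P ({p \<in> space ?P. fst p \<le> x + \<eta> * w} \<union> {p \<in> space ?P. w < \<bar>snd p\<bar>})"
    unfolding G
  proof (rule P.finite_measure_mono)
    show "{p \<in> space ?P. fst p + \<eta> * snd p \<le> x} \<subseteq> {p \<in> space ?P. fst p \<le> x + \<eta> * w} \<union> {p \<in> space ?P. w < \<bar>snd p\<bar>}"
      using z by (auto simp: abs_le_iff) (smt (verit))
  qed measurable
  also have "\<dots> \<le> cdf M (x + \<eta> * w) + q"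
    unfolding X Q by (intro measure_Un_le) measurable
  finally show "cdf (gauss_smooth M \<eta>) x \<le> cdf M (x + \<eta> * w) + q" .
qed

text \<open>The shift \<open>\<eta> * w\<close> and the loss \<open>q\<close> each occur twice, once
  for smoothing \<open>M\<close> and once for removing the smoothing from \<open>N\<close>. The
  one-sided form is applied a second time with the two laws exchanged.\<close>

lemma cdf_compare:
  fixes w x \<eta> :: real
  assumes M: "real_distribution M" and N: "real_distribution N" and \<eta>: "0 < \<eta>" and h: "integrable lborel h"
    and le: "\<And>t. cmod (char M t - char N t) * exp (- ((\<eta> * t)\<^sup>2) / 2) \<le> \<bar>t\<bar> * h t"
  defines "q \<equiv> measure std_normal_distribution {z. w < \<bar>z\<bar>}"
  shows "cdf M x \<le> cdf N (x + 2 * \<eta> * w) + 2 * q + (\<integral>t. h t \<partial>lborel) / pi"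
proof -
  have d: "\<bar>cdf (gauss_smooth M \<eta>) b - cdf (gauss_smooth N \<eta>) b\<bar> \<le> (\<integral>t. h t \<partial>lborel) / pi" for b
  proof (rule cdf_diff_le_char[OF _ _ _ _ h])
    fix t
    have "cmod (char (gauss_smooth M \<eta>) t - char (gauss_smooth N \<eta>) t)
        = cmod ((char M t - char N t) * complex_of_real (exp (- ((\<eta> * t)\<^sup>2) / 2)))"
      by (simp add: char_gauss_smooth M N left_diff_distrib)
    also have "\<dots> = cmod (char M t - char N t) * exp (- ((\<eta> * t)\<^sup>2) / 2)"
      by (simp only: norm_mult norm_of_real abs_exp_cancel)
    finally show "cmod (char (gauss_smooth M \<eta>) t - char (gauss_smooth N \<eta>) t) \<le> \<bar>t\<bar> * h t"
      using le[of t] by simp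
  qed (use M N \<eta> in \<open>auto intro: real_distribution_gauss_smooth gauss_smooth_no_atoms\<close>)
  show ?thesis
    using cdf_gauss_smooth_sandwich(1)[OF M \<eta>, of x w] d[of "x + \<eta> * w"]
      cdf_gauss_smooth_sandwich(2)[OF N \<eta>, of "x + \<eta> * w" w]
    unfolding q_def by (simp add: algebra_simps)
qed

section \<open>Characteristic functions of normalised sums\<close>

abbreviation "\<Phi> \<equiv> cdf std_normal_distribution"

text \<open>Dividing by \<open>c\<close> reduces to the closed unit disc. The factor
  \<open>c ^ (n - 1)\<close> is kept because it supplies the Gaussian decay in
  \<open>char_power_close\<close>.\<close>

lemma norm_power_diff_le:
  fixes z w :: complex
  assumes "cmod z \<le> c" "cmod w \<le> c" "0 < c" "0 < n"
  shows "cmod (z ^ n - w ^ n) \<le> real n * c ^ (n - 1) * cmod (z - w)"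
proof -
  have "cmod ((z / of_real c) ^ n - (w / of_real c) ^ n) \<le> real n * cmod (z / of_real c - w / of_real c)"
    using assms by (intro norm_power_diff) (auto simp: norm_divide)
  then have "cmod (z ^ n - w ^ n) / c ^ n \<le> real n * (cmod (z - w) / c)"
    using assms by (simp add: power_divide norm_divide norm_power flip: diff_divide_distrib)
  then have "cmod (z ^ n - w ^ n) \<le> real n * (cmod (z - w) / c) * c ^ n"
    using assms by (simp add: pos_divide_le_eq)
  also have "c ^ n = c * c ^ (n - 1)" using assms by (cases n) auto
  finally show ?thesis using assms by (simp add: field_simps)
qed

lemma char_third_moment:
  assumes "real_distribution D" and i1: "integrable D (\<lambda>x. x)" "integral\<^sup>L D (\<lambda>x. x) = 0"
    and i2: "integrable D (\<lambda>x. x\<^sup>2)" "integral\<^sup>L D (\<lambda>x. x\<^sup>2) = 1"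
    and i3: "integrable D (\<lambda>x. \<bar>x\<bar> ^ 3)"
  shows "cmod (char D s - (1 - s\<^sup>2 / 2)) \<le> \<bar>s\<bar> ^ 3 * integral\<^sup>L D (\<lambda>x. \<bar>x\<bar> ^ 3) / 6"
proof -
  interpret D: real_distribution D by fact
  have "cmod (char D s - (1 - s\<^sup>2 * 1 / 2)) \<le> (s\<^sup>2 / 6) * D.expectation (\<lambda>x. min (6 * x\<^sup>2) (\<bar>s\<bar> * \<bar>x\<bar> ^ 3))"
    using i1 i2 by (intro D.char_approx3) auto
  also have "\<dots> \<le> (s\<^sup>2 / 6) * D.expectation (\<lambda>x. \<bar>s\<bar> * \<bar>x\<bar> ^ 3)"
    using i3 by (intro mult_left_mono integral_mono integrable_min integrable_mult_right i2) auto
  also have "\<dots> = \<bar>s\<bar> ^ 3 * integral\<^sup>L D (\<lambda>x. \<bar>x\<bar> ^ 3) / 6"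
    by (simp add: power2_eq_square power3_eq_cube abs_if)
  finally show ?thesis by simp
qed

text \<open>With the bound 3/2 the cubic remainder is at most a quarter of the square of
  \<open>s\<close>, half of the quadratic term, so the modulus is at most
  \<open>1 - s\<^sup>2 / 4\<close>.\<close>

lemma char_small_le_exp:
  assumes "real_distribution D" and i1: "integrable D (\<lambda>x. x)" "integral\<^sup>L D (\<lambda>x. x) = 0"
    and i2: "integrable D (\<lambda>x. x\<^sup>2)" "integral\<^sup>L D (\<lambda>x. x\<^sup>2) = 1"
    and i3: "integrable D (\<lambda>x. \<bar>x\<bar> ^ 3)"
    and s: "\<bar>s\<bar> \<le> 1" "\<bar>s\<bar> * integral\<^sup>L D (\<lambda>x. \<bar>x\<bar> ^ 3) \<le> 3 / 2"
  shows "cmod (char D s) \<le> exp (- (s\<^sup>2 / 4))"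
proof -
  have s2: "s\<^sup>2 \<le> 1" using s by (simp add: abs_square_le_1)
  have "cmod (char D s) \<le> cmod (char D s - (1 - s\<^sup>2 / 2)) + cmod (1 - complex_of_real (s\<^sup>2) / 2)"
    using norm_triangle_ineq[of "char D s - (1 - s\<^sup>2 / 2)" "1 - complex_of_real (s\<^sup>2) / 2"] by simp
  also have "cmod (1 - complex_of_real (s\<^sup>2) / 2) = 1 - s\<^sup>2 / 2"
  proof -
    have "1 - complex_of_real (s\<^sup>2) / 2 = complex_of_real (1 - s\<^sup>2 / 2)" by simp
    then show ?thesis using s2 by (simp only: norm_of_real)
  qed
  also have "cmod (char D s - (1 - s\<^sup>2 / 2)) \<le> \<bar>s\<bar> ^ 3 * integral\<^sup>L D (\<lambda>x. \<bar>x\<bar> ^ 3) / 6"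
    using assms(1) i1 i2 i3 by (rule char_third_moment)
  also have "\<dots> = s\<^sup>2 * (\<bar>s\<bar> * integral\<^sup>L D (\<lambda>x. \<bar>x\<bar> ^ 3)) / 6"
    by (simp add: power2_eq_square power3_eq_cube abs_if)
  also have "\<dots> \<le> s\<^sup>2 * (3 / 2) / 6"
    using s by (intro divide_right_mono mult_left_mono) auto
  finally have "cmod (char D s) \<le> 1 + - (s\<^sup>2 / 4)" by simp
  also have "\<dots> \<le> exp (- (s\<^sup>2 / 4))" by (rule exp_ge_add_one_self)
  finally show ?thesis .
qed

lemma std_normal_moments:
  "integrable std_normal_distribution (\<lambda>x. x)" "integral\<^sup>L std_normal_distribution (\<lambda>x. x) = 0"
  "integrable std_normal_distribution (\<lambda>x. x\<^sup>2)" "integral\<^sup>L std_normal_distribution (\<lambda>x. x\<^sup>2) = 1"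
  "integrable std_normal_distribution (\<lambda>x. \<bar>x\<bar> ^ 3)"
proof -
  show "integrable std_normal_distribution (\<lambda>x. x)"
    using integrable_std_normal_distribution_moment[of 1] by simp
  show "integral\<^sup>L std_normal_distribution (\<lambda>x. x) = 0"
    using integral_std_normal_distribution_moment_odd[of 1] by simp
  show "integrable std_normal_distribution (\<lambda>x. x\<^sup>2)"
    by (rule integrable_std_normal_distribution_moment)
  show "integral\<^sup>L std_normal_distribution (\<lambda>x. x\<^sup>2) = 1"
    using std_normal_distribution_even_moments[of 1] by (simp add: numeral_2_eq_2)
  have "integrable std_normal_distribution (\<lambda>x. \<bar>x ^ 3\<bar>)"
    by (intro integrable_abs integrable_std_normal_distribution_moment)
  then show "integrable std_normal_distribution (\<lambda>x. \<bar>x\<bar> ^ 3)" by (simp add: power_abs)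
qed

text \<open>Both laws have the same first two moments, so at \<open>s = t / sqrt n\<close> their
  characteristic functions differ by a multiple of |s| cubed. Comparing \<open>n\<close>-th powers
  costs a factor \<open>n\<close> and leaves the order 1 / sqrt n.\<close>

lemma char_power_close:
  assumes D: "real_distribution D" and i1: "integrable D (\<lambda>x. x)" "integral\<^sup>L D (\<lambda>x. x) = 0"
    and i2: "integrable D (\<lambda>x. x\<^sup>2)" "integral\<^sup>L D (\<lambda>x. x\<^sup>2) = 1"
    and i3: "integrable D (\<lambda>x. \<bar>x\<bar> ^ 3)"
  shows "\<exists>K\<ge>0. \<exists>\<delta>>0. \<forall>n\<ge>2. \<forall>t. \<bar>t\<bar> \<le> \<delta> * sqrt (real n) \<longrightarrow>
    cmod (char D (t / sqrt (real n)) ^ n - char std_normal_distribution t)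
      \<le> K / sqrt (real n) * \<bar>t\<bar> ^ 3 * exp (- (t\<^sup>2 / 8))"
proof -
  define \<beta> where "\<beta> = integral\<^sup>L D (\<lambda>x. \<bar>x\<bar> ^ 3)"
  define \<beta>' where "\<beta>' = integral\<^sup>L std_normal_distribution (\<lambda>x. \<bar>x\<bar> ^ 3)"
  have b0: "0 \<le> \<beta>" "0 \<le> \<beta>'" unfolding \<beta>_def \<beta>'_def by (auto intro!: Bochner_Integration.integral_nonneg)
  define K where "K = (\<beta> + \<beta>') / 6"
  \<comment> \<open>Small enough that \<open>\<bar>s\<bar> \<le> \<delta>\<close> meets both
    conditions of \<open>char_small_le_exp\<close>, for \<open>D\<close> and for the normal
    law.\<close>
  define \<delta> where "\<delta> = 1 / (1 + \<beta> + \<beta>')"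
  have \<delta>: "0 < \<delta>" "\<delta> \<le> 1" using b0 by (auto simp: \<delta>_def)
  have \<delta>b: "\<delta> * \<beta> \<le> 3 / 2" "\<delta> * \<beta>' \<le> 3 / 2"
  proof -
    have "\<delta> * \<beta> \<le> 1" "\<delta> * \<beta>' \<le> 1" using b0 by (auto simp: \<delta>_def)
    then show "\<delta> * \<beta> \<le> 3 / 2" "\<delta> * \<beta>' \<le> 3 / 2" by auto
  qed
  have K0: "0 \<le> K" using b0 by (simp add: K_def)
  have "cmod (char D (t / sqrt (real n)) ^ n - char std_normal_distribution t)
      \<le> K / sqrt (real n) * \<bar>t\<bar> ^ 3 * exp (- (t\<^sup>2 / 8))"
    if n: "2 \<le> n" and t: "\<bar>t\<bar> \<le> \<delta> * sqrt (real n)" for n :: nat and t :: real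
  proof -
    define s where "s = t / sqrt (real n)"
    have sn: "0 < sqrt (real n)" using n by simp
    have s\<delta>: "\<bar>s\<bar> \<le> \<delta>" using t sn by (simp add: s_def pos_divide_le_eq)
    have s1: "\<bar>s\<bar> \<le> 1" using s\<delta> \<delta> by simp
    have s2n: "s\<^sup>2 * real n = t\<^sup>2" using n by (simp add: s_def power_divide)
    let ?c = "exp (- (s\<^sup>2 / 4))"
    have z: "cmod (char D s) \<le> ?c"
    proof (rule char_small_le_exp[OF D i1 i2 i3 s1])
      show "\<bar>s\<bar> * integral\<^sup>L D (\<lambda>x. \<bar>x\<bar> ^ 3) \<le> 3 / 2"
        using mult_right_mono[OF s\<delta> b0(1)] \<delta>b by (simp add: \<beta>_def)
    qed
    have w: "cmod (char std_normal_distribution s) \<le> ?c"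
    proof (rule char_small_le_exp[OF real_dist_normal_dist std_normal_moments s1])
      show "\<bar>s\<bar> * integral\<^sup>L std_normal_distribution (\<lambda>x. \<bar>x\<bar> ^ 3) \<le> 3 / 2"
        using mult_right_mono[OF s\<delta> b0(2)] \<delta>b by (simp add: \<beta>'_def)
    qed
    have zw: "cmod (char D s - char std_normal_distribution s) \<le> K * \<bar>s\<bar> ^ 3"
    proof -
      have "cmod (char D s - char std_normal_distribution s)
          \<le> cmod (char D s - (1 - s\<^sup>2 / 2)) + cmod (char std_normal_distribution s - (1 - s\<^sup>2 / 2))"
        using norm_triangle_ineq4[of "char D s - (1 - s\<^sup>2 / 2)" "char std_normal_distribution s - (1 - s\<^sup>2 / 2)"] by simp
      also have "\<dots> \<le> \<bar>s\<bar> ^ 3 * \<beta> / 6 + \<bar>s\<bar> ^ 3 * \<beta>' / 6"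
        unfolding \<beta>_def \<beta>'_def
        by (intro add_mono char_third_moment D i1 i2 i3 real_dist_normal_dist std_normal_moments)
      also have "\<dots> = K * \<bar>s\<bar> ^ 3" by (simp add: K_def algebra_simps add_divide_distrib)
      finally show ?thesis .
    qed
    have "char std_normal_distribution t = char std_normal_distribution s ^ n"
    proof -
      have "real n * (- s\<^sup>2 / 2) = - t\<^sup>2 / 2" using s2n by (simp add: mult.commute)
      then show ?thesis
        by (simp only: char_std_normal_distribution of_real_power[symmetric] exp_of_nat_mult[symmetric])
    qed
    then have "cmod (char D s ^ n - char std_normal_distribution t)
        \<le> real n * ?c ^ (n - 1) * cmod (char D s - char std_normal_distribution s)"
      using norm_power_diff_le[OF z w, of n] n by simp
    also have "\<dots> \<le> real n * exp (- (t\<^sup>2 / 8)) * (K * \<bar>s\<bar> ^ 3)"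
    proof (intro mult_mono zw)
      have "?c ^ (n - 1) = exp (real (n - 1) * (- (s\<^sup>2 / 4)))" by (simp only: exp_of_nat_mult)
      also have "\<dots> \<le> exp (- (t\<^sup>2 / 8))"
      proof -
        \<comment> \<open>From \<open>n \<ge> 2\<close>; the lost factor 2 turns the exponent 1/4
          into 1/8.\<close>
        have "real n / 2 \<le> real (n - 1)" using n by (simp add: of_nat_diff)
        then have "real n / 2 * (s\<^sup>2 / 4) \<le> real (n - 1) * (s\<^sup>2 / 4)" by (intro mult_right_mono) auto
        then show ?thesis by (simp add: s2n[symmetric] mult.commute)
      qed
      finally show "?c ^ (n - 1) \<le> exp (- (t\<^sup>2 / 8))" .
    qed auto
    also have "\<dots> = K / sqrt (real n) * \<bar>t\<bar> ^ 3 * exp (- (t\<^sup>2 / 8))"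
    proof -
      have "real n * \<bar>s\<bar> ^ 3 = \<bar>t\<bar> ^ 3 / sqrt (real n)"
        using sn by (simp add: s_def power_divide power3_eq_cube field_simps)
      then have "K * exp (- (t\<^sup>2 / 8)) * (real n * \<bar>s\<bar> ^ 3) = K * exp (- (t\<^sup>2 / 8)) * (\<bar>t\<bar> ^ 3 / sqrt (real n))"
        by (simp only:)
      then show ?thesis by (simp add: mult_ac)
    qed
    finally show "cmod (char D (t / sqrt (real n)) ^ n - char std_normal_distribution t)
      \<le> K / sqrt (real n) * \<bar>t\<bar> ^ 3 * exp (- (t\<^sup>2 / 8))" by (simp add: s_def)
  qed
  with K0 \<delta>(1) show ?thesis by blast
qed

text \<open>Half of the Gaussian exponent is spent on the bound at \<open>w\<close>; the other half
  is, up to the factor sqrt 2, a normal density of variance 2.\<close>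

lemma std_normal_tail:
  assumes "0 \<le> w"
  shows "measure std_normal_distribution {z. w < \<bar>z\<bar>} \<le> sqrt 2 * exp (- (w\<^sup>2 / 4))"
proof -
  interpret Z: real_distribution std_normal_distribution by (rule real_dist_normal_dist)
  interpret G: prob_space "density lborel (\<lambda>z. ennreal (normal_density 0 (sqrt 2) z))"
    by (rule prob_space_normal_density) simp
  have "emeasure std_normal_distribution {z. w < \<bar>z\<bar>}
      = (\<integral>\<^sup>+z. ennreal (std_normal_density z) * indicator {z. w < \<bar>z\<bar>} z \<partial>lborel)"
    by (simp add: emeasure_density)
  also have "\<dots> \<le> (\<integral>\<^sup>+z. ennreal (sqrt 2 * exp (- (w\<^sup>2 / 4))) * ennreal (normal_density 0 (sqrt 2) z) \<partial>lborel)"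
  proof (rule nn_integral_mono)
    fix z :: real
    have eq: "sqrt 2 * exp (- (w\<^sup>2 / 4)) * normal_density 0 (sqrt 2) z = std_normal_density z * exp ((z\<^sup>2 - w\<^sup>2) / 4)"
    proof -
      have "sqrt (2 * pi * (sqrt 2)\<^sup>2) = sqrt 2 * sqrt (2 * pi)" by (simp add: real_sqrt_mult)
      moreover have "exp (- (w\<^sup>2 / 4)) * exp (- z\<^sup>2 / 4) = exp (- z\<^sup>2 / 2) * exp ((z\<^sup>2 - w\<^sup>2) / 4)"
        unfolding exp_add[symmetric] by (simp add: field_simps)
      ultimately show ?thesis by (simp add: normal_density_def)
    qed
    show "ennreal (std_normal_density z) * indicator {z. w < \<bar>z\<bar>} z
        \<le> ennreal (sqrt 2 * exp (- (w\<^sup>2 / 4))) * ennreal (normal_density 0 (sqrt 2) z)"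
    proof (cases "w < \<bar>z\<bar>")
      case True
      then have "w\<^sup>2 \<le> z\<^sup>2" using assms by (intro abs_le_square_iff[THEN iffD1]) auto
      then have "std_normal_density z * 1 \<le> std_normal_density z * exp ((z\<^sup>2 - w\<^sup>2) / 4)"
        by (intro mult_left_mono) auto
      then show ?thesis using True by (simp add: ennreal_mult[symmetric] eq ennreal_leI)
    qed simp
  qed
  also have "\<dots> = ennreal (sqrt 2 * exp (- (w\<^sup>2 / 4)))"
    using G.emeasure_space_1 by (simp add: nn_integral_cmult emeasure_density)
  finally show ?thesis by (simp add: Z.emeasure_eq_measure)
qed

lemma Phi_diff_le:
  assumes "x \<le> y"
  shows "\<Phi> y - \<Phi> x \<le> y - x"
proof (cases "x = y")
  case False
  with assms have xy: "x < y" by simp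
  interpret Z: real_distribution std_normal_distribution by (rule real_dist_normal_dist)
  have "emeasure std_normal_distribution {x<..y} = (\<integral>\<^sup>+z. ennreal (std_normal_density z) * indicator {x<..y} z \<partial>lborel)"
    by (simp add: emeasure_density)
  also have "\<dots> \<le> (\<integral>\<^sup>+z. 1 * indicator {x<..y} z \<partial>lborel)"
  proof (intro nn_integral_mono mult_right_mono)
    fix z :: real
    have "exp (- z\<^sup>2 / 2) \<le> 1" by simp
    moreover have "1 \<le> sqrt (2 * pi)" using pi_ge_two by simp
    ultimately have "1 / sqrt (2 * pi) * exp (- z\<^sup>2 / 2) \<le> 1 * 1"
      by (intro mult_mono) auto
    then have "std_normal_density z \<le> 1"
      by (simp add: std_normal_density_def)
    then show "ennreal (std_normal_density z) \<le> 1" by (simp flip: ennreal_1 add: ennreal_leI)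
  qed simp
  also have "\<dots> = ennreal (y - x)" using xy by simp
  finally show ?thesis using xy by (simp add: Z.cdf_diff_eq[OF xy] Z.emeasure_eq_measure)
qed simp

lemma Phi_diff_ge:
  assumes "x < y" and c: "\<And>z. x < z \<Longrightarrow> z \<le> y \<Longrightarrow> c \<le> std_normal_density z" and "0 \<le> c"
  shows "c * (y - x) \<le> \<Phi> y - \<Phi> x"
proof -
  interpret Z: real_distribution std_normal_distribution by (rule real_dist_normal_dist)
  have "ennreal (c * (y - x)) = (\<integral>\<^sup>+z. ennreal c * indicator {x<..y} z \<partial>lborel)"
    using assms by (simp add: nn_integral_cmult ennreal_mult)
  also have "\<dots> \<le> (\<integral>\<^sup>+z. ennreal (std_normal_density z) * indicator {x<..y} z \<partial>lborel)"
    using c by (intro nn_integral_mono) (auto split: split_indicator intro!: ennreal_leI)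
  also have "\<dots> = emeasure std_normal_distribution {x<..y}"
    by (simp add: emeasure_density)
  finally show ?thesis by (simp add: Z.cdf_diff_eq[OF assms(1)] Z.emeasure_eq_measure)
qed

lemma integrable_gaussian:
  shows "integrable lborel (\<lambda>t::real. t\<^sup>2 * exp (- (t\<^sup>2 / 8)))"
    and "integrable lborel (\<lambda>t::real. exp (- (t\<^sup>2 / 4)))"
proof -
  have "integrable lborel (\<lambda>t::real. sqrt (2 * pi * 2\<^sup>2) * (normal_density 0 2 t * (t - 0) ^ 2))"
    by (intro integrable_mult_right integrable_normal_moment) simp
  also have "(\<lambda>t::real. sqrt (2 * pi * 2\<^sup>2) * (normal_density 0 2 t * (t - 0) ^ 2)) = (\<lambda>t. t\<^sup>2 * exp (- (t\<^sup>2 / 8)))"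
    by (auto simp: normal_density_def fun_eq_iff)
  finally show "integrable lborel (\<lambda>t::real. t\<^sup>2 * exp (- (t\<^sup>2 / 8)))" .
  have "integrable lborel (\<lambda>t::real. sqrt (2 * pi * (sqrt 2)\<^sup>2) * (normal_density 0 (sqrt 2) t * (t - 0) ^ 0))"
    by (intro integrable_mult_right integrable_normal_moment) simp
  also have "(\<lambda>t::real. sqrt (2 * pi * (sqrt 2)\<^sup>2) * (normal_density 0 (sqrt 2) t * (t - 0) ^ 0)) = (\<lambda>t. exp (- (t\<^sup>2 / 4)))"
    by (auto simp: normal_density_def fun_eq_iff)
  finally show "integrable lborel (\<lambda>t::real. exp (- (t\<^sup>2 / 4)))" .
qed

text \<open>A Berry--Esseen bound with an additional logarithmic factor: smoothing by a Gaussian of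
  standard deviation of order \<open>sqrt (ln n / n)\<close> makes the contribution of the frequencies
  beyond order \<open>sqrt n\<close> negligible, and costs only a shift of order \<open>ln n / sqrt n\<close>.\<close>

theorem berry_esseen_log:
  assumes D: "real_distribution D" and i1: "integrable D (\<lambda>x. x)" "integral\<^sup>L D (\<lambda>x. x) = 0"
    and i2: "integrable D (\<lambda>x. x\<^sup>2)" "integral\<^sup>L D (\<lambda>x. x\<^sup>2) = 1"
    and i3: "integrable D (\<lambda>x. \<bar>x\<bar> ^ 3)"
  shows "\<exists>C\<ge>0. \<forall>n\<ge>3. \<forall>M. real_distribution M \<longrightarrow> (\<forall>t. char M t = char D (t / sqrt (real n)) ^ n) \<longrightarrow>
    (\<forall>x. \<bar>cdf M x - \<Phi> x\<bar> \<le> C * ln (real n) / sqrt (real n))"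
proof -
  obtain K \<delta> where K: "0 \<le> K" and \<delta>: "0 < \<delta>" and close: "\<And>n t. 2 \<le> n \<Longrightarrow> \<bar>t\<bar> \<le> \<delta> * sqrt (real n) \<Longrightarrow>
    cmod (char D (t / sqrt (real n)) ^ n - char std_normal_distribution t)
      \<le> K / sqrt (real n) * \<bar>t\<bar> ^ 3 * exp (- (t\<^sup>2 / 8))"
    using char_power_close[OF assms] by blast
  define I1 :: real where "I1 = (\<integral>t. t\<^sup>2 * exp (- (t\<^sup>2 / 8)) \<partial>(lborel :: real measure))"
  define I0 :: real where "I0 = (\<integral>t. exp (- (t\<^sup>2 / 4)) \<partial>(lborel :: real measure))"
  have I: "0 \<le> I1" "0 \<le> I0" unfolding I1_def I0_def by (auto intro!: Bochner_Integration.integral_nonneg)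
  \<comment> \<open>The constant of the shift: \<open>2 * \<eta> * w\<close> equals
    \<open>A * L / r\<close> for the values of \<open>\<eta>\<close> and \<open>w\<close> fixed
    below.\<close>
  define A where "A = 4 * sqrt 2 / \<delta>"
  define C where "C = A + 2 * sqrt 2 + (K * I1 + I0) / pi"
  have A0: "0 \<le> A" using \<delta> by (simp add: A_def)
  have B0: "0 \<le> 2 * sqrt 2 + (K * I1 + I0) / pi" using K I by (intro add_nonneg_nonneg divide_nonneg_pos) auto
  show ?thesis
  proof (intro exI[of _ C] conjI allI impI)
    show "0 \<le> C" using A0 B0 by (simp add: C_def)
    fix n :: nat and M :: "real measure" and x
    assume n: "3 \<le> n" and M: "real_distribution M" and cM: "\<forall>t. char M t = char D (t / sqrt (real n)) ^ n"
    interpret D: real_distribution D by fact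
    interpret Z: real_distribution std_normal_distribution by (rule real_dist_normal_dist)
    define L where "L = ln (real n)"
    define r where "r = sqrt (real n)"
    have r0: "0 < r" and rr: "r * r = real n" using n by (auto simp: r_def)
    have r1: "1 \<le> r" using n by (simp add: r_def)
    have L1: "1 \<le> L"
    proof -
      have "exp 1 \<le> real n" using exp_le n by linarith
      then show ?thesis using n by (simp add: L_def ln_ge_iff)
    qed
    \<comment> \<open>The smallest order of smoothing for which half of the damping exponent is at
      least ln n beyond frequency \<open>\<delta> * r\<close>. This half contributes 1 / n, and the
      other half keeps the integrand integrable.\<close>
    define \<eta> where "\<eta> = 2 / \<delta> * sqrt L / r"
    have \<eta>0: "0 < \<eta>" using \<delta> L1 r0 by (simp add: \<eta>_def)
    have \<eta>2: "\<eta>\<^sup>2 * (\<delta>\<^sup>2 * real n) = 4 * L"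
      using \<delta> L1 r0 rr n by (simp add: \<eta>_def power_divide power_mult_distrib power2_eq_square[of r])
    \<comment> \<open>Makes \<open>exp (- (w\<^sup>2 / 4))\<close> equal to 1 / sqrt n.\<close>
    define w where "w = sqrt (2 * L)"
    have w0: "0 \<le> w" using L1 by (simp add: w_def)
    have shift: "2 * \<eta> * w = A * L / r"
      using L1 by (simp add: \<eta>_def w_def A_def real_sqrt_mult)
    define q where "q = measure std_normal_distribution {z. w < \<bar>z\<bar>}"
    have q: "q \<le> sqrt 2 / r"
    proof -
      have "q \<le> sqrt 2 * exp (- (w\<^sup>2 / 4))" unfolding q_def by (rule std_normal_tail[OF w0])
      also have "w\<^sup>2 / 4 = ln r" using L1 n by (simp add: w_def r_def L_def ln_sqrt)
      also have "sqrt 2 * exp (- ln r) = sqrt 2 / r" using r0 by (simp add: exp_minus divide_inverse)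
      finally show ?thesis .
    qed
    \<comment> \<open>The first summand controls the frequencies up to \<open>\<delta> * r\<close>,
      the second those beyond, where division by \<open>\<delta> * r\<close> pays for the factor |t|
      in \<open>cdf_compare\<close>.\<close>
    define h where "h t = K / r * (t\<^sup>2 * exp (- (t\<^sup>2 / 8))) + 2 / (\<delta> * r * real n) * exp (- ((\<eta> * t)\<^sup>2 / 4))" for t :: real
    have ig: "integrable lborel (\<lambda>t::real. exp (- ((\<eta> * t)\<^sup>2 / 4)))"
      using lborel_integrable_real_affine[OF integrable_gaussian(2), of \<eta> 0] \<eta>0 by simp
    have igv: "(\<integral>t. exp (- ((\<eta> * t)\<^sup>2 / 4)) \<partial>lborel) = I0 / \<eta>"
      using lborel_integral_real_affine[of \<eta> "\<lambda>t. exp (- (t\<^sup>2 / 4))" 0] \<eta>0 by (simp add: I0_def)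
    have h: "integrable lborel h"
      unfolding h_def by (intro Bochner_Integration.integrable_add integrable_mult_right integrable_gaussian ig)
    have "(\<integral>t. h t \<partial>lborel) = K / r * I1 + 2 / (\<delta> * r * real n) * (I0 / \<eta>)"
      unfolding h_def I1_def igv[symmetric]
      by (subst Bochner_Integration.integral_add) (auto intro!: integrable_mult_right integrable_gaussian ig)
    also have "2 / (\<delta> * r * real n) * (I0 / \<eta>) = I0 / (real n * sqrt L)"
      using \<delta> r0 n L1 by (simp add: \<eta>_def)
    also have "\<dots> \<le> I0 / (r * 1)"
    proof (rule divide_left_mono)
      have "r * 1 \<le> real n * sqrt L" unfolding rr[symmetric] using r1 L1 by (intro mult_mono) auto
      then show "r * 1 \<le> real n * sqrt L" .
      show "0 < real n * sqrt L * (r * 1)" using n L1 r0 by simp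
    qed (rule I)
    finally have hint: "(\<integral>t. h t \<partial>lborel) \<le> (K * I1 + I0) / r" by (simp add: add_divide_distrib)
    have le: "cmod (char M t - char std_normal_distribution t) * exp (- ((\<eta> * t)\<^sup>2) / 2) \<le> \<bar>t\<bar> * h t" for t
    proof (cases "\<bar>t\<bar> \<le> \<delta> * r")
      case True
      have "cmod (char M t - char std_normal_distribution t) * exp (- ((\<eta> * t)\<^sup>2) / 2)
          \<le> cmod (char M t - char std_normal_distribution t) * 1"
        by (intro mult_left_mono) auto
      also have "\<dots> \<le> K / r * \<bar>t\<bar> ^ 3 * exp (- (t\<^sup>2 / 8))"
        using close[of n t] n True cM by (simp add: r_def)
      also have "\<dots> = \<bar>t\<bar> * (K / r * (t\<^sup>2 * exp (- (t\<^sup>2 / 8))))"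
        by (simp add: power2_eq_square power3_eq_cube abs_if)
      also have "\<dots> \<le> \<bar>t\<bar> * h t"
        unfolding h_def using \<delta> r0 by (intro mult_left_mono) auto
      finally show ?thesis .
    next
      case False
      have c1: "cmod (char M t) \<le> 1"
      proof -
        interpret M: real_distribution M by fact
        show ?thesis by (rule M.cmod_char_le_1)
      qed
      have "cmod (char M t - char std_normal_distribution t) \<le> 1 + 1"
        by (rule order_trans[OF norm_triangle_ineq4]) (intro add_mono c1 Z.cmod_char_le_1)
      then have "cmod (char M t - char std_normal_distribution t) * exp (- ((\<eta> * t)\<^sup>2) / 2) \<le> 2 * exp (- ((\<eta> * t)\<^sup>2) / 2)"
        by (intro mult_right_mono) auto
      also have "2 * exp (- ((\<eta> * t)\<^sup>2) / 2) = 2 * (exp (- ((\<eta> * t)\<^sup>2 / 4)) * exp (- ((\<eta> * t)\<^sup>2 / 4)))"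
        unfolding exp_add[symmetric] by simp
      also have "2 * (exp (- ((\<eta> * t)\<^sup>2 / 4)) * exp (- ((\<eta> * t)\<^sup>2 / 4))) \<le> 2 * (exp (- ((\<eta> * t)\<^sup>2 / 4)) * (1 / real n))"
      proof (intro mult_left_mono)
        have "(\<delta> * r)\<^sup>2 \<le> t\<^sup>2" using False \<delta> r0 by (intro abs_le_square_iff[THEN iffD1]) auto
        then have "\<eta>\<^sup>2 * (\<delta> * r)\<^sup>2 \<le> \<eta>\<^sup>2 * t\<^sup>2" by (intro mult_left_mono) auto
        then have "L \<le> (\<eta> * t)\<^sup>2 / 4"
          using \<eta>2 rr by (simp add: power_mult_distrib power2_eq_square[of r])
        then have "exp (- ((\<eta> * t)\<^sup>2 / 4)) \<le> exp (- L)" by simp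
        also have "\<dots> = 1 / real n" using n by (simp add: L_def exp_minus divide_inverse)
        finally show "exp (- ((\<eta> * t)\<^sup>2 / 4)) \<le> 1 / real n" .
      qed auto
      also have "\<dots> = (\<delta> * r) * (2 / (\<delta> * r * real n) * exp (- ((\<eta> * t)\<^sup>2 / 4)))"
        using \<delta> r0 by simp
      also have "\<dots> \<le> \<bar>t\<bar> * (2 / (\<delta> * r * real n) * exp (- ((\<eta> * t)\<^sup>2 / 4)))"
        using False \<delta> r0 by (intro mult_right_mono) auto
      also have "\<dots> \<le> \<bar>t\<bar> * h t"
        unfolding h_def using K r0 by (intro mult_left_mono) auto
      finally show ?thesis .
    qed
    let ?B = "2 * q + (\<integral>t. h t \<partial>lborel) / pi"
    have B: "?B \<le> (2 * sqrt 2 + (K * I1 + I0) / pi) / r"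
    proof -
      have "(\<integral>t. h t \<partial>lborel) / pi \<le> (K * I1 + I0) / r / pi" by (intro divide_right_mono hint) auto
      moreover have "(2 * sqrt 2 + (K * I1 + I0) / pi) / r = 2 * (sqrt 2 / r) + (K * I1 + I0) / r / pi"
        by (simp add: add_divide_distrib mult.commute)
      ultimately show ?thesis using q by linarith
    qed
    have Bl: "(2 * sqrt 2 + (K * I1 + I0) / pi) / r \<le> (2 * sqrt 2 + (K * I1 + I0) / pi) * L / r"
      using mult_left_mono[OF L1 B0] r0 by (intro divide_right_mono) auto
    have pos: "0 \<le> 2 * \<eta> * w" using \<eta>0 w0 by simp
    have CL: "C * L / r = 2 * \<eta> * w + (2 * sqrt 2 + (K * I1 + I0) / pi) * L / r"
      unfolding shift C_def by (simp add: distrib_right add_divide_distrib)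
    have "cdf M x \<le> \<Phi> (x + 2 * \<eta> * w) + ?B"
      using cdf_compare[OF M real_dist_normal_dist \<eta>0 h le, of x w] unfolding q_def by simp
    moreover have "\<Phi> (x + 2 * \<eta> * w) - \<Phi> x \<le> 2 * \<eta> * w"
      using Phi_diff_le[of x "x + 2 * \<eta> * w"] pos by simp
    moreover have "\<Phi> (x - 2 * \<eta> * w) \<le> cdf M x + ?B"
    proof -
      have "\<Phi> (x - 2 * \<eta> * w) \<le> cdf M ((x - 2 * \<eta> * w) + 2 * \<eta> * w) + 2 * q + (\<integral>t. h t \<partial>lborel) / pi"
        unfolding q_def
        by (rule cdf_compare[OF real_dist_normal_dist M \<eta>0 h]) (use le in \<open>simp add: norm_minus_commute\<close>)
      then show ?thesis by simp
    qed
    moreover have "\<Phi> x - \<Phi> (x - 2 * \<eta> * w) \<le> 2 * \<eta> * w"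
      using Phi_diff_le[of "x - 2 * \<eta> * w" x] pos by simp
    ultimately have "\<bar>cdf M x - \<Phi> x\<bar> \<le> 2 * \<eta> * w + ?B" unfolding abs_le_iff by linarith
    also have "\<dots> \<le> C * L / r" unfolding CL using B Bl by linarith
    finally show "\<bar>cdf M x - \<Phi> x\<bar> \<le> C * ln (real n) / sqrt (real n)" by (simp add: L_def r_def)
  qed
qed

section \<open>Moments and the law of the information density\<close>

abbreviation fading_law :: "(real \<Rightarrow> real) \<Rightarrow> real measure" where
  "fading_law f \<equiv> density lborel (\<lambda>h. ennreal (f h))"

abbreviation noise_law :: "real \<Rightarrow> real measure" where
  "noise_law \<sigma> \<equiv> density lborel (\<lambda>z. ennreal (normal_density 0 \<sigma> z))"

lemma nn_integral_powr_from_0: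
  assumes "a > -1" "0 < c"
  shows "(\<integral>\<^sup>+x. ennreal (x powr a) * indicator {0..c} x \<partial>lborel) < \<infinity>"
proof -
  have "((\<lambda>x. x powr a) has_integral (c powr (a + 1) / (a + 1))) {0..c}"
    using assms by (intro has_integral_powr_from_0) auto
  then have "((\<lambda>x. if x \<in> {0..c} then x powr a else 0) has_integral (c powr (a + 1) / (a + 1))) UNIV"
    by (simp only: has_integral_restrict_UNIV)
  then have "(\<integral>\<^sup>+x. ennreal (if x \<in> {0..c} then x powr a else 0) \<partial>lborel) = ennreal (c powr (a + 1) / (a + 1))"
    by (intro nn_integral_has_integral_lborel) auto
  moreover have "(\<integral>\<^sup>+x. ennreal (x powr a) * indicator {0..c} x \<partial>lborel)
      = (\<integral>\<^sup>+x. ennreal (if x \<in> {0..c} then x powr a else 0) \<partial>lborel)"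
    by (intro nn_integral_cong) auto
  ultimately show ?thesis by simp
qed

text \<open>The square of \<open>h\<close> matches the second moment of the fading; the exponent
  \<open>b\<close> is free, so that the singularity at 0 can be made as weak as the density there
  demands. Both come from ln y \<le> y, at a square root and at a negative power of
  \<open>h\<close>.\<close>

lemma ln_power4_le:
  fixes h :: real
  assumes "0 < h" "0 < b"
  shows "(ln h) ^ 4 \<le> 16 * h\<^sup>2 + (1 / b) ^ 4 * h powr (- (4 * b))"
proof (cases "1 \<le> h")
  case True
  have "ln h = 2 * ln (sqrt h)" using assms by (simp add: ln_sqrt)
  also have "\<dots> \<le> 2 * sqrt h" using assms ln_bound[of "sqrt h"] by simp
  finally have "(ln h) ^ 4 \<le> (2 * sqrt h) ^ 4" using True by (intro power_mono) auto
  also have "\<dots> = 16 * h\<^sup>2" using assms by (simp add: power_mult_distrib numeral_eq_Suc)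
  finally show ?thesis by (simp add: add_increasing2)
next
  case False
  have "- ln h * b = ln (h powr (- b))" using assms by (simp add: ln_powr)
  also have "\<dots> \<le> h powr (- b)" using assms ln_bound[of "h powr (- b)"] by simp
  finally have "- ln h \<le> 1 / b * h powr (- b)" using assms by (simp add: field_simps)
  then have "(- ln h) ^ 4 \<le> (1 / b * h powr (- b)) ^ 4" using False assms by (intro power_mono) auto
  also have "\<dots> = (1 / b) ^ 4 * h powr (- (4 * b))"
    using assms powr_power[of h "- b" 4] by (simp only: power_mult_distrib) simp
  finally show ?thesis by (simp add: add_increasing)
qed

lemma power4_add_le: "(x + y) ^ 4 \<le> 8 * x ^ 4 + 8 * y ^ 4" for x y :: real
proof -
  have "(x + y)\<^sup>2 \<le> 2 * x\<^sup>2 + 2 * y\<^sup>2"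
    using sum_squares_bound[of x y] by (simp add: power2_sum)
  then have "((x + y)\<^sup>2)\<^sup>2 \<le> (2 * x\<^sup>2 + 2 * y\<^sup>2)\<^sup>2" by (intro power_mono) auto
  also have "\<dots> \<le> 2 * (2 * x\<^sup>2)\<^sup>2 + 2 * (2 * y\<^sup>2)\<^sup>2"
    using sum_squares_bound[of "2 * x\<^sup>2" "2 * y\<^sup>2"] by (simp add: power2_sum)
  finally show ?thesis by (simp add: power_mult_distrib power_mult[symmetric])
qed

text \<open>The second moment of the fading covers large \<open>h\<close>, the power law covers
  \<open>h\<close> below \<open>h0\<close>, and on the rest the negative power of \<open>h\<close>
  is bounded.\<close>

lemma delta_H_power4_integrable:
  assumes s: "\<sigma> > 0" and f: "fading_pdf f" and reg: "regular_fading f"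
  shows "integrable (fading_law f) (\<lambda>h. (delta_H \<sigma> h) ^ 4)"
proof -
  have fm[measurable]: "f \<in> borel_measurable borel" and f0: "\<And>h. 0 \<le> f h" and fneg: "\<And>h. h < 0 \<Longrightarrow> f h = 0"
    and f1: "(\<integral>\<^sup>+h. ennreal (f h) \<partial>lborel) = 1" and f2: "(\<integral>\<^sup>+h. ennreal (h\<^sup>2 * f h) \<partial>lborel) = 1"
    using f by (auto simp: fading_pdf_def)
  obtain \<alpha> c h0 where \<alpha>: "0 < \<alpha>" and c: "0 < c" and h0: "0 < h0"
    and fh: "\<And>h. 0 < h \<Longrightarrow> h < h0 \<Longrightarrow> f h = c * h powr (\<alpha> - 1)"
    using reg by (auto simp: regular_fading_def)
  \<comment> \<open>Then \<open>4 * b\<close> is \<open>\<alpha> / 2\<close>, so near 0 the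
    integrand behaves like \<open>h powr (\<alpha> / 2 - 1)\<close>, which is integrable.\<close>
  define b where "b = \<alpha> / 8"
  have b: "0 < b" using \<alpha> by (simp add: b_def)
  define m where "m = 1/2 * ln (2 * pi * \<sigma>\<^sup>2) + 1/2"
  define K1 where "K1 = 8 * (1 / b) ^ 4 * h0 powr (- (4 * b)) + 8 * m ^ 4"
  define K3 where "K3 = 8 * (1 / b) ^ 4 * c"
  have K: "0 \<le> K1" "0 \<le> K3" using c by (auto simp: K1_def K3_def)
  have ptw: "f h * (delta_H \<sigma> h) ^ 4 \<le> K1 * f h + 128 * (h\<^sup>2 * f h) + K3 * (h powr (\<alpha> / 2 - 1) * indicator {0..h0} h)"
    if "h \<noteq> 0" for h
  proof (cases "h < 0")
    case True
    then show ?thesis using fneg[of h] K by simp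
  next
    case False
    with that have h: "0 < h" by simp
    have "delta_H \<sigma> h = ln h + (- m)" using delta_H_pos[OF s h] by (simp add: m_def)
    then have "(delta_H \<sigma> h) ^ 4 \<le> 8 * (ln h) ^ 4 + 8 * m ^ 4"
      using power4_add_le[of "ln h" "- m"] by simp
    also have "\<dots> \<le> 8 * (16 * h\<^sup>2 + (1 / b) ^ 4 * h powr (- (4 * b))) + 8 * m ^ 4"
      using ln_power4_le[OF h b] by simp
    finally have 1: "f h * (delta_H \<sigma> h) ^ 4 \<le> f h * (128 * h\<^sup>2 + 8 * (1 / b) ^ 4 * h powr (- (4 * b)) + 8 * m ^ 4)"
      using f0[of h] by (intro mult_left_mono) auto
    have 2: "f h * (8 * (1 / b) ^ 4 * h powr (- (4 * b)))
        \<le> 8 * (1 / b) ^ 4 * h0 powr (- (4 * b)) * f h + K3 * (h powr (\<alpha> / 2 - 1) * indicator {0..h0} h)"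
    proof (cases "h < h0")
      case True
      have "f h * h powr (- (4 * b)) = c * h powr (\<alpha> / 2 - 1)"
        using fh[OF h True] h by (simp add: b_def powr_add[symmetric] field_simps)
      then have "f h * (8 * (1 / b) ^ 4 * h powr (- (4 * b))) = K3 * (h powr (\<alpha> / 2 - 1) * indicator {0..h0} h)"
        using h True by (simp add: K3_def mult_ac)
      moreover have "0 \<le> 8 * (1 / b) ^ 4 * h0 powr (- (4 * b)) * f h" using f0[of h] by simp
      ultimately show ?thesis by linarith
    next
      case False
      have "h powr (- (4 * b)) \<le> h0 powr (- (4 * b))"
        using False h0 b by (intro powr_mono2') auto
      then have "(8 * (1 / b) ^ 4 * f h) * h powr (- (4 * b)) \<le> (8 * (1 / b) ^ 4 * f h) * h0 powr (- (4 * b))"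
        using f0[of h] by (intro mult_left_mono) auto
      moreover have "0 \<le> K3 * (h powr (\<alpha> / 2 - 1) * indicator {0..h0} h)" using K by simp
      ultimately show ?thesis by (simp add: mult_ac)
    qed
    show ?thesis using 1 2 by (simp add: K1_def algebra_simps)
  qed
  have "(\<integral>\<^sup>+h. ennreal (norm ((delta_H \<sigma> h) ^ 4)) \<partial>fading_law f) = (\<integral>\<^sup>+h. ennreal (f h * (delta_H \<sigma> h) ^ 4) \<partial>lborel)"
    by (subst nn_integral_density) (auto simp: ennreal_mult f0 intro!: nn_integral_cong)
  also have "\<dots> \<le> (\<integral>\<^sup>+h. ennreal K1 * ennreal (f h) + ennreal 128 * ennreal (h\<^sup>2 * f h)
      + ennreal K3 * (ennreal (h powr (\<alpha> / 2 - 1)) * indicator {0..h0} h) \<partial>lborel)"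
  proof (rule nn_integral_mono_AE, use AE_lborel_singleton[of 0] in eventually_elim)
    case (elim h)
    have "ennreal (f h * (delta_H \<sigma> h) ^ 4)
        \<le> ennreal (K1 * f h + 128 * (h\<^sup>2 * f h) + K3 * (h powr (\<alpha> / 2 - 1) * indicator {0..h0} h))"
      by (rule ennreal_leI[OF ptw[OF elim]])
    also have "\<dots> = ennreal K1 * ennreal (f h) + ennreal 128 * ennreal (h\<^sup>2 * f h)
      + ennreal K3 * (ennreal (h powr (\<alpha> / 2 - 1)) * indicator {0..h0} h)"
      using K f0[of h] by (auto simp: ennreal_plus ennreal_mult' split: split_indicator)
    finally show ?case .
  qed
  also have "\<dots> = ennreal K1 * 1 + ennreal 128 * 1
      + ennreal K3 * (\<integral>\<^sup>+h. ennreal (h powr (\<alpha> / 2 - 1)) * indicator {0..h0} h \<partial>lborel)"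
    by (simp add: nn_integral_add nn_integral_cmult f1 f2)
  also have "\<dots> < \<infinity>"
    using nn_integral_powr_from_0[of "\<alpha> / 2 - 1" h0] \<alpha> h0 by (simp add: ennreal_mult_less_top)
  finally show ?thesis by (intro integrableI_bounded) auto
qed

text \<open>Fourth moments are carried instead of absolute third ones: an even power has no absolute
  value and is easily bounded for sums.\<close>

lemma (in prob_space) integrable_of_power4:
  fixes X :: "'a \<Rightarrow> real"
  assumes [measurable]: "X \<in> borel_measurable M" and X4: "integrable M (\<lambda>x. X x ^ 4)"
  shows "integrable M X" "integrable M (\<lambda>x. (X x)\<^sup>2)" "integrable M (\<lambda>x. \<bar>X x\<bar> ^ 3)"
proof -
  have int: "integrable M (\<lambda>x. 1 + X x ^ 4)" using X4 by simp
  have b: "\<bar>x\<bar> ^ k \<le> 1 + x ^ 4" if "k \<le> 4" for x :: real and k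
  proof (cases "\<bar>x\<bar> \<le> 1")
    case True
    then have "\<bar>x\<bar> ^ k \<le> 1" by (intro power_le_one) auto
    then show ?thesis by (simp add: add_increasing2)
  next
    case False
    then have "\<bar>x\<bar> ^ k \<le> \<bar>x\<bar> ^ 4" using that by (intro power_increasing) auto
    then show ?thesis by (simp add: power_even_abs)
  qed
  show "integrable M X"
    using b[of 1] by (intro Bochner_Integration.integrable_bound[OF int]) (auto intro!: AE_I2)
  show "integrable M (\<lambda>x. (X x)\<^sup>2)"
    using b[of 2] by (intro Bochner_Integration.integrable_bound[OF int]) (auto intro!: AE_I2)
  show "integrable M (\<lambda>x. \<bar>X x\<bar> ^ 3)"
    using b[of 3] by (intro Bochner_Integration.integrable_bound[OF int]) (auto intro!: AE_I2)
qed

definition fading_dev :: "real \<Rightarrow> (real \<Rightarrow> real) \<Rightarrow> real \<Rightarrow> real" where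
  "fading_dev \<sigma> f h = delta_H \<sigma> h - delta_star \<sigma> f"

definition noise_dev :: "real \<Rightarrow> real \<Rightarrow> real" where
  "noise_dev \<sigma> z = 1/2 - z\<^sup>2 / (2 * \<sigma>\<^sup>2)"

lemma fading_dev_measurable[measurable]: "fading_dev \<sigma> f \<in> borel_measurable borel" unfolding fading_dev_def by measurable
lemma noise_dev_measurable[measurable]: "noise_dev \<sigma> \<in> borel_measurable borel" unfolding noise_dev_def by measurable

lemma fading_dev_moments:
  assumes s: "\<sigma> > 0" and f: "fading_pdf f" and reg: "regular_fading f"
  shows "integrable (fading_law f) (\<lambda>h. fading_dev \<sigma> f h ^ 4)"
    and "integral\<^sup>L (fading_law f) (fading_dev \<sigma> f) = 0"
    and "integral\<^sup>L (fading_law f) (\<lambda>h. (fading_dev \<sigma> f h)\<^sup>2) = dispersion \<sigma> f - 1/2"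
proof -
  interpret F: prob_space "fading_law f" by (rule prob_space_fading_density[OF f])
  note d4 = delta_H_power4_integrable[OF assms]
  show "integrable (fading_law f) (\<lambda>h. fading_dev \<sigma> f h ^ 4)"
  proof (rule Bochner_Integration.integrable_bound)
    show "integrable (fading_law f) (\<lambda>h. 8 * delta_H \<sigma> h ^ 4 + 8 * (delta_star \<sigma> f) ^ 4)" using d4 by simp
    show "AE h in fading_law f. norm (fading_dev \<sigma> f h ^ 4) \<le> norm (8 * delta_H \<sigma> h ^ 4 + 8 * (delta_star \<sigma> f) ^ 4)"
      using power4_add_le[of "delta_H \<sigma> _" "- delta_star \<sigma> f"] by (intro AE_I2) (simp add: fading_dev_def)
  qed measurable
  have "integrable (fading_law f) (delta_H \<sigma>)" by (rule F.integrable_of_power4(1)[OF _ d4]) simp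
  then show "integral\<^sup>L (fading_law f) (fading_dev \<sigma> f) = 0"
    unfolding fading_dev_def by (subst Bochner_Integration.integral_diff) (use F.prob_space in \<open>auto simp: delta_star_def\<close>)
  show "integral\<^sup>L (fading_law f) (\<lambda>h. (fading_dev \<sigma> f h)\<^sup>2) = dispersion \<sigma> f - 1/2"
    by (simp add: dispersion_def fading_dev_def)
qed

lemma normal_even_moment:
  assumes "\<sigma> > 0"
  shows "has_bochner_integral (noise_law \<sigma>) (\<lambda>z. z ^ (2 * k)) (fact (2 * k) / ((2 / \<sigma>\<^sup>2) ^ k * fact k))"
proof -
  have "has_bochner_integral lborel (\<lambda>z. normal_density 0 \<sigma> z *\<^sub>R z ^ (2 * k)) (fact (2 * k) / ((2 / \<sigma>\<^sup>2) ^ k * fact k))"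
    using normal_moment_even[OF assms, of 0 k] by simp
  then show ?thesis
    using assms by (intro has_bochner_integral_density) auto
qed

text \<open>The fourth moment of a normal variable is three times the squared variance, so the
  second moment here is 1/4 - 1/2 + 3/4. This is the term 1/2 of the dispersion.\<close>

lemma noise_dev_moments:
  assumes s: "\<sigma> > 0"
  shows "integrable (noise_law \<sigma>) (\<lambda>z. noise_dev \<sigma> z ^ 4)"
    and "integral\<^sup>L (noise_law \<sigma>) (noise_dev \<sigma>) = 0"
    and "integral\<^sup>L (noise_law \<sigma>) (\<lambda>z. (noise_dev \<sigma> z)\<^sup>2) = 1/2"
proof -
  interpret N: prob_space "noise_law \<sigma>" by (rule prob_space_normal_density[OF s])
  have N1: "N.prob UNIV = 1" using N.prob_space by simp
  have i: "integrable (noise_law \<sigma>) (\<lambda>z. z ^ (2 * k))" for k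
    using normal_even_moment[OF s, of k] by (simp add: has_bochner_integral_iff)
  have m2: "has_bochner_integral (noise_law \<sigma>) (\<lambda>z. z\<^sup>2) (\<sigma>\<^sup>2)"
    using normal_even_moment[OF s, of 1] s by (simp add: fact_numeral)
  have m4: "has_bochner_integral (noise_law \<sigma>) (\<lambda>z. z ^ 4) (3 * \<sigma> ^ 4)"
    using normal_even_moment[OF s, of 2] s by (simp add: fact_numeral power_divide power_mult[symmetric])
  show "integrable (noise_law \<sigma>) (\<lambda>z. noise_dev \<sigma> z ^ 4)"
  proof (rule Bochner_Integration.integrable_bound)
    show "integrable (noise_law \<sigma>) (\<lambda>z. 8 * (1/2) ^ 4 + 8 * (1 / (2 * \<sigma>\<^sup>2)) ^ 4 * z ^ (2 * 4))" using i[of 4] by simp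
    have "noise_dev \<sigma> z ^ 4 \<le> 8 * (1/2) ^ 4 + 8 * (1 / (2 * \<sigma>\<^sup>2)) ^ 4 * z ^ (2 * 4)" for z
    proof -
      have "noise_dev \<sigma> z ^ 4 \<le> 8 * (1/2) ^ 4 + 8 * (- (z\<^sup>2 / (2 * \<sigma>\<^sup>2))) ^ 4"
        using power4_add_le[of "1/2" "- (z\<^sup>2 / (2 * \<sigma>\<^sup>2))"] by (simp add: noise_dev_def)
      also have "(- (z\<^sup>2 / (2 * \<sigma>\<^sup>2))) ^ 4 = (1 / (2 * \<sigma>\<^sup>2)) ^ 4 * z ^ (2 * 4)"
        by (simp add: power_divide power_mult[symmetric])
      finally show ?thesis by simp
    qed
    then show "AE z in noise_law \<sigma>. norm (noise_dev \<sigma> z ^ 4) \<le> norm (8 * (1/2) ^ 4 + 8 * (1 / (2 * \<sigma>\<^sup>2)) ^ 4 * z ^ (2 * 4))"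
      by (intro AE_I2) (simp add: order_trans[OF _ abs_ge_self])
  qed measurable
  have "has_bochner_integral (noise_law \<sigma>) (\<lambda>z. 1/2 - z\<^sup>2 / (2 * \<sigma>\<^sup>2)) (1/2 - \<sigma>\<^sup>2 / (2 * \<sigma>\<^sup>2))"
    using m2 by (intro has_bochner_integral_diff has_bochner_integral_divide_zero)
      (auto simp: has_bochner_integral_iff N1)
  then show "integral\<^sup>L (noise_law \<sigma>) (noise_dev \<sigma>) = 0"
    using s by (simp add: has_bochner_integral_iff noise_dev_def[abs_def])
  have "has_bochner_integral (noise_law \<sigma>) (\<lambda>z. 1/4 - z\<^sup>2 / (2 * \<sigma>\<^sup>2) + z ^ 4 / (4 * \<sigma> ^ 4))
      (1/4 - \<sigma>\<^sup>2 / (2 * \<sigma>\<^sup>2) + 3 * \<sigma> ^ 4 / (4 * \<sigma> ^ 4))"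
    using m2 m4 by (intro has_bochner_integral_add has_bochner_integral_diff has_bochner_integral_divide_zero)
      (auto simp: has_bochner_integral_iff N1)
  moreover have "(\<lambda>z. 1/4 - z\<^sup>2 / (2 * \<sigma>\<^sup>2) + z ^ 4 / (4 * \<sigma> ^ 4)) = (\<lambda>z. (noise_dev \<sigma> z)\<^sup>2)"
    using s by (auto simp: noise_dev_def fun_eq_iff power2_diff power_divide power_mult_distrib power_mult[symmetric])
  ultimately show "integral\<^sup>L (noise_law \<sigma>) (\<lambda>z. (noise_dev \<sigma> z)\<^sup>2) = 1/2"
    using s by (simp add: has_bochner_integral_iff)
qed

section \<open>Law of the normalised information density\<close>

text \<open>The contribution of one channel use to \<open>info\<close>, centred and scaled to unit
  variance.\<close>

definition letter_law :: "real \<Rightarrow> (real \<Rightarrow> real) \<Rightarrow> real measure" where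
  "letter_law \<sigma> f = distr (fading_law f \<Otimes>\<^sub>M noise_law \<sigma>) borel (\<lambda>x. (fading_dev \<sigma> f (fst x) + noise_dev \<sigma> (snd x)) / sqrt (dispersion \<sigma> f))"

lemma dispersion_pos: "dispersion \<sigma> f \<ge> 1/2"
  unfolding dispersion_def by (simp add: Bochner_Integration.integral_nonneg)

lemma (in pair_prob_space) integral_product:
  fixes g h :: "_ \<Rightarrow> 'c :: {real_normed_field, banach, second_countable_topology}"
  assumes [measurable]: "integrable M1 g" "integrable M2 h"
  shows "integrable (M1 \<Otimes>\<^sub>M M2) (\<lambda>x. g (fst x) * h (snd x))"
    and "integral\<^sup>L (M1 \<Otimes>\<^sub>M M2) (\<lambda>x. g (fst x) * h (snd x)) = integral\<^sup>L M1 g * integral\<^sup>L M2 h"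
proof -
  show int: "integrable (M1 \<Otimes>\<^sub>M M2) (\<lambda>x. g (fst x) * h (snd x))"
  proof (rule Fubini_integrable)
    show "integrable M1 (\<lambda>x. \<integral>y. norm (g (fst (x, y)) * h (snd (x, y))) \<partial>M2)"
      using assms by (simp add: norm_mult)
    show "AE x in M1. integrable M2 (\<lambda>y. g (fst (x, y)) * h (snd (x, y)))"
      using assms by (intro AE_I2) simp
  qed measurable
  show "integral\<^sup>L (M1 \<Otimes>\<^sub>M M2) (\<lambda>x. g (fst x) * h (snd x)) = integral\<^sup>L M1 g * integral\<^sup>L M2 h"
    using integral_fst'[OF int] assms by simp
qed

text \<open>The cross term of the variance vanishes because the fading and noise parts are
  independent and centred; their variances then add up to the dispersion.\<close>

lemma letter_law_moments:
  assumes s: "\<sigma> > 0" and f: "fading_pdf f" and reg: "regular_fading f"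
  shows "real_distribution (letter_law \<sigma> f)"
    and "integrable (letter_law \<sigma> f) (\<lambda>x. x)" "integral\<^sup>L (letter_law \<sigma> f) (\<lambda>x. x) = 0"
    and "integrable (letter_law \<sigma> f) (\<lambda>x. x\<^sup>2)" "integral\<^sup>L (letter_law \<sigma> f) (\<lambda>x. x\<^sup>2) = 1"
    and "integrable (letter_law \<sigma> f) (\<lambda>x. \<bar>x\<bar> ^ 3)"
proof -
  interpret F: prob_space "fading_law f" by (rule prob_space_fading_density[OF f])
  interpret N: prob_space "noise_law \<sigma>" by (rule prob_space_normal_density[OF s])
  interpret P: pair_prob_space "fading_law f" "noise_law \<sigma>" by standard
  have P1: "F.prob UNIV = 1" "N.prob UNIV = 1" using F.prob_space N.prob_space by auto
  define V where "V = dispersion \<sigma> f"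
  have V: "0 < V" using dispersion_pos[of \<sigma> f] by (simp add: V_def)
  have fm: "f \<in> borel_measurable borel" using f by (simp add: fading_pdf_def)
  note fading_dev = fading_dev_moments[OF assms] and noise_dev = noise_dev_moments[OF s]
  note Ui = F.integrable_of_power4[OF _ fading_dev(1)] and Wi = N.integrable_of_power4[OF _ noise_dev(1)]
  define Y where "Y x = (fading_dev \<sigma> f (fst x) + noise_dev \<sigma> (snd x)) / sqrt V" for x
  have Ym[measurable]: "Y \<in> borel_measurable (fading_law f \<Otimes>\<^sub>M noise_law \<sigma>)" unfolding Y_def by measurable
  have D: "letter_law \<sigma> f = distr (fading_law f \<Otimes>\<^sub>M noise_law \<sigma>) borel Y"
    unfolding letter_law_def Y_def V_def ..
  show "real_distribution (letter_law \<sigma> f)" unfolding D by (rule P.real_distribution_distr) measurable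
  have iU: "integrable (fading_law f \<Otimes>\<^sub>M noise_law \<sigma>) (\<lambda>x. g (fst x))" "P.expectation (\<lambda>x. g (fst x)) = F.expectation g"
    if "integrable (fading_law f) g" for g :: "real \<Rightarrow> real"
    using P.integral_product[OF that, of "\<lambda>_. 1"] by (auto simp: P1)
  have iW: "integrable (fading_law f \<Otimes>\<^sub>M noise_law \<sigma>) (\<lambda>x. g (snd x))" "P.expectation (\<lambda>x. g (snd x)) = N.expectation g"
    if "integrable (noise_law \<sigma>) g" for g :: "real \<Rightarrow> real"
    using P.integral_product[OF _ that, of "\<lambda>_. 1"] by (auto simp: P1)
  have U1: "integrable (fading_law f) (fading_dev \<sigma> f)" "integrable (fading_law f) (\<lambda>h. (fading_dev \<sigma> f h)\<^sup>2)" using Ui by auto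
  have W1: "integrable (noise_law \<sigma>) (noise_dev \<sigma>)" "integrable (noise_law \<sigma>) (\<lambda>h. (noise_dev \<sigma> h)\<^sup>2)" using Wi by auto
  have Y4: "integrable (fading_law f \<Otimes>\<^sub>M noise_law \<sigma>) (\<lambda>x. Y x ^ 4)"
  proof (rule Bochner_Integration.integrable_bound)
    show "integrable (fading_law f \<Otimes>\<^sub>M noise_law \<sigma>) (\<lambda>x. (8 * fading_dev \<sigma> f (fst x) ^ 4 + 8 * noise_dev \<sigma> (snd x) ^ 4) / sqrt V ^ 4)"
      using iU(1)[OF fading_dev(1)] iW(1)[OF noise_dev(1)] by simp
    have "Y x ^ 4 \<le> (8 * fading_dev \<sigma> f (fst x) ^ 4 + 8 * noise_dev \<sigma> (snd x) ^ 4) / sqrt V ^ 4" for x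
      unfolding Y_def power_divide using V by (intro divide_right_mono power4_add_le) auto
    then show "AE x in fading_law f \<Otimes>\<^sub>M noise_law \<sigma>. norm (Y x ^ 4) \<le> norm ((8 * fading_dev \<sigma> f (fst x) ^ 4 + 8 * noise_dev \<sigma> (snd x) ^ 4) / sqrt V ^ 4)"
      by (intro AE_I2) (simp add: order_trans[OF _ abs_ge_self])
  qed measurable
  note Yi = P.integrable_of_power4[OF Ym Y4]
  show "integrable (letter_law \<sigma> f) (\<lambda>x. x)" "integrable (letter_law \<sigma> f) (\<lambda>x. x\<^sup>2)" "integrable (letter_law \<sigma> f) (\<lambda>x. \<bar>x\<bar> ^ 3)"
    unfolding D using Yi by (simp_all add: integrable_distr_eq)
  have "P.expectation Y = (P.expectation (\<lambda>x. fading_dev \<sigma> f (fst x)) + P.expectation (\<lambda>x. noise_dev \<sigma> (snd x))) / sqrt V"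
    unfolding Y_def using iU(1)[OF U1(1)] iW(1)[OF W1(1)] by simp
  also have "\<dots> = 0" using iU(2)[OF U1(1)] iW(2)[OF W1(1)] fading_dev noise_dev by simp
  finally show "integral\<^sup>L (letter_law \<sigma> f) (\<lambda>x. x) = 0"
    unfolding D by (simp add: integral_distr)
  note UW = P.integral_product[OF U1(1) W1(1)]
  have "P.expectation (\<lambda>x. (Y x)\<^sup>2) = P.expectation (\<lambda>x. ((fading_dev \<sigma> f (fst x))\<^sup>2 + (noise_dev \<sigma> (snd x))\<^sup>2 + 2 * (fading_dev \<sigma> f (fst x) * noise_dev \<sigma> (snd x))) / V)"
    using V by (intro Bochner_Integration.integral_cong) (auto simp: Y_def power_divide power2_sum mult.assoc)
  also have "\<dots> = (P.expectation (\<lambda>x. (fading_dev \<sigma> f (fst x))\<^sup>2) + P.expectation (\<lambda>x. (noise_dev \<sigma> (snd x))\<^sup>2)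
      + 2 * P.expectation (\<lambda>x. fading_dev \<sigma> f (fst x) * noise_dev \<sigma> (snd x))) / V"
    using iU(1)[OF U1(2)] iW(1)[OF W1(2)] UW(1) by simp
  also have "\<dots> = 1"
    using iU(2)[OF U1(2)] iW(2)[OF W1(2)] UW(2) fading_dev noise_dev V by (simp add: V_def)
  finally show "integral\<^sup>L (letter_law \<sigma> f) (\<lambda>x. x\<^sup>2) = 1"
    unfolding D by (simp add: integral_distr)
qed

lemma char_letter_law:
  assumes s: "\<sigma> > 0" and f: "fading_pdf f"
  shows "char (letter_law \<sigma> f) t = (CLINT h|fading_law f. iexp (t / sqrt (dispersion \<sigma> f) * fading_dev \<sigma> f h))
      * (CLINT z|noise_law \<sigma>. iexp (t / sqrt (dispersion \<sigma> f) * noise_dev \<sigma> z))"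
proof -
  interpret F: prob_space "fading_law f" by (rule prob_space_fading_density[OF f])
  interpret N: prob_space "noise_law \<sigma>" by (rule prob_space_normal_density[OF s])
  interpret P: pair_prob_space "fading_law f" "noise_law \<sigma>" by standard
  let ?V = "dispersion \<sigma> f"
  let ?u = "\<lambda>h. iexp (t / sqrt ?V * fading_dev \<sigma> f h)" and ?w = "\<lambda>z. iexp (t / sqrt ?V * noise_dev \<sigma> z)"
  have "char (letter_law \<sigma> f) t = P.expectation (\<lambda>x. iexp (t * ((fading_dev \<sigma> f (fst x) + noise_dev \<sigma> (snd x)) / sqrt ?V)))"
    unfolding char_def letter_law_def by (subst integral_distr) auto
  also have "\<dots> = P.expectation (\<lambda>x. ?u (fst x) * ?w (snd x))"
    by (intro Bochner_Integration.integral_cong) (auto simp: exp_add[symmetric] distrib_left add_divide_distrib)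
  also have "\<dots> = (CLINT h|fading_law f. ?u h) * (CLINT z|noise_law \<sigma>. ?w z)"
    by (intro P.integral_product(2) F.integrable_iexp N.integrable_iexp) auto
  finally show ?thesis .
qed

definition normalized_info :: "nat \<Rightarrow> real \<Rightarrow> (real \<Rightarrow> real) \<Rightarrow> real measure" where
  "normalized_info n \<sigma> f = distr (joint n \<sigma> f) borel
     (\<lambda>x. (info n \<sigma> (fst x) (snd x) - real n * delta_star \<sigma> f) / sqrt (real n * dispersion \<sigma> f))"

text \<open>The product structure is used only at the level of characteristic functions: the
  exponential of the sum factors over fading, noise and coordinates. This is exactly the form in
  which \<open>berry_esseen_log\<close> takes its hypothesis, so no sequence of independent
  variables has to be constructed.\<close>

lemma char_normalized_info:
  assumes s: "\<sigma> > 0" and f: "fading_pdf f"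
  shows "char (normalized_info n \<sigma> f) t = char (letter_law \<sigma> f) (t / sqrt (real n)) ^ n"
proof -
  interpret F: prob_space "fading_law f" by (rule prob_space_fading_density[OF f])
  interpret N: prob_space "noise_law \<sigma>" by (rule prob_space_normal_density[OF s])
  interpret PF: product_sigma_finite "\<lambda>_::nat. fading_law f" by standard
  interpret PN: product_sigma_finite "\<lambda>_::nat. noise_law \<sigma>" by standard
  interpret Fn: prob_space "fading n f" using f by (rule prob_space_fading)
  interpret Nn: prob_space "noise n \<sigma>" using s by (rule prob_space_noise)
  interpret P: pair_prob_space "fading n f" "noise n \<sigma>" by standard
  define r where "r = t / sqrt (real n) / sqrt (dispersion \<sigma> f)"
  let ?u = "\<lambda>H. \<Prod>i<n. iexp (r * fading_dev \<sigma> f (H i))" and ?w = "\<lambda>z. \<Prod>i<n. iexp (r * noise_dev \<sigma> (z i))"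
  have bu: "cmod (?u H) \<le> 1" for H :: "nat \<Rightarrow> real"
    by (simp add: prod_norm[symmetric] norm_exp_i_times del: of_real_mult)
  have bw: "cmod (?w z) \<le> 1" for z :: "nat \<Rightarrow> real"
    by (simp add: prod_norm[symmetric] norm_exp_i_times del: of_real_mult)
  have "char (normalized_info n \<sigma> f) t
      = P.expectation (\<lambda>x. iexp (t * ((info n \<sigma> (fst x) (snd x) - real n * delta_star \<sigma> f) / sqrt (real n * dispersion \<sigma> f))))"
    unfolding char_def normalized_info_def by (subst integral_distr) auto
  also have "\<dots> = P.expectation (\<lambda>x. ?u (fst x) * ?w (snd x))"
  proof (rule Bochner_Integration.integral_cong[OF refl])
    fix x :: "(nat \<Rightarrow> real) \<times> (nat \<Rightarrow> real)"
    have "t * ((info n \<sigma> (fst x) (snd x) - real n * delta_star \<sigma> f) / sqrt (real n * dispersion \<sigma> f))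
        = r * (info n \<sigma> (fst x) (snd x) - real n * delta_star \<sigma> f)"
      by (simp add: r_def real_sqrt_mult)
    also have "r * (info n \<sigma> (fst x) (snd x) - real n * delta_star \<sigma> f)
        = r * ((\<Sum>i<n. fading_dev \<sigma> f (fst x i)) + (\<Sum>i<n. noise_dev \<sigma> (snd x i)))"
      by (simp add: info_def fading_dev_def noise_dev_def sum.distrib sum_subtractf)
    also have "r * ((\<Sum>i<n. fading_dev \<sigma> f (fst x i)) + (\<Sum>i<n. noise_dev \<sigma> (snd x i)))
        = (\<Sum>i<n. r * fading_dev \<sigma> f (fst x i)) + (\<Sum>i<n. r * noise_dev \<sigma> (snd x i))"
      by (simp add: distrib_left sum_distrib_left)
    finally show "iexp (t * ((info n \<sigma> (fst x) (snd x) - real n * delta_star \<sigma> f) / sqrt (real n * dispersion \<sigma> f)))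
        = ?u (fst x) * ?w (snd x)"
      by (simp only: of_real_add of_real_sum distrib_left sum_distrib_left exp_add exp_sum[OF finite_lessThan])
  qed
  also have "\<dots> = (CLINT H|fading n f. ?u H) * (CLINT z|noise n \<sigma>. ?w z)"
    by (intro P.integral_product(2) Fn.integrable_const_bound[where B=1] Nn.integrable_const_bound[where B=1] AE_I2 bu bw)
      measurable
  also have "(CLINT H|fading n f. ?u H) = (\<Prod>i<n. CLINT h|fading_law f. iexp (r * fading_dev \<sigma> f h))"
    unfolding fading_def by (intro PF.product_integral_prod F.integrable_iexp) auto
  also have "(CLINT z|noise n \<sigma>. ?w z) = (\<Prod>i<n. CLINT z|noise_law \<sigma>. iexp (r * noise_dev \<sigma> z))"
    unfolding noise_def by (intro PN.product_integral_prod N.integrable_iexp) auto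
  finally show ?thesis
    by (simp add: char_letter_law[OF s f] r_def power_mult_distrib)
qed

text \<open>\<open>letter_law\<close> does not depend on \<open>n\<close>, so one constant serves
  all dimensions.\<close>

theorem info_cdf_close:
  assumes s: "\<sigma> > 0" and f: "fading_pdf f" and reg: "regular_fading f"
  shows "\<exists>C\<ge>0. \<forall>n\<ge>3. \<forall>x. \<bar>measure (joint n \<sigma> f) (info_le n \<sigma> f (real n * delta_star \<sigma> f + x * sqrt (real n * dispersion \<sigma> f))) - \<Phi> x\<bar>
    \<le> C * ln (real n) / sqrt (real n)"
proof -
  obtain C where C: "0 \<le> C" and close: "\<And>n M x. 3 \<le> n \<Longrightarrow> real_distribution M \<Longrightarrow>
      (\<forall>t. char M t = char (letter_law \<sigma> f) (t / sqrt (real n)) ^ n) \<Longrightarrow> \<bar>cdf M x - \<Phi> x\<bar> \<le> C * ln (real n) / sqrt (real n)"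
    using berry_esseen_log[OF letter_law_moments[OF assms]] by blast
  show ?thesis
  proof (intro exI[of _ C] conjI C allI impI)
    fix n :: nat and x :: real assume n: "3 \<le> n"
    interpret P: prob_space "joint n \<sigma> f" using s f by (rule prob_space_joint)
    have pos: "0 < sqrt (real n * dispersion \<sigma> f)" using n dispersion_pos[of \<sigma> f] by simp
    have "cdf (normalized_info n \<sigma> f) x = P.prob {y \<in> space (joint n \<sigma> f).
        (info n \<sigma> (fst y) (snd y) - real n * delta_star \<sigma> f) / sqrt (real n * dispersion \<sigma> f) \<le> x}"
      unfolding cdf_def normalized_info_def
      by (subst measure_distr) (auto intro!: arg_cong[where f=P.prob])
    also have "\<dots> = P.prob (info_le n \<sigma> f (real n * delta_star \<sigma> f + x * sqrt (real n * dispersion \<sigma> f)))"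
      using pos by (simp add: pos_divide_le_eq diff_le_eq add.commute)
    finally show "\<bar>P.prob (info_le n \<sigma> f (real n * delta_star \<sigma> f + x * sqrt (real n * dispersion \<sigma> f))) - \<Phi> x\<bar>
      \<le> C * ln (real n) / sqrt (real n)"
      using close[OF n, of "normalized_info n \<sigma> f" x] char_normalized_info[OF s f]
        P.real_distribution_distr[of "\<lambda>x. (info n \<sigma> (fst x) (snd x) - real n * delta_star \<sigma> f) / sqrt (real n * dispersion \<sigma> f)"]
      by (simp add: normalized_info_def)
  qed
qed

section \<open>The expansion\<close>

lemma Phi_continuous: "isCont \<Phi> x"
proof -
  interpret Z: real_distribution std_normal_distribution by (rule real_dist_normal_dist)
  show ?thesis unfolding Z.isCont_cdf by (rule std_normal_no_atoms)
qed

lemma std_normal_density_ge: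
  assumes "\<bar>z\<bar> \<le> b"
  shows "std_normal_density b \<le> std_normal_density z"
proof -
  have "z\<^sup>2 \<le> b\<^sup>2" using assms by (intro abs_le_square_iff[THEN iffD1]) auto
  then show ?thesis by (auto simp: std_normal_density_def intro!: divide_right_mono)
qed

lemma Phi_strict_mono: "x < y \<Longrightarrow> \<Phi> x < \<Phi> y"
proof -
  assume xy: "x < y"
  let ?c = "std_normal_density (max \<bar>x\<bar> \<bar>y\<bar>)"
  have "?c * (y - x) \<le> \<Phi> y - \<Phi> x"
    using xy by (intro Phi_diff_ge std_normal_density_ge) auto
  moreover have "0 < ?c * (y - x)" using xy by (intro mult_pos_pos normal_density_pos) auto
  ultimately show ?thesis by linarith
qed

lemma Phi_surj:
  assumes "0 < e" "e < 1"
  shows "\<exists>x. \<Phi> x = e"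
proof -
  interpret Z: real_distribution std_normal_distribution by (rule real_dist_normal_dist)
  have "\<forall>\<^sub>F x in at_bot. \<Phi> x < e" using order_tendstoD(2)[OF Z.cdf_lim_at_bot] assms by blast
  then obtain a where a: "\<Phi> a < e" by (auto simp: eventually_at_bot_linorder)
  have "\<forall>\<^sub>F x in at_top. e < \<Phi> x" using order_tendstoD(1)[OF Z.cdf_lim_at_top_prob] assms by blast
  then obtain b where b: "e < \<Phi> b" by (auto simp: eventually_at_top_linorder)
  have "a \<le> b" using a b Z.cdf_nondecreasing[of b a] by linarith
  then show ?thesis using IVT[of \<Phi> a e b] a b Phi_continuous by auto
qed

lemma Qfun_eq: "Qfun x = \<Phi> (- x)"
proof -
  interpret Z: real_distribution std_normal_distribution by (rule real_dist_normal_dist)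
  have "emeasure std_normal_distribution {x<..} = (\<integral>\<^sup>+z. ennreal (std_normal_density z) * indicator {x<..} z \<partial>lborel)"
    by (simp add: emeasure_density)
  also have "\<dots> = (\<integral>\<^sup>+z. ennreal (std_normal_density (- z)) * indicator {x<..} (- z) \<partial>lborel)"
    using nn_integral_real_affine[of "\<lambda>z. ennreal (std_normal_density z) * indicator {x<..} z" "-1" 0] by simp
  also have "\<dots> = (\<integral>\<^sup>+z. ennreal (std_normal_density z) * indicator {..<- x} z \<partial>lborel)"
    by (intro nn_integral_cong) (auto simp: std_normal_density_def split: split_indicator)
  also have "\<dots> = emeasure std_normal_distribution {..<- x}"
    by (simp add: emeasure_density)
  finally have "Qfun x = Z.prob {..<- x}"
    by (simp add: Qfun_def Z.emeasure_eq_measure)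
  also have "\<dots> = \<Phi> (- x)"
  proof -
    have "Z.prob ({..<- x} \<union> {- x}) = Z.prob {..<- x} + Z.prob {- x}"
      by (intro Z.finite_measure_Union) auto
    moreover have "{..- x} = {..<- x} \<union> {- x}" by auto
    ultimately have "\<Phi> (- x) = Z.prob {..<- x} + Z.prob {- x}"
      unfolding cdf_def by (simp only:)
    then show ?thesis by (simp add: std_normal_no_atoms)
  qed
  finally show ?thesis .
qed

lemma Qinv_eq:
  assumes "\<Phi> p = e"
  shows "Qinv e = - p"
  unfolding Qinv_def
proof (rule the_equality)
  show "Qfun (- p) = e" using assms by (simp add: Qfun_eq)
  fix x assume "Qfun x = e"
  then have "\<Phi> (- x) = \<Phi> p" using assms by (simp add: Qfun_eq)
  then have "- x = p" using Phi_strict_mono[of "- x" p] Phi_strict_mono[of p "- x"] by (cases "- x" p rule: linorder_cases) auto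
  then show "x = - p" by simp
qed

section \<open>From the two bounds to the optimal density\<close>

text \<open>By contraposition: an eventual upper bound on the counts makes the density finite, which
  disposes of the infinite case of \<open>NLD\<close>, while density 0 would give the value minus
  infinity.\<close>

lemma frequently_density_if_NLD_gt:
  assumes "0 < n" and "ereal u < NLD n S"
  shows "\<exists>\<^sub>F a in at_top. exp (real n * u) < real (Mcount n S a) / a ^ n"
proof (rule ccontr)
  let ?g = "IC_density n S"
  assume "\<not> ?thesis"
  then have "\<forall>\<^sub>F a in at_top. ereal (real (Mcount n S a) / a ^ n) \<le> ereal (exp (real n * u))"
    by (simp add: frequently_def not_less)
  then have le: "?g \<le> ereal (exp (real n * u))"
    unfolding IC_density_def by (intro Limsup_bounded) auto
  have "\<forall>\<^sub>F a in at_top. 0 \<le> ereal (real (Mcount n S a) / a ^ n)"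
    using eventually_ge_at_top[of 0] by eventually_elim simp
  then have "0 \<le> ?g"
    unfolding IC_density_def by (intro le_Limsup) auto
  with le obtain r where r: "?g = ereal r" "0 \<le> r" by (cases ?g) auto
  have "r \<noteq> 0" using assms(2) r by (auto simp: NLD_def zero_ereal_def)
  then have "NLD n S = ereal (ln r / real n)" using r by (simp add: NLD_def zero_ereal_def)
  then have "u < ln r / real n" using assms by simp
  then have "real n * u < ln r" using assms by (simp add: pos_less_divide_eq mult.commute)
  then have "exp (real n * u) < r" using \<open>r \<noteq> 0\<close> r by (metis exp_less_cancel_iff exp_ln less_eq_real_def)
  with le r show False by simp
qed

text \<open>\<open>converse_bound\<close> with \<open>g = exp (n u)\<close>: a constellation of
  larger NLD would have an error probability above \<open>\<epsilon>\<close>.\<close>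

lemma delta_opt_le:
  assumes s: "\<sigma> > 0" and f: "fading_pdf f" and n: "0 < n" and "0 \<le> \<epsilon>"
    and gt: "\<epsilon> + 1 / sqrt (real n) < measure (joint n \<sigma> f) (info_le n \<sigma> f (real n * u - ln (real n) / 2))"
  shows "delta_opt n \<sigma> f \<epsilon> \<le> ereal u"
  unfolding delta_opt_def
proof (rule Sup_least, clarify)
  interpret P: prob_space "joint n \<sigma> f" using s f by (rule prob_space_joint)
  fix S assume S: "is_IC n S" "Pe_avg n \<sigma> f S \<le> ennreal \<epsilon>"
  show "NLD n S \<le> ereal u"
  proof (rule ccontr)
    assume "\<not> NLD n S \<le> ereal u"
    then have "ereal u < NLD n S" by simp
    from converse_bound[OF s f S(1) exp_gt_zero n frequently_density_if_NLD_gt[OF n this]]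
    have "ennreal (P.prob (info_le n \<sigma> f (real n * u - ln (real n) / 2)))
        \<le> Pe_avg n \<sigma> f S + ennreal (1 / sqrt (real n))"
      by (simp add: P.emeasure_eq_measure)
    also have "\<dots> \<le> ennreal \<epsilon> + ennreal (1 / sqrt (real n))" using S(2) by (rule add_right_mono)
    also have "\<dots> = ennreal (\<epsilon> + 1 / sqrt (real n))" using assms by (simp add: ennreal_plus)
    finally have "P.prob (info_le n \<sigma> f (real n * u - ln (real n) / 2))
        \<le> \<epsilon> + 1 / sqrt (real n)"
      using assms by (subst (asm) ennreal_le_iff) auto
    with gt show False by simp
  qed
qed

lemma delta_opt_ge:
  assumes s: "\<sigma> > 0" and f: "fading_pdf f" and n: "0 < n" and \<epsilon>: "\<epsilon> < 1"
    and le: "measure (joint n \<sigma> f) (info_le n \<sigma> f r)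
      + 2 / sqrt (real n) \<le> \<epsilon>"
  shows "ereal ((r - ln 3 - ln (real n) / 2) / real n) \<le> delta_opt n \<sigma> f \<epsilon>"
proof -
  interpret P: prob_space "joint n \<sigma> f" using s f by (rule prob_space_joint)
  let ?p = "P.prob (info_le n \<sigma> f r)"
  \<comment> \<open>Makes the competitor term of \<open>achievability\<close> equal to 1 / sqrt n.
    The slack for \<open>self_alias\<close> is given the same size, which explains the 2 / sqrt n in
    the hypothesis.\<close>
  define \<gamma> where "\<gamma> = exp r / (3 * sqrt (real n))"
  have \<gamma>: "0 < \<gamma>" using n by (simp add: \<gamma>_def)
  have \<gamma>r: "3 * \<gamma> / exp r = 1 / sqrt (real n)" by (simp add: \<gamma>_def)
  have ln\<gamma>: "ln \<gamma> = r - ln 3 - ln (real n) / 2"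
    using n by (simp add: \<gamma>_def ln_div ln_mult ln_sqrt)
  have sn: "0 < 1 / sqrt (real n)" using n by simp
  have "\<exists>S. is_IC n S \<and> ereal (ln \<gamma> / real n) \<le> NLD n S \<and> Pe_avg n \<sigma> f S
    \<le> ennreal ?p + ennreal (1 / sqrt (real n)) + ennreal (1 / sqrt (real n))"
    unfolding P.emeasure_eq_measure[symmetric] \<gamma>r[symmetric, of]
  proof (rule achievability[OF s f n \<gamma>])
    show "0 < 3 * \<gamma> / exp r" using \<gamma> by simp
    have "2 / sqrt (real n) = 1 / sqrt (real n) + 1 / sqrt (real n)" by simp
    then have "?p + 1 / sqrt (real n) < 1" using le \<epsilon> sn by linarith
    then show "emeasure (joint n \<sigma> f) (info_le n \<sigma> f r) + ennreal (3 * \<gamma> / exp r) < 1"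
      unfolding P.emeasure_eq_measure \<gamma>r using sn by (simp add: ennreal_plus[symmetric] ennreal_less_one_iff del: ennreal_plus)
  qed
  then obtain S where S: "is_IC n S" "ereal (ln \<gamma> / real n) \<le> NLD n S"
    "Pe_avg n \<sigma> f S \<le> ennreal ?p + ennreal (1 / sqrt (real n)) + ennreal (1 / sqrt (real n))" by blast
  have "ennreal ?p + ennreal (1 / sqrt (real n)) + ennreal (1 / sqrt (real n)) = ennreal (?p + 2 / sqrt (real n))"
    using sn by (simp add: ennreal_plus[symmetric] del: ennreal_plus)
  also have "\<dots> \<le> ennreal \<epsilon>" by (rule ennreal_leI[OF le])
  finally have "Pe_avg n \<sigma> f S \<le> ennreal \<epsilon>" using S(3) by (rule order_trans[rotated])
  with S have "NLD n S \<le> delta_opt n \<sigma> f \<epsilon>" unfolding delta_opt_def by (intro Sup_upper) blast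
  with S(2) show ?thesis unfolding ln\<gamma> by (rule order_trans)
qed

text \<open>The probability bounds are inverted through the slope of \<open>\<Phi>\<close> near the
  quantile \<open>p\<close> of \<open>\<epsilon>\<close>: a correction of order t = ln n / sqrt n in
  probability becomes \<open>K * t\<close> in the argument, and after division by sqrt n a term of
  order ln n / n.\<close>

theorem theorem4p1:
  fixes f :: "real \<Rightarrow> real" and \<sigma> \<epsilon> :: real
  assumes "\<sigma> > 0" and "fading_pdf f" and "regular_fading f"
    and "0 < \<epsilon>" and "\<epsilon> < 1"
  shows "\<exists>C. \<forall>\<^sub>F n in sequentially. \<exists>d. delta_opt n \<sigma> f \<epsilon> = ereal d \<and>
           \<bar>d - (delta_star \<sigma> f - sqrt (dispersion \<sigma> f / real n) * Qinv \<epsilon>)\<bar> \<le> C * ln (real n) / real n"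
proof -
  define V where "V = dispersion \<sigma> f"
  define \<mu> where "\<mu> = delta_star \<sigma> f"
  have V: "0 < V" using dispersion_pos[of \<sigma> f] by (simp add: V_def)
  obtain C1 where C1: "0 \<le> C1" and close: "\<And>n x. 3 \<le> n \<Longrightarrow> \<bar>measure (joint n \<sigma> f) (info_le n \<sigma> f (real n * \<mu> + x * sqrt (real n * V))) - \<Phi> x\<bar> \<le> C1 * ln (real n) / sqrt (real n)"
    using info_cdf_close[OF assms(1-3)] unfolding V_def \<mu>_def by blast
  obtain p where p: "\<Phi> p = \<epsilon>" using Phi_surj[OF assms(4,5)] by blast
  have Q: "Qinv \<epsilon> = - p" using p by (rule Qinv_eq)
  \<comment> \<open>A lower bound for the normal density within distance 1 of \<open>p\<close>;
    \<open>K * t < 1\<close>, which holds eventually, keeps the shifted quantiles there.\<close>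
  define c where "c = std_normal_density (\<bar>p\<bar> + 1)"
  have c: "0 < c" unfolding c_def by (rule normal_density_pos) simp
  \<comment> \<open>\<open>C1\<close> absorbs the Berry--Esseen error, and 3 covers the losses of 1
    / sqrt n and 2 / sqrt n with room for a strict inequality.\<close>
  define K where "K = (C1 + 3) / c"
  have K: "0 < K" "c * K = C1 + 3" using C1 c by (auto simp: K_def)
  have "(\<lambda>n. K * (ln (real n) / real n powr (1/2))) \<longlonglongrightarrow> K * 0"
    by (intro tendsto_intros lim_ln_over_power) simp
  then have "\<forall>\<^sub>F n in sequentially. K * (ln (real n) / real n powr (1/2)) < 1"
    by (intro order_tendstoD) auto
  then have "\<forall>\<^sub>F n in sequentially. \<exists>d. delta_opt n \<sigma> f \<epsilon> = ereal d \<and>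
           \<bar>d - (\<mu> - sqrt (V / real n) * Qinv \<epsilon>)\<bar> \<le> (K * sqrt V + 2) * ln (real n) / real n"
    using eventually_ge_at_top[of 3]
  proof eventually_elim
    case (elim n)
    define l where "l = ln (real n)"
    define t where "t = l / sqrt (real n)"
    have sn: "0 < sqrt (real n)" and n0: "0 < n" and n3: "3 \<le> n" using elim by auto
    have l1: "1 \<le> l"
    proof -
      have "exp 1 \<le> real n" using exp_le elim by linarith
      then show ?thesis using n0 by (simp add: l_def ln_ge_iff)
    qed
    have t1: "K * t < 1" using elim by (simp add: t_def l_def powr_half_sqrt)
    have t0: "0 < t" using l1 sn by (simp add: t_def)
    have Kt: "0 < K * t" using K t0 by simp
    have inv: "1 / sqrt (real n) \<le> t" using l1 sn by (simp add: t_def divide_right_mono)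
    have cK: "c * (K * t) = (C1 + 3) * t" using K by simp
    have up: "\<epsilon> + (C1 + 3) * t \<le> \<Phi> (p + K * t)"
    proof -
      have "c * ((p + K * t) - p) \<le> \<Phi> (p + K * t) - \<Phi> p"
        using c Kt t1 unfolding c_def by (intro Phi_diff_ge std_normal_density_ge) auto
      then show ?thesis using cK p by simp
    qed
    have low: "\<Phi> (p - K * t) \<le> \<epsilon> - (C1 + 3) * t"
    proof -
      have "c * (p - (p - K * t)) \<le> \<Phi> p - \<Phi> (p - K * t)"
        using c Kt t1 unfolding c_def by (intro Phi_diff_ge std_normal_density_ge) auto
      then show ?thesis using cK p by simp
    qed
    have close': "\<bar>measure (joint n \<sigma> f) (info_le n \<sigma> f (real n * \<mu> + x * sqrt (real n * V))) - \<Phi> x\<bar> \<le> C1 * t" for x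
      using close[OF n3, of x] by (simp add: t_def l_def)
    have nV: "real n * sqrt (V / real n) = sqrt (real n * V)"
    proof -
      have "real n * sqrt (V / real n) = sqrt (real n) * sqrt (real n) * (sqrt V / sqrt (real n))"
        by (simp add: real_sqrt_divide)
      also have "\<dots> = sqrt (real n) * sqrt V"
      proof -
        have "a * a * (b / a) = a * b" if "0 < a" for a b :: real using that by simp
        then show ?thesis using sn by blast
      qed
      finally show ?thesis by (simp add: real_sqrt_mult)
    qed
    have tV: "t * sqrt (V / real n) = sqrt V * l / real n"
      by (simp add: t_def real_sqrt_divide mult.commute)
    \<comment> \<open>The last summand compensates the ln n / 2 in the threshold of
      \<open>delta_opt_le\<close>.\<close>
    define u where "u = \<mu> + (p + K * t) * sqrt (V / real n) + l / (2 * real n)"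
    have nu: "real n * u - l / 2 = real n * \<mu> + (p + K * t) * sqrt (real n * V)"
      unfolding u_def nV[symmetric] using n0 by (simp add: distrib_left)
    have upper: "delta_opt n \<sigma> f \<epsilon> \<le> ereal u"
    proof (rule delta_opt_le[OF assms(1,2) n0])
      show "\<epsilon> + 1 / sqrt (real n) < measure (joint n \<sigma> f) (info_le n \<sigma> f (real n * u - ln (real n) / 2))"
        using close'[of "p + K * t"] up inv t0 unfolding l_def[symmetric] nu
        by (simp add: abs_le_iff algebra_simps)
    qed (use assms in simp)
    define r where "r = real n * \<mu> + (p - K * t) * sqrt (real n * V)"
    have lower: "ereal ((r - ln 3 - l / 2) / real n) \<le> delta_opt n \<sigma> f \<epsilon>"
      unfolding l_def
    proof (rule delta_opt_ge[OF assms(1,2) n0 assms(5)])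
      have "2 / sqrt (real n) \<le> 2 * t" using inv by simp
      then show "measure (joint n \<sigma> f) (info_le n \<sigma> f r)
        + 2 / sqrt (real n) \<le> \<epsilon>"
        using close'[of "p - K * t"] low t0 unfolding r_def[symmetric]
        by (simp add: abs_le_iff algebra_simps)
    qed
    have lo: "(r - ln 3 - l / 2) / real n = \<mu> + (p - K * t) * sqrt (V / real n) - (ln 3 + l / 2) / real n"
      unfolding r_def nV[symmetric] using n0 by (simp add: field_simps)
    \<comment> \<open>Finiteness of the extended real comes from having bounds on both
      sides.\<close>
    obtain d where d: "delta_opt n \<sigma> f \<epsilon> = ereal d"
      using upper lower by (cases "delta_opt n \<sigma> f \<epsilon>") auto
    have d1: "d \<le> u" and d2: "(r - ln 3 - l / 2) / real n \<le> d" using upper lower d by auto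
    \<comment> \<open>\<open>n \<ge> 3\<close> gives \<open>ln 3 \<le> l\<close>, so this constant
      merges into the logarithmic term.\<close>
    have ln3: "(ln 3 + l / 2) / real n \<le> (l + l) / real n"
      using n3 l1 by (intro divide_right_mono add_mono) (auto simp: l_def)
    have half: "l / (2 * real n) \<le> (l + l) / real n" using l1 n0 by (simp add: field_simps)
    have KtV: "K * t * sqrt (V / real n) = K * sqrt V * l / real n"
      by (simp only: mult.assoc tV) simp
    have CC: "(K * sqrt V + 2) * l / real n = K * sqrt V * l / real n + (l + l) / real n"
      by (simp add: field_simps add_divide_distrib)
    have "d - (\<mu> + sqrt (V / real n) * p) \<le> (K * sqrt V + 2) * l / real n"
      using d1 half unfolding u_def CC KtV[symmetric] by (simp add: algebra_simps)
    moreover have "- (d - (\<mu> + sqrt (V / real n) * p)) \<le> (K * sqrt V + 2) * l / real n"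
      using d2 ln3 unfolding lo CC KtV[symmetric] by (simp add: algebra_simps)
    ultimately have "\<bar>d - (\<mu> - sqrt (V / real n) * Qinv \<epsilon>)\<bar> \<le> (K * sqrt V + 2) * l / real n"
      unfolding Q by (simp add: abs_le_iff)
    then show ?case using d by (auto simp: l_def)
  qed
  then show ?thesis unfolding V_def \<mu>_def by blast
qed

end
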